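(* Let $\alpha>0$ and let $f^\omega$ be the random datum $$f^{\omega}(x)=\sum_{n\in\mathbb Z^2}\frac{g_n^\omega}{\langle n\rangle^{1+\alpha}}\,e^{in\cdot x},\qquad x\in\mathbb T^2 ,$$ where $(g_n^\omega)_{n\in\mathbb Z^2}$ are i.i.d. complex standard Gaussian random variables. Let $u^\omega$ be the solution of the periodic two-dimensional quintic nonlinear Schrödinger equation $$i\partial_t u+\Delta u=|u|^4u\ \text{ on }\mathbb T^2,\qquad u(0)=f^\omega .$$ Then, $\omega$-almost surely, $$\lim_{t\to0}u^\omega(t,x)=f^\omega(x)\qquad\text{for almost every }x\in\mathbb T^2 .$$
   Context: $\mathbb T^2=(\mathbb R/2\pi\mathbb Z)^2$, with integrals over $\mathbb T^2$ taken with respect to normalized Lebesgue measure; $\langle n\rangle=(1+|n|^2)^{1/2}$. Almost surely $f^\omega\in\bigcap_{s<\alpha}H^s(\mathbb T^2)\setminus H^\alpha(\mathbb T^2)$. Bourgain spaces: $\|G\|_{X^{s,b}}^2=\sum_{n\in\mathbb Z^2}\int_{\mathbb R}\langle n\rangle^{2s}\langle\tau+|n|^2\rangle^{2b}|\widetilde G(\tau,n)|^2\,d\tau$, with $\widetilde G$ the space-time Fourier transform, and $\|F\|_{X^{s,b}_\delta}=\inf\{\|G\|_{X^{s,b}}: G=F\text{ for }t\in[0,\delta]\}$. Meaning of "the solution" (it is a local-in-time solution): fix $0\le\sigma<1/2$ with $s=\alpha+\sigma>1/2$, and $b=\frac12+\beta$ with $\beta>0$ small enough. Let $\mathcal Q(w)=|w|^4w-3w\int_{\mathbb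 T^2}|w|^4dx$. For almost every $\omega$ there is $\delta_\omega>0$ such that the Cauchy problem $i\partial_tD+\Delta D=\mathcal Q(e^{it\Delta}f^\omega+D)$, $D(0)=0$, has a unique solution $D\in X^{s,b}_{\delta_\omega}$ with $\|D\|_{X^{s,b}_{\delta_\omega}}\le1$. With $w=e^{it\Delta}f^\omega+D$, the solution $u^\omega$ on $[0,\delta_\omega]$ is $$u^\omega(t,x)=e^{-3i\int_0^t\int_{\mathbb T^2}|w(t',y)|^4\,dy\,dt'}\,w(t,x),$$ which is the unique solution of the quintic equation with datum $f^\omega$ in the class of functions of this form, i.e. in the image of $\{e^{it\Delta}f^\omega+D:\|D\|_{X^{s,b}_{\delta_\omega}}\le1\}$ under the map $w\mapsto e^{-3i\int_0^t\int_{\mathbb T^2}|w|^4}w$. *)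

theory Defs
  imports "HOL-Probability.Probability"
begin

section \<open>Fourier series on the torus\<close>

text \<open>
  A function on \<open>(\<real>/2\<pi>\<int>)\<^sup>2\<close> is represented by its values on the fundamental cell
  \<open>[0,2\<pi>)\<^sup>2\<close>; values outside the cell never matter.
\<close>

type_synonym point = "real \<times> real"
type_synonym freq = "int \<times> int"

definition torus :: "point measure" where
  "torus = uniform_measure lborel ({0..<2*pi} \<times> {0..<2*pi})"

definition fvec :: "freq \<Rightarrow> point" where
  "fvec n = (of_int (fst n), of_int (snd n))"

definition char :: "freq \<Rightarrow> point \<Rightarrow> complex" where
  "char n x = cis (fvec n \<bullet> x)"

definition jbr :: "'a::real_normed_vector \<Rightarrow> real" where
  "jbr v = sqrt (1 + (norm v)\<^sup>2)"

definition fcoeff :: "(point \<Rightarrow> complex) \<Rightarrow> freq \<Rightarrow> complex" where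
  "fcoeff F n = (LINT x|torus. F x * cnj (char n x))"

text \<open>
  The pointwise sum of a double Fourier series is the limit of its square partial sums. For
  square-integrable coefficients these converge almost everywhere to the function having
  these coefficients.
\<close>

definition fsum :: "(freq \<Rightarrow> complex) \<Rightarrow> point \<Rightarrow> complex" where
  "fsum c x = lim (\<lambda>N::nat. \<Sum>n\<in>{-int N..int N} \<times> {-int N..int N}. c n * char n x)"

definition schroedinger :: "real \<Rightarrow> (point \<Rightarrow> complex) \<Rightarrow> point \<Rightarrow> complex" where
  "schroedinger t F = fsum (\<lambda>n. cis (- (t * (norm (fvec n))\<^sup>2)) * fcoeff F n)"


section \<open>Bourgain spaces\<close>

text \<open>
  \<open>spacetime_fourier G \<Gamma>\<close>: the function \<open>G \<in> L\<^sup>2(\<real> \<times> \<T>\<^sup>2)\<close> has space-time Fourier transform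
  \<open>\<Gamma> n \<tau> = \<integral>\<integral> e\<^sup>-\<^sup>i\<^sup>(\<^sup>\<tau>\<^sup>t\<^sup>+\<^sup>n\<^sup>\<cdot>\<^sup>x\<^sup>) G(t,x) dx dt\<close>. The integral over \<open>t \<in> \<real>\<close> is that of Plancherel,
  that is, the limit in \<open>L\<^sup>2(d\<tau>)\<close> of the integrals over \<open>[-T,T]\<close>. Thus \<open>\<Gamma> n\<close> is determined
  by \<open>G\<close> up to null sets.
\<close>

definition spacetime_fourier ::
    "(real \<Rightarrow> point \<Rightarrow> complex) \<Rightarrow> (freq \<Rightarrow> real \<Rightarrow> complex) \<Rightarrow> bool" where
  "spacetime_fourier G \<Gamma> \<longleftrightarrow>
     (\<lambda>(t, x). G t x) \<in> borel_measurable (lborel \<Otimes>\<^sub>M torus) \<and>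
     integrable (lborel \<Otimes>\<^sub>M torus) (\<lambda>(t, x). (cmod (G t x))\<^sup>2) \<and>
     (\<forall>n. \<Gamma> n \<in> borel_measurable lborel \<and>
        ((\<lambda>T. \<integral>\<^sup>+\<tau>. ennreal ((cmod (\<Gamma> n \<tau> -
             (LINT t:{-T..T}|lborel. fcoeff (G t) n * cis (- (\<tau> * t)))))\<^sup>2) \<partial>lborel)
          \<longlongrightarrow> 0) at_top)"

definition ennreal_sqrt :: "ennreal \<Rightarrow> ennreal" where
  "ennreal_sqrt a = (if a = top then top else ennreal (sqrt (enn2real a)))"

text \<open>
  For \<open>s, b \<ge> 0\<close> the space \<open>X\<^sup>s\<^sup>,\<^sup>b\<close> is contained in \<open>L\<^sup>2(\<real> \<times> \<T>\<^sup>2)\<close>. The infimum below has essentially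
  one candidate \<open>\<Gamma>\<close>, and it is infinite when \<open>G\<close> is not in \<open>L\<^sup>2\<close>.
\<close>

definition X_norm :: "real \<Rightarrow> real \<Rightarrow> (real \<Rightarrow> point \<Rightarrow> complex) \<Rightarrow> ennreal" where
  "X_norm s b G = (INF \<Gamma> \<in> {\<Gamma>. spacetime_fourier G \<Gamma>}.
     ennreal_sqrt (\<integral>\<^sup>+n. (\<integral>\<^sup>+\<tau>. ennreal
        (jbr (fvec n) powr (2 * s) * jbr (\<tau> + (norm (fvec n))\<^sup>2) powr (2 * b) * (cmod (\<Gamma> n \<tau>))\<^sup>2)
        \<partial>lborel) \<partial>count_space UNIV))"

definition slab :: "real \<Rightarrow> (real \<times> point) measure" where
  "slab \<delta> = restrict_space lborel {0..\<delta>} \<Otimes>\<^sub>M torus"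

definition X_norm_on :: "real \<Rightarrow> real \<Rightarrow> real \<Rightarrow> (real \<Rightarrow> point \<Rightarrow> complex) \<Rightarrow> ennreal" where
  "X_norm_on \<delta> s b F = (INF G \<in> {G. AE (t, x) in slab \<delta>. G t x = F t x}. X_norm s b G)"


section \<open>The equation\<close>

definition quintic :: "(point \<Rightarrow> complex) \<Rightarrow> point \<Rightarrow> complex" where
  "quintic w x = of_real ((cmod (w x)) ^ 4) * w x
     - 3 * w x * of_real (LINT y|torus. (cmod (w y)) ^ 4)"

text \<open>
  \<open>D\<close> solves \<open>i \<partial>\<^sub>t D + \<Delta> D = quintic (e\<^sup>i\<^sup>t\<^sup>\<Delta> f + D)\<close>, \<open>D(0) = 0\<close>, on \<open>[0,\<delta>]\<close>. The equation is
  understood in the sense of distributions in \<open>x\<close>, that is, tested against each character, and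
  is integrated in time. The integrability condition on \<open>|w|\<^sup>5\<close> makes \<open>quintic w\<close> an \<open>L\<^sup>1\<close>
  function.

  An element of \<open>X\<^sup>s\<^sup>,\<^sup>b\<^sub>\<delta>\<close> with \<open>b > 1/2\<close> is a continuous curve of classes of functions of \<open>x\<close>.
  Pointwise convergence as \<open>t \<rightarrow> 0\<close> involves uncountably many times and so depends on the choice
  of a representative of each class. We take the canonical one, the sum of the Fourier series.
\<close>

definition gauged_solution ::
    "real \<Rightarrow> real \<Rightarrow> real \<Rightarrow> (point \<Rightarrow> complex) \<Rightarrow> (real \<Rightarrow> point \<Rightarrow> complex) \<Rightarrow> bool" where
  "gauged_solution \<delta> s b f D \<longleftrightarrow>
     (let w = (\<lambda>t x. schroedinger t f x + D t x) in
       (\<lambda>(t, x). D t x) \<in> borel_measurable (slab \<delta>) \<and>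
       (\<forall>t\<in>{0..\<delta>}. integrable torus (\<lambda>x. (cmod (D t x))\<^sup>2)) \<and>
       (\<forall>t\<in>{0..\<delta>}. \<forall>x. D t x = fsum (fcoeff (D t)) x) \<and>
       X_norm_on \<delta> s b D \<le> 1 \<and>
       integrable (slab \<delta>) (\<lambda>(t, x). (cmod (w t x)) ^ 5) \<and>
       (AE x in torus. D 0 x = 0) \<and>
       (\<forall>t\<in>{0..\<delta>}. \<forall>n. \<i> * fcoeff (D t) n =
          (LINT r:{0..t}|lborel.
             of_real ((norm (fvec n))\<^sup>2) * fcoeff (D r) n + fcoeff (quintic (w r)) n)))"

text \<open>
  The solution of \<open>i \<partial>\<^sub>t u + \<Delta> u = |u|\<^sup>4 u\<close>, \<open>u(0) = f\<close>, on \<open>[0,\<delta>]\<close>, obtained by undoing the gauge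
  transformation.
\<close>

definition nls_solution ::
    "real \<Rightarrow> real \<Rightarrow> real \<Rightarrow> (point \<Rightarrow> complex) \<Rightarrow> (real \<Rightarrow> point \<Rightarrow> complex) \<Rightarrow> bool" where
  "nls_solution \<delta> s b f u \<longleftrightarrow>
     (\<exists>D. gauged_solution \<delta> s b f D \<and>
       (let w = (\<lambda>t x. schroedinger t f x + D t x) in
         \<forall>t\<in>{0..\<delta>}. \<forall>x. u t x =
           cis (- 3 * (LINT r:{0..t}|lborel. (LINT y|torus. (cmod (w r y)) ^ 4))) * w t x))"


section \<open>The random datum\<close>

text \<open>Normalization: \<open>E |X|\<^sup>2 = 1\<close>.\<close>

definition complex_std_gaussian :: "'w measure \<Rightarrow> ('w \<Rightarrow> complex) \<Rightarrow> bool" where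
  "complex_std_gaussian M X \<longleftrightarrow>
     distributed M lborel (\<lambda>\<omega>. Re (X \<omega>)) (normal_density 0 (1 / sqrt 2)) \<and>
     distributed M lborel (\<lambda>\<omega>. Im (X \<omega>)) (normal_density 0 (1 / sqrt 2)) \<and>
     prob_space.indep_var M borel (\<lambda>\<omega>. Re (X \<omega>)) borel (\<lambda>\<omega>. Im (X \<omega>))"

definition datum :: "real \<Rightarrow> (freq \<Rightarrow> 'w \<Rightarrow> complex) \<Rightarrow> 'w \<Rightarrow> point \<Rightarrow> complex" where
  "datum \<alpha> g \<omega> = fsum (\<lambda>n. g n \<omega> / of_real (jbr (fvec n) powr (1 + \<alpha>)))"

end

theory Submission
  imports Defs "HOL-Computational_Algebra.Primes"
begin

text \<open>
  The solution is a phase times \<open>e\<^sup>i\<^sup>t\<^sup>\<Delta> f + D\<close>, and the phase tends to \<open>1\<close> since \<open>\<integral>|w|\<^sup>4 dx\<close> is integrable in time.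

  For the random linear part, Gaussian exponential moments on a grid of size \<open>2\<^sup>-\<^sup>5\<^sup>k\<close> show that
  almost surely the part of the series over \<open>|n| ~ 2\<^sup>k\<close> is \<open>O(k 2\<^sup>-\<^sup>k\<^sup>\<alpha>)\<close> up to summable errors, uniformly in
  \<open>(t, x)\<close>; hence \<open>e\<^sup>i\<^sup>t\<^sup>\<Delta> f\<close> is continuous.

  For \<open>D\<close>, membership in \<open>X\<^sup>s\<^sup>,\<^sup>b\<close> with \<open>b > 1/2\<close> writes \<open>D\<close> as an \<open>L\<^sup>1\<close> superposition of modulated free solutions with
  data in \<open>H\<^sup>s\<close>, so it suffices to bound \<open>sup\<^sub>t |e\<^sup>i\<^sup>t\<^sup>\<Delta> \<phi>|\<close> in \<open>L\<^sup>1\<close> by \<open>N\<^sup>1\<^sup>/\<^sup>2\<^sup>+\<^sup>\<epsilon> \<parallel>\<phi>\<parallel>\<^sub>2\<close> for frequencies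
  \<open>|n| \<le> N\<close>. The square of \<open>e\<^sup>i\<^sup>t\<^sup>\<Delta> \<phi>\<close> has \<open>O(N\<^sup>2)\<close> time frequencies, whose coefficients are controlled in \<open>L\<^sup>2\<close> by the
  number of lattice points on a circle, which is \<open>O(N\<^sup>\<epsilon>)\<close> by the divisor bound. The supremum over
  the square partial sums costs a logarithm (Rademacher-Menshov). As \<open>s > 1/2\<close>, the Fourier series of \<open>D(t)\<close>
  converges uniformly in \<open>t\<close> for almost every \<open>x\<close>, and its coefficients are continuous and vanish at \<open>t = 0\<close>.
\<close>

section \<open>Fourier analysis on the torus\<close>

text \<open>Pointwise convergence asks for control at uncountably many times, so each supremum over
  \<open>t\<close> is replaced by a measurable majorant free of \<open>t\<close>:
  \<open>quartic\<close> and \<open>ring_max\<close> for free solutions, \<open>curve_max\<close>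
  for \<open>D\<close>, exponential sums over a finite grid for the random part. The threshold 1/2
  is the outcome of a fourth moment: the number N^2 of time frequencies multiplies the fourth power
  of the data norm, and the fourth root leaves N^(1/2), up to \<epsilon>. This argument cannot serve
  the datum itself, which lies in H^s only for s < \<alpha>, where \<alpha> may be small; there
  Gaussian independence replaces smoothness. A second obstacle is that the Bourgain norm speaks of
  an extension \<open>G\<close> that equals \<open>D\<close> only almost everywhere on the slab,
  whereas the limit needs \<open>D\<close> at every \<open>t\<close>. The bridge is continuity on
  both sides: the coefficients of \<open>D\<close> are continuous by the integrated equation, the
  inversion integrals of \<Gamma> are continuous because \<Gamma> is integrable in time frequency
  when b > 1/2, and so they agree at every interior time.\<close>

abbreviation cell :: "point set" where "cell \<equiv> {0..<2*pi} \<times> {0..<2*pi}"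

lemma borel_measurable_cnj [measurable (raw)]:
  "f \<in> borel_measurable M \<Longrightarrow> (\<lambda>x. cnj (f x)) \<in> borel_measurable M"
  by (rule measurable_compose[of f M borel cnj borel]) (auto intro!: borel_measurable_continuous_onI continuous_intros)

lemma borel_measurable_cis [measurable (raw)]:
  "f \<in> borel_measurable M \<Longrightarrow> (\<lambda>x. cis (f x)) \<in> borel_measurable M"
  by (rule measurable_compose[of f M borel cis borel]) (auto intro!: borel_measurable_continuous_onI continuous_intros)

lemma emeasure_cell: "emeasure lborel cell = ennreal (4 * pi\<^sup>2)"
proof -
  have "emeasure lborel cell = emeasure (lborel :: real measure) {0..<2*pi} * emeasure (lborel :: real measure) {0..<2*pi}"
    unfolding lborel_prod[symmetric] by (rule lborel.emeasure_pair_measure_Times) auto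
  also have "\<dots> = ennreal (4 * pi\<^sup>2)"
    by (simp add: ennreal_mult[symmetric] power2_eq_square)
  finally show ?thesis .
qed

lemma sets_cell [measurable]: "cell \<in> sets borel"
  unfolding borel_prod[symmetric] by (rule pair_measureI) auto

lemma prob_space_torus: "prob_space torus"
  unfolding torus_def by (rule prob_space_uniform_measure) (auto simp: emeasure_cell)

interpretation torus: prob_space torus
  by (rule prob_space_torus)

lemma sets_torus [simp, measurable_cong]: "sets torus = sets borel"
  by (simp add: torus_def)

lemma space_torus [simp]: "space torus = UNIV"
  by (simp add: torus_def)

lemma torus_density: "torus = density lborel (\<lambda>x. ennreal (indicator cell x / (4 * pi\<^sup>2)))"
  unfolding torus_def uniform_measure_def emeasure_cell
  by (intro density_cong) (auto simp: indicator_def divide_ennreal[symmetric])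

lemma integral_torus:
  fixes f :: "point \<Rightarrow> complex"
  assumes [measurable]: "f \<in> borel_measurable borel"
  shows "(LINT x|torus. f x) = (LINT x:cell|lborel. f x) / of_real (4 * pi\<^sup>2)"
proof -
  have "(LINT x|torus. f x) = (LINT x|lborel. (indicator cell x / (4 * pi\<^sup>2)) *\<^sub>R f x)"
    unfolding torus_density by (rule integral_density) (auto simp: indicator_def)
  also have "\<dots> = (LINT x|lborel. (indicator cell x *\<^sub>R f x) / of_real (4 * pi\<^sup>2))"
    by (intro Bochner_Integration.integral_cong) (auto simp: scaleR_conv_of_real)
  finally show ?thesis by (simp add: set_lebesgue_integral_def)
qed

lemma integral_cis_period:
  "(LINT x:{0..<2*pi}|lborel. cis (of_int k * x)) = (if k = 0 then of_real (2*pi) else 0)"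
proof -
  have *: "(LINT x:{0..<2*pi}|lborel. cis (of_int k * x)) = (LINT x|lborel. indicator {0..2*pi} x *\<^sub>R cis (of_int k * x))"
    unfolding set_lebesgue_integral_def
  proof (rule integral_cong_AE)
    show "AE x in lborel. indicator {0..<2*pi} x *\<^sub>R cis (of_int k * x) = indicator {0..2*pi} x *\<^sub>R cis (of_int k * x)"
      using AE_lborel_singleton[of "2*pi"] by eventually_elim (auto simp: indicator_def)
  qed auto
  show ?thesis
  proof (cases "k = 0")
    case True
    then show ?thesis unfolding * by (simp add: scaleR_conv_of_real)
  next
    case False
    have "(LINT x|lborel. indicator {0..2*pi} x *\<^sub>R cis (of_int k * x)) =
        cis (of_int k * (2*pi)) / (\<i> * of_int k) - cis (of_int k * 0) / (\<i> * of_int k)"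
    proof (rule integral_FTC_Icc)
      show "((\<lambda>x. cis (of_int k * x) / (\<i> * of_int k)) has_vector_derivative cis (of_int k * x)) (at x within {0..2*pi})" for x
        unfolding has_vector_derivative_def using False
        by (auto intro!: derivative_eq_intros simp: scaleR_conv_of_real field_simps)
    qed (auto intro!: continuous_intros)
    also have "cis (of_int k * (2*pi)) = 1"
      using cis_multiple_2pi[of "of_int k"] by (simp add: mult_ac)
    finally show ?thesis unfolding * using False by simp
  qed
qed

lemma char_Pair: "char n (x, y) = cis (of_int (fst n) * x) * cis (of_int (snd n) * y)"
  by (simp add: char_def fvec_def cis_mult)

lemma char_add: "char (n + m) x = char n x * char m x"
  by (cases x) (simp add: char_Pair cis_mult algebra_simps)

lemma cnj_char: "cnj (char n x) = char (- n) x"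
  by (simp add: char_def fvec_def cis_cnj inner_Pair_0 algebra_simps inner_prod_def)

lemma char_0 [simp]: "char 0 x = 1"
  by (cases x) (simp add: char_Pair)

lemma norm_char [simp]: "norm (char n x) = 1"
  by (simp add: char_def)

lemma continuous_on_char [continuous_intros]: "continuous_on S (char n)"
  unfolding char_def by (intro continuous_intros)

lemma char_measurable [measurable]: "char n \<in> borel_measurable borel"
  by (intro borel_measurable_continuous_onI continuous_intros)

lemma integrable_char: "integrable torus (char n)"
  by (rule torus.integrable_const_bound[of _ 1]) auto

lemma integral_char: "(LINT x|torus. char n x) = (if n = 0 then 1 else 0)"
proof -
  obtain k l where n: "n = (k, l)" by (cases n)
  define I where "I = (\<lambda>(k::int) (x::real). indicator {0..<2*pi} x *\<^sub>R cis (of_int k * x))"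
  have int: "integrable lborel (I k)" for k
  proof -
    have "set_integrable lborel {0..2*pi} (\<lambda>x. cis (of_int k * x))"
      by (intro borel_integrable_atLeastAtMost') (auto intro!: continuous_intros)
    then have "set_integrable lborel {0..<2*pi} (\<lambda>x. cis (of_int k * x))"
      by (rule set_integrable_subset) auto
    then show ?thesis by (simp add: set_integrable_def I_def)
  qed
  have eq: "(LINT x:cell|lborel. char n x) = (LINT z|(lborel \<Otimes>\<^sub>M lborel). I k (fst z) * I l (snd z))"
    unfolding set_lebesgue_integral_def lborel_prod I_def n
    by (intro Bochner_Integration.integral_cong) (auto simp: char_Pair indicator_def)
  also have "\<dots> = (LINT x|lborel. LINT y|lborel. I k x * I l y)"
  proof -
    have [measurable]: "I k \<in> borel_measurable borel" for k unfolding I_def by measurable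
    have "integrable (lborel \<Otimes>\<^sub>M lborel) (\<lambda>(x, y). I k x * I l y)"
    proof (rule Bochner_Integration.integrable_bound)
      show "integrable (lborel \<Otimes>\<^sub>M lborel) (indicator cell :: _ \<Rightarrow> real)"
        unfolding lborel_prod by (rule integrable_real_indicator) (auto simp: emeasure_cell)
    qed (auto simp: I_def indicator_def norm_mult)
    then show ?thesis
      using lborel_pair.integral_fst'[of "\<lambda>(x, y). I k x * I l y"] by (simp add: case_prod_unfold)
  qed
  also have "\<dots> = (LINT x|lborel. I k x) * (LINT y|lborel. I l y)"
    by simp
  also have "\<dots> = (if k = 0 then of_real (2*pi) else 0) * (if l = 0 then of_real (2*pi) else 0)"
    using integral_cis_period unfolding I_def set_lebesgue_integral_def by simp
  finally show ?thesis
    by (subst integral_torus) (auto simp: n zero_prod_def power2_eq_square)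
qed

lemma fcoeff_char: "fcoeff (char m) n = (if m = n then 1 else 0)"
proof -
  have "fcoeff (char m) n = (LINT x|torus. char (m - n) x)"
    unfolding fcoeff_def cnj_char char_add[symmetric] by simp
  then show ?thesis by (simp add: integral_char)
qed

lemma fcoeff_sum:
  assumes "finite A"
  shows "fcoeff (\<lambda>x. \<Sum>n\<in>A. c n * char n x) m = (if m \<in> A then c m else 0)"
proof -
  have int: "integrable torus (\<lambda>x. c n * (char n x * cnj (char m x)))" for n
    unfolding cnj_char char_add[symmetric] by (intro integrable_mult_right integrable_char)
  have "fcoeff (\<lambda>x. \<Sum>n\<in>A. c n * char n x) m = (\<Sum>n\<in>A. c n * fcoeff (char n) m)"
    unfolding fcoeff_def sum_distrib_right mult.assoc
    by (subst Bochner_Integration.integral_sum) (use int in auto)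
  also have "\<dots> = (if m \<in> A then c m else 0)"
    using assms by (simp add: fcoeff_char if_distrib cong: if_cong)
  finally show ?thesis .
qed

lemma parseval_finite:
  assumes "finite A"
  shows "(\<integral>\<^sup>+x. ennreal ((cmod (\<Sum>n\<in>A. c n * char n x))\<^sup>2) \<partial>torus) = ennreal (\<Sum>n\<in>A. (cmod (c n))\<^sup>2)"
proof -
  let ?F = "\<lambda>x. \<Sum>n\<in>A. c n * char n x"
  have bd: "cmod (?F x) \<le> (\<Sum>n\<in>A. cmod (c n))" for x
    by (rule order_trans[OF norm_sum]) (simp add: norm_mult)
  have intF: "integrable torus (\<lambda>x. ?F x * cnj (char n x))" for n
    by (rule torus.integrable_const_bound[of _ "\<Sum>n\<in>A. cmod (c n)"]) (auto simp: norm_mult bd)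
  have int2: "integrable torus (\<lambda>x. (cmod (?F x))\<^sup>2)"
    by (rule torus.integrable_const_bound[of _ "(\<Sum>n\<in>A. cmod (c n))\<^sup>2"]) (auto simp: power_mono bd simp del: norm_sum)
  have "of_real (LINT x|torus. (cmod (?F x))\<^sup>2) = (LINT x|torus. of_real ((cmod (?F x))\<^sup>2))"
    by (rule integral_of_real[symmetric, OF int2])
  also have "\<dots> = (LINT x|torus. (\<Sum>n\<in>A. cnj (c n) * (?F x * cnj (char n x))))"
    unfolding complex_norm_square by (intro Bochner_Integration.integral_cong) (auto simp: sum_distrib_left mult_ac)
  also have "\<dots> = (\<Sum>n\<in>A. cnj (c n) * fcoeff ?F n)"
    unfolding fcoeff_def by (subst Bochner_Integration.integral_sum) (use intF in \<open>auto\<close>)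
  also have "\<dots> = (\<Sum>n\<in>A. of_real ((cmod (c n))\<^sup>2))"
    unfolding fcoeff_sum[OF assms] complex_norm_square by (intro sum.cong) (auto simp: mult_ac)
  finally have "(LINT x|torus. (cmod (?F x))\<^sup>2) = (\<Sum>n\<in>A. (cmod (c n))\<^sup>2)"
    unfolding of_real_sum[symmetric] of_real_eq_iff .
  then show ?thesis by (subst nn_integral_eq_integral[OF int2]) auto
qed

section \<open>Square partial sums and convergence along dyadic blocks\<close>

definition sq :: "nat \<Rightarrow> freq set" where
  "sq N = {-int N..int N} \<times> {-int N..int N}"

lemma finite_sq [simp]: "finite (sq N)"
  by (simp add: sq_def)

lemma sq_mono: "M \<le> N \<Longrightarrow> sq M \<subseteq> sq N"
  by (auto simp: sq_def)

lemma card_sq: "card (sq N) = (2 * N + 1)\<^sup>2"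
proof -
  have "card {-int N..int N} = 2 * N + 1" by simp
  then show ?thesis by (simp add: sq_def card_cartesian_product power2_eq_square)
qed

lemma fsum_sq: "fsum c x = lim (\<lambda>N. \<Sum>n\<in>sq N. c n * char n x)"
  by (simp add: fsum_def sq_def)

lemma sum_sq_diff:
  fixes f :: "freq \<Rightarrow> complex"
  assumes "M \<le> N"
  shows "(\<Sum>n\<in>sq N. f n) - (\<Sum>n\<in>sq M. f n) = (\<Sum>n\<in>sq N - sq M. f n)"
  using sum.subset_diff[OF sq_mono[OF assms], of f] by simp

text \<open>Telescoping along the powers of two: a cutoff in the k-th dyadic block differs from the
  cutoff 2^K by at most the sum of \<open>b\<close> over K, ..., k, a section of a convergent
  series. Only the oscillation inside each block has to be known, and uniformity on \<open>T\<close>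
  comes from \<open>b\<close> not depending on \<open>t\<close>.\<close>

lemma uniformly_convergent_dyadic:
  fixes f :: "nat \<Rightarrow> 't \<Rightarrow> complex"
  assumes b: "summable b"
    and le: "\<And>k N t. t \<in> T \<Longrightarrow> 2 ^ k \<le> N \<Longrightarrow> N \<le> 2 ^ Suc k \<Longrightarrow> cmod (f N t - f (2 ^ k) t) \<le> b k"
  shows "uniformly_convergent_on T f"
proof (rule Cauchy_uniformly_convergent, cases "T = {}")
  case False
  then obtain t0 where "t0 \<in> T" by auto
  then have b0: "b k \<ge> 0" for k
    using le[of t0 k "2^k"] by simp
  have tele: "cmod (f N t - f (2 ^ K) t) \<le> (\<Sum>j\<in>{K..<K+k}. b j) + b (K + k)"
    if "t \<in> T" "2 ^ (K + k) \<le> N" "N \<le> 2 ^ Suc (K + k)" for t K k N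
    using that
  proof (induction k arbitrary: N)
    case 0
    then show ?case using le[of t K N] by simp
  next
    case (Suc k)
    have "cmod (f N t - f (2 ^ K) t) \<le> cmod (f N t - f (2 ^ (K + Suc k)) t) + cmod (f (2 ^ (K + Suc k)) t - f (2 ^ K) t)"
      using norm_triangle_ineq[of "f N t - f (2 ^ (K + Suc k)) t" "f (2 ^ (K + Suc k)) t - f (2 ^ K) t"] by simp
    also have "\<dots> \<le> b (K + Suc k) + ((\<Sum>j\<in>{K..<K+k}. b j) + b (K + k))"
      using Suc.prems by (intro add_mono le Suc.IH) auto
    finally show ?case by (simp add: algebra_simps)
  qed
  show "uniformly_Cauchy_on T f"
    unfolding uniformly_Cauchy_on_def
  proof (intro allI impI)
    fix e :: real assume e: "e > 0"
    obtain K where K: "\<And>m n. m \<ge> K \<Longrightarrow> norm (sum b {m..<n}) < e / 2"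
      using b[unfolded summable_Cauchy, rule_format, of "e/2"] e by auto
    have near: "dist (f N t) (f (2 ^ K) t) < e / 2" if t: "t \<in> T" and N: "N \<ge> 2 ^ K" for t N
    proof -
      have "N > 0" using N by (metis gr0I not_less_zero not_le power_eq_0_iff zero_less_power pos2 le_zero_eq zero_neq_numeral)
      then obtain k where k: "2 ^ k \<le> N" "N < 2 ^ Suc k" using ex_power_ivl1[of 2 N] by auto
      have "(2::nat) ^ K < 2 ^ Suc k" using N k(2) by (rule le_less_trans)
      then have "K \<le> k" using power_less_imp_less_exp[of "2::nat" K "Suc k"] by simp
      then obtain l where l: "k = K + l" using le_Suc_ex by blast
      have "dist (f N t) (f (2 ^ K) t) \<le> (\<Sum>j\<in>{K..<Suc (K+l)}. b j)"
        using tele[OF t, of K l N] k l by (simp add: dist_norm)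
      also have "\<dots> < e / 2" using K[of K "Suc (K + l)"] unfolding real_norm_def by linarith
      finally show ?thesis .
    qed
    show "\<exists>M. \<forall>x\<in>T. \<forall>m\<ge>M. \<forall>n\<ge>M. dist (f m x) (f n x) < e"
      using near by (intro exI[of _ "2 ^ K"] ballI allI impI) (rule dist_triangle_half_l, auto)
  qed
qed (simp add: uniformly_Cauchy_on_def)

lemma uniform_limit_dyadic:
  fixes f :: "nat \<Rightarrow> 't \<Rightarrow> complex"
  assumes "summable b"
    and "\<And>k N t. t \<in> T \<Longrightarrow> 2 ^ k \<le> N \<Longrightarrow> N \<le> 2 ^ Suc k \<Longrightarrow> cmod (f N t - f (2 ^ k) t) \<le> b k"
  shows "uniform_limit T f (\<lambda>t. lim (\<lambda>N. f N t)) sequentially"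
  using uniformly_convergent_dyadic[of b T f, OF assms] by (simp add: uniformly_convergent_uniform_limit_iff)

section \<open>Lattice points on circles\<close>

text \<open>Each divisor of a product is a product of divisors of the two factors. This inequality
  is all that the induction over prime powers uses.\<close>

lemma card_divisors_mult_le: "card {d. d dvd a * b} \<le> card {d. d dvd a} * card {d. d dvd b}"
  if "a > 0" "b > 0" for a b :: nat
proof -
  have "{d. d dvd a * b} \<subseteq> (\<lambda>(x,y). x * y) ` ({d. d dvd a} \<times> {d. d dvd b})"
  proof
    fix d assume "d \<in> {d. d dvd a * b}"
    then obtain x y where "d = x * y" "x dvd a" "y dvd b" using division_decomp[of d a b] by auto
    then show "d \<in> (\<lambda>(x,y). x * y) ` ({d. d dvd a} \<times> {d. d dvd b})" by force
  qed
  then have "card {d. d dvd a * b} \<le> card ((\<lambda>(x,y). x * y) ` ({d. d dvd a} \<times> {d. d dvd b}))"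
    using that by (intro card_mono) auto
  also have "\<dots> \<le> card ({d. d dvd a} \<times> {d. d dvd b})"
    using that by (intro card_image_le) auto
  finally show ?thesis by (simp add: card_cartesian_product)
qed

lemma card_divisors_prime_power: "card {d. d dvd p ^ a} = Suc a" if "prime p" for p :: nat
proof -
  have "{d. d dvd p ^ a} = (\<lambda>i. p ^ i) ` {..a}"
    using divides_primepow_nat[OF that] by auto
  moreover have "inj_on (\<lambda>i. p ^ i) {..a}"
    using that by (auto simp: inj_on_def dest: prime_gt_1_nat)
  ultimately show ?thesis by (simp add: card_image)
qed

text \<open>Only the primes below \<open>2 powr (1 / \<epsilon>)\<close> contribute a factor exceeding \<open>1\<close> to the quotient of both
  sides, and each of these factors is at most \<open>1 + 1 / (\<epsilon> ln 2)\<close>.\<close>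

lemma divisor_bound:
  fixes \<epsilon> :: real
  assumes "\<epsilon> > 0"
  shows "\<exists>C\<ge>1. \<forall>m::nat. m > 0 \<longrightarrow> real (card {d. d dvd m}) \<le> C * real m powr \<epsilon>"
proof -
  define K where "K = 1 + 1 / (\<epsilon> * ln 2)"
  define S where "S = {p::nat. prime p \<and> real p < 2 powr (1 / \<epsilon>)}"
  have K: "K \<ge> 1" using assms by (simp add: K_def)
  have finS: "finite S"
    by (rule finite_subset[of _ "{..nat \<lceil>2 powr (1 / \<epsilon>)\<rceil>}"]) (auto simp: S_def, linarith)
  have local: "real (Suc a) \<le> (if p \<in> S then K else 1) * real (p ^ a) powr \<epsilon>"
    if p: "prime p" for p a
  proof -
    have p2: "real p \<ge> 2" using prime_ge_2_nat[OF p] by simp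
    have eq: "real (p ^ a) powr \<epsilon> = (real p powr \<epsilon>) ^ a"
      using p2 by (simp add: powr_powr powr_realpow[symmetric] mult.commute)
    show ?thesis
    proof (cases "p \<in> S")
      case False
      then have "(2 powr (1 / \<epsilon>)) powr \<epsilon> \<le> real p powr \<epsilon>"
        using assms p by (intro powr_mono2) (auto simp: S_def)
      then have "2 \<le> real p powr \<epsilon>" using assms by (simp add: powr_powr)
      then have "2 ^ a \<le> (real p powr \<epsilon>) ^ a" by (intro power_mono) auto
      moreover have "Suc a \<le> 2 ^ a" by (simp add: Suc_leI)
      then have "real (Suc a) \<le> 2 ^ a"
        by (metis of_nat_le_iff of_nat_numeral of_nat_power)
      ultimately show ?thesis using False eq by simp
    next
      case True
      \<comment> \<open>For a small prime the factor a + 1 is absorbed by 1 + x \<le> exp x. The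
        constant satisfies K \<ge> 1 and K \<epsilon> ln 2 \<ge> 1, so a + 1 \<le> K (1 + a
        \<epsilon> ln 2).\<close>
      have "1 + real a * (\<epsilon> * ln 2) \<le> exp (real a * (\<epsilon> * ln 2))" by (rule exp_ge_add_one_self)
      also have "\<dots> = (2 powr \<epsilon>) ^ a" by (simp add: powr_def exp_of_nat_mult)
      also have "\<dots> \<le> (real p powr \<epsilon>) ^ a"
        using p2 assms by (intro power_mono powr_mono2) auto
      finally have *: "1 + real a * (\<epsilon> * ln 2) \<le> (real p powr \<epsilon>) ^ a" .
      have "real (Suc a) \<le> K * (1 + real a * (\<epsilon> * ln 2))"
        using assms by (simp add: K_def field_simps)
      also have "\<dots> \<le> K * (real p powr \<epsilon>) ^ a"
        using * K by (intro mult_left_mono) auto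
      finally show ?thesis using True eq by simp
    qed
  qed
  \<comment> \<open>Strong induction that splits off the full power of one prime. The exponent of
    \<open>K\<close> counts the distinct small primes of \<open>m\<close>, hence never exceeds the
    size of \<open>S\<close>, whatever \<open>m\<close> is.\<close>
  have main: "real (card {d. d dvd m}) \<le> K ^ card (S \<inter> prime_factors m) * real m powr \<epsilon>"
    if "m > 0" for m
    using that
  proof (induction m rule: less_induct)
    case (less m)
    show ?case
    proof (cases "m = 1")
      case True
      then show ?thesis by simp
    next
      case False
      then obtain p where p: "prime p" "p dvd m"
        using prime_factor_nat by blast
      define a where "a = multiplicity p m"
      obtain m' where m': "m = p ^ a * m'" "\<not> p dvd m'"
        using multiplicity_decompose'[of m p] less.prems p by (metis a_def not_prime_unit gr_implies_not0)
      have m'0: "m' > 0" using m' less.prems by (cases m') auto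
      have a0: "a > 0" using p less.prems by (simp add: a_def prime_multiplicity_gt_zero_iff)
      have "p ^ a > 1" using prime_gt_1_nat[OF p(1)] a0 by (rule one_less_power)
      then have lt: "m' < m" using m' m'0 by simp
      have pf: "prime_factors m = insert p (prime_factors m')"
        using m' m'0 p a0 less.prems
        by (auto simp: prime_factors_product prime_factorization_prime_power split: if_splits)
      have pn: "p \<notin> prime_factors m'" using m' by auto
      have "real (card {d. d dvd m}) \<le> real (Suc a * card {d. d dvd m'})"
        using card_divisors_mult_le[of "p ^ a" m'] m'0 p(1) m'(1)
        by (simp only: card_divisors_prime_power[OF p(1)] of_nat_le_iff) (simp add: prime_gt_0_nat)
      also have "\<dots> \<le> ((if p \<in> S then K else 1) * real (p ^ a) powr \<epsilon>) *
          (K ^ card (S \<inter> prime_factors m') * real m' powr \<epsilon>)"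
        unfolding of_nat_mult using K
        by (intro mult_mono local p less.IH lt m'0) auto
      also have "\<dots> = K ^ card (S \<inter> prime_factors m) * real m powr \<epsilon>"
        using pn finS by (auto simp: pf m'(1)[symmetric] Int_insert_right card_insert_if) (auto simp: m'(1) powr_mult)
      finally show ?thesis .
    qed
  qed
  have "real (card {d. d dvd m}) \<le> K ^ card S * real m powr \<epsilon>" if "m > 0" for m
  proof -
    have "K ^ card (S \<inter> prime_factors m) \<le> K ^ card S"
      using K finS by (intro power_increasing card_mono) auto
    then show ?thesis using main[OF that]
      by (meson mult_right_mono order_trans powr_ge_zero)
  qed
  then show ?thesis using K by (intro exI[of _ "K ^ card S"]) (auto simp: one_le_power)
qed

section \<open>Representations as sums of two squares\<close>

lemma finite_sum_squares: "finite {(x::int, y). x\<^sup>2 + y\<^sup>2 = m}"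
proof (rule finite_subset[where B = "{-\<bar>m\<bar>..\<bar>m\<bar>} \<times> {-\<bar>m\<bar>..\<bar>m\<bar>}"])
  have le: "\<bar>x\<bar> \<le> x\<^sup>2" for x :: int
    using self_le_power[of "\<bar>x\<bar>" 2] by (cases "x = 0") auto
  show "{(x, y). x\<^sup>2 + y\<^sup>2 = m} \<subseteq> {-\<bar>m\<bar>..\<bar>m\<bar>} \<times> {-\<bar>m\<bar>..\<bar>m\<bar>}"
  proof (rule subsetI)
    fix z assume "z \<in> {(x, y). x\<^sup>2 + y\<^sup>2 = m}"
    then obtain x y where z: "z = (x, y)" "x\<^sup>2 + y\<^sup>2 = m" by auto
    have "\<bar>x\<bar> \<le> m" "\<bar>y\<bar> \<le> m"
      using le[of x] le[of y] zero_le_power2[of x] zero_le_power2[of y] unfolding z(2)[symmetric] by linarith+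
    then show "z \<in> {-\<bar>m\<bar>..\<bar>m\<bar>} \<times> {-\<bar>m\<bar>..\<bar>m\<bar>}" by (auto simp: z)
  qed
qed auto

text \<open>If \<open>x \<equiv> r y\<close>, \<open>x' \<equiv> r y'\<close> modulo \<open>m = x\<^sup>2 + y\<^sup>2 = x'\<^sup>2 + y'\<^sup>2\<close> with \<open>r\<^sup>2 \<equiv> -1\<close>, then \<open>m\<close> divides both entries of
  the Gaussian integer \<open>(x - i y) (x' + i y')\<close>, whose norm is \<open>m\<^sup>2\<close>; so \<open>x' + i y'\<close> is a unit times \<open>x + i y\<close>.\<close>

lemma card_sum_squares_root_le:
  fixes m r :: int
  assumes "m > 0" "m dvd r\<^sup>2 + 1"
  shows "card {(x, y). x\<^sup>2 + y\<^sup>2 = m \<and> m dvd x - r * y} \<le> 4" (is "card ?A \<le> 4")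
proof (cases "?A = {}")
  case True
  then show ?thesis by (simp only: card.empty)
next
  case False
  then obtain x y where xy: "x\<^sup>2 + y\<^sup>2 = m" "m dvd x - r * y" by auto
  have "?A \<subseteq> {(x, y), (-x, -y), (-y, x), (y, -x)}"
  proof (rule subsetI)
    fix z assume "z \<in> ?A"
    then obtain x' y' where z: "z = (x', y')" "x'\<^sup>2 + y'\<^sup>2 = m" "m dvd x' - r * y'" by auto
    \<comment> \<open>The real part of (x - i y) (x' + i y'), written as a combination of the three
      known multiples of \<open>m\<close>; the imaginary part is treated likewise below.\<close>
    have "x * x' + y * y' = (x - r * y) * x' + r * y * (x' - r * y') + (r\<^sup>2 + 1) * y * y'"
      by (simp add: algebra_simps power2_eq_square)
    then have "m dvd x * x' + y * y'" using xy(2) z(3) assms(2) by (metis dvd_add dvd_mult dvd_mult2)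
    then obtain c where c: "x * x' + y * y' = m * c" by (elim dvdE)
    have "x * y' - y * x' = (x - r * y) * y' - y * (x' - r * y')"
      by (simp add: algebra_simps)
    then have "m dvd x * y' - y * x'" using xy(2) z(3) by (metis dvd_diff dvd_mult dvd_mult2)
    then obtain d where d: "x * y' - y * x' = m * d" by (elim dvdE)
    have "m\<^sup>2 * (c\<^sup>2 + d\<^sup>2) = (m * c)\<^sup>2 + (m * d)\<^sup>2" by (simp add: algebra_simps power_mult_distrib)
    also have "\<dots> = (x\<^sup>2 + y\<^sup>2) * (x'\<^sup>2 + y'\<^sup>2)" unfolding c[symmetric] d[symmetric] by (simp add: algebra_simps power2_eq_square)
    also have "\<dots> = m\<^sup>2" using xy z by (simp add: power2_eq_square)
    finally have cd: "c\<^sup>2 + d\<^sup>2 = 1" using assms(1) by simp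
    \<comment> \<open>Multiplying (x - i y) (x' + i y') = m (c + i d) by x + i y gives x' + i y' =
      (c + i d) (x + i y), since (x + i y) (x - i y) = m.\<close>
    have "m * x' = (x * x' + y * y') * x - (x * y' - y * x') * y"
      by (simp add: xy(1)[symmetric] algebra_simps power2_eq_square)
    also have "\<dots> = m * (c * x - d * y)" unfolding c d by (simp add: algebra_simps)
    finally have "m * x' = m * (c * x - d * y)" .
    then have x': "x' = c * x - d * y" using assms(1) by simp
    have "m * y' = (x * x' + y * y') * y + (x * y' - y * x') * x"
      by (simp add: xy(1)[symmetric] algebra_simps power2_eq_square)
    also have "\<dots> = m * (c * y + d * x)" unfolding c d by (simp add: algebra_simps)
    finally have "m * y' = m * (c * y + d * x)" .
    then have y': "y' = c * y + d * x" using assms(1) by simp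
    have "c\<^sup>2 \<le> 1" "d\<^sup>2 \<le> 1"
      using cd zero_le_power2[of c] zero_le_power2[of d] by linarith+
    then have "\<bar>c\<bar> \<le> 1" "\<bar>d\<bar> \<le> 1"
      using zero_le_power2[of c] zero_le_power2[of d] abs_le_square_iff[of c 1] abs_le_square_iff[of d 1]
      by auto
    then have "c \<in> {-1, 0, 1}" "d \<in> {-1, 0, 1}" by auto
    then show "z \<in> {(x, y), (-x, -y), (-y, x), (y, -x)}"
      using cd by (auto simp: z(1) x' y')
  qed
  then have "card ?A \<le> card {(x, y), (-x, -y), (-y, x), (y, -x)}" by (intro card_mono) auto
  also have "\<dots> \<le> 4" using card_length[of "[(x, y), (-x, -y), (-y, x), (y, -x)]"] by simp
  finally show ?thesis .
qed

text \<open>Roots \<open>r\<close> of \<open>-1\<close> modulo \<open>m\<close> are compared with a fixed root \<open>q\<close>: each is congruent to \<open>q\<close> modulo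
  \<open>d = gcd (r - q) m\<close> and to \<open>-q\<close> modulo \<open>m / d\<close>, which determines it up to a factor \<open>2\<close> in the modulus.\<close>

lemma card_roots_minus_one_le:
  fixes m :: nat
  assumes m: "m > 0"
  shows "card {r. 0 \<le> r \<and> r < int m \<and> int m dvd r\<^sup>2 + 1} \<le> 2 * card {d. d dvd m}" (is "card ?R \<le> _")
proof (cases "?R = {}")
  case True
  then show ?thesis by (simp only: card.empty)
next
  case False
  then obtain q where q: "int m dvd q\<^sup>2 + 1" by auto
  define F where "F = (\<lambda>d::nat. {r. r \<in> ?R \<and> gcd (r - q) (int m) = int d})"
  have finR: "finite ?R" by (rule finite_subset[of _ "{0..int m}"]) auto
  have sub: "?R \<subseteq> (\<Union>d\<in>{d. d dvd m}. F d)"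
  proof
    fix r assume r: "r \<in> ?R"
    have "r \<in> F (nat (gcd (r - q) (int m)))" using r by (simp add: F_def)
    moreover have "nat (gcd (r - q) (int m)) dvd m"
      by (metis gcd_dvd2 gcd_ge_0_int int_dvd_int_iff nat_0_le)
    ultimately show "r \<in> (\<Union>d\<in>{d. d dvd m}. F d)" by auto
  qed
  have two: "int m dvd 2 * (r - r')" if r: "r \<in> F d" "r' \<in> F d" for r r' d
  proof -
    \<comment> \<open>If d k = m, then d k divides (s - q) (s + q). As d is the exact gcd of s - q
      and m, the quotient (s - q) / d is coprime to k, and k must divide s + q.\<close>
    have *: "int d dvd s - q \<and> int d * k = int m \<longrightarrow> k dvd s + q" if "s \<in> F d" for s k
    proof
      assume k: "int d dvd s - q \<and> int d * k = int m"
      have g: "gcd (s - q) (int m) = int d" using that by (simp add: F_def)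
      have "int m dvd (s\<^sup>2 + 1) - (q\<^sup>2 + 1)" using that q by (intro dvd_diff) (auto simp: F_def)
      then have "int d * k dvd (s - q) * (s + q)" using k by (simp add: algebra_simps power2_eq_square)
      moreover obtain l where l: "s - q = int d * l" using k by auto
      moreover have d0: "int d \<noteq> 0" using k m by (metis mult_zero_left of_nat_0_less_iff less_irrefl)
      ultimately have "k dvd l * (s + q)" by (simp add: mult.assoc)
      moreover have "coprime k l"
      proof -
        have "gcd (int d * l) (int d * k) = int d" using g l k by simp
        then have "gcd l k = 1" using d0 by (simp add: gcd_mult_distrib_int[symmetric])
        then show ?thesis by (simp add: coprime_iff_gcd_eq_1 gcd.commute)
      qed
      ultimately show "k dvd s + q" by (simp add: coprime_dvd_mult_right_iff)
    qed
    have dd: "int d dvd s - q" if "s \<in> F d" for s using gcd_dvd1[of "s - q" "int m"] that by (simp add: F_def del: gcd_dvd1)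
    have "int d dvd int m" using gcd_dvd2[of "r - q" "int m"] r(1) by (simp add: F_def del: gcd_dvd2)
    then obtain k where k: "int m = int d * k" by (elim dvdE)
    have kd: "k dvd r - r'" using *[OF r(1), of k] *[OF r(2), of k] dd[OF r(1)] dd[OF r(2)] k
      dvd_diff[of k "r + q" "r' + q"] by simp
    have dd': "int d dvd r - r'" using dd[OF r(1)] dd[OF r(2)]
      dvd_diff[of "int d" "r - q" "r' - q"] by simp
    \<comment> \<open>The factors d and k of m need not be coprime. Their gcd divides r - q and r +
      q, hence 2 q; as it also divides q^2 + 1, it divides 2 (q^2 + 1) - 2 q q = 2.\<close>
    define e where "e = gcd (int d) k"
    have e2: "e dvd 2"
    proof -
      have "e dvd r - q" "e dvd r + q" using dd[OF r(1)] *[OF r(1), of k] k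
        by (auto simp: e_def intro: dvd_trans[OF gcd_dvd1] dvd_trans[OF gcd_dvd2])
      then have "e dvd 2 * q" using dvd_diff[of e "r + q" "r - q"] by simp
      moreover have "e dvd int m" by (simp add: e_def k)
      then have "e dvd q\<^sup>2 + 1" using q by (rule dvd_trans)
      ultimately have "e dvd 2 * (q\<^sup>2 + 1) - (2 * q) * q" by (metis dvd_diff dvd_mult dvd_mult2)
      then show ?thesis by (simp add: algebra_simps power2_eq_square)
    qed
    have "int m dvd e * (r - r')"
    proof -
      \<comment> \<open>By Bezout: m = d k divides both d (r - r') and k (r - r'), hence e (r -
        r').\<close>
      obtain u v where uv: "u * int d + v * k = e" using bezout_int e_def by metis
      have "int m dvd int d * (r - r')" using kd by (simp add: k)
      moreover have "int m dvd k * (r - r')" using dd' by (simp add: k mult.commute mult_dvd_mono)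
      ultimately have "int m dvd u * (int d * (r - r')) + v * (k * (r - r'))" by (rule dvd_add[OF dvd_mult dvd_mult])
      then show ?thesis unfolding uv[symmetric] by (simp add: algebra_simps)
    qed
    also have "e * (r - r') dvd 2 * (r - r')" using e2 by (rule mult_dvd_mono) simp
    finally show ?thesis .
  qed
  have cardF: "card (F d) \<le> 2" for d
  proof (cases "F d = {}")
    case False
    then obtain r where r: "r \<in> F d" by auto
    \<comment> \<open>Two residues in [0, m) whose doubled difference is a multiple of m agree or
      differ by m / 2, and only one of the two shifts of r by m / 2 can stay in range.\<close>
    have "F d \<subseteq> {r, if 2 * r < int m then r + int m div 2 else r - int m div 2}"
    proof
      fix s assume s: "s \<in> F d"
      obtain k where k: "2 * (s - r) = int m * k" using two[OF s r] by auto
      have b: "0 \<le> s" "s < int m" "0 \<le> r" "r < int m" using s r by (auto simp: F_def)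
      have "int m * k < int m * 2" "int m * (-2) < int m * k" unfolding k[symmetric] using b by auto
      then have "k < 2" "-2 < k" using m by (simp_all only: mult_less_cancel_left_pos of_nat_0_less_iff)
      then have "k = 0 \<or> k = 1 \<or> k = -1" by linarith
      then show "s \<in> {r, if 2 * r < int m then r + int m div 2 else r - int m div 2}"
        using k b by auto
    qed
    then have "card (F d) \<le> card {r, if 2 * r < int m then r + int m div 2 else r - int m div 2}"
      by (intro card_mono) auto
    also have "\<dots> \<le> 2" by (simp add: card_insert_if)
    finally show ?thesis .
  qed auto
  have fd: "finite {d. d dvd m}" using m by simp
  have "card ?R \<le> card (\<Union>d\<in>{d. d dvd m}. F d)"
    using sub fd finite_subset[OF _ finR, of "F _"] by (intro card_mono finite_UN_I) (auto simp: F_def)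
  also have "\<dots> \<le> (\<Sum>d\<in>{d. d dvd m}. card (F d))" using fd by (rule card_UN_le)
  also have "\<dots> \<le> (\<Sum>d\<in>{d. d dvd m}. 2)" by (intro sum_mono cardF)
  finally show ?thesis by (simp add: mult.commute)
qed

text \<open>Coprimality of x and y makes y invertible modulo m, and r = x / y is then a root of -1.
  Each root carries at most four points, and there are at most twice as many roots as divisors of m;
  hence the factor 8.\<close>

lemma card_primitive_sum_squares_le:
  fixes m :: nat
  assumes m: "m > 0"
  shows "card {(x, y). x\<^sup>2 + y\<^sup>2 = int m \<and> coprime x y} \<le> 8 * card {d. d dvd m}" (is "card ?P \<le> _")
proof -
  define R where "R = {r. 0 \<le> r \<and> r < int m \<and> int m dvd r\<^sup>2 + 1}"
  define A where "A = (\<lambda>r. {(x, y). x\<^sup>2 + y\<^sup>2 = int m \<and> int m dvd x - r * y})"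
  have finR: "finite R" by (rule finite_subset[of _ "{0..int m}"]) (auto simp: R_def)
  have finA: "finite (A r)" for r
    by (rule finite_subset[OF _ finite_sum_squares[of "int m"]]) (auto simp: A_def)
  have "?P \<subseteq> (\<Union>r\<in>R. A r)"
  proof
    fix z assume "z \<in> ?P"
    then obtain x y where z: "z = (x, y)" "x\<^sup>2 + y\<^sup>2 = int m" "coprime x y" by auto
    have "coprime (y * y) (x * x)" using z(3) by (simp add: coprime_commute)
    then have "gcd y (x * x) = 1" by simp
    have "coprime y (int m)"
    proof (rule coprimeI)
      fix c assume c: "c dvd y" "c dvd int m"
      have "c dvd int m - y * y" using c by (intro dvd_diff dvd_mult)
      moreover have "int m - y * y = x * x" using z(2) by (simp add: power2_eq_square)
      ultimately have "c dvd x * x" by simp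
      then show "is_unit c" using c(1) \<open>gcd y (x * x) = 1\<close> by (metis gcd_greatest)
    qed
    then obtain v w where vw: "v * y + w * int m = 1" using bezout_int[of y "int m"] by auto
    define r where "r = (x * v) mod int m"
    have rx: "int m dvd x - r * y"
    proof -
      have "int m dvd x * v - r" by (simp add: r_def)
      then have "int m dvd (x * v - r) * y + x * (w * int m)" by simp
      moreover have "(x * v - r) * y + x * (w * int m) = x * (v * y + w * int m) - r * y"
        by (simp add: algebra_simps)
      ultimately show ?thesis using vw by simp
    qed
    have "int m dvd y\<^sup>2 * (r\<^sup>2 + 1)"
    proof -
      have "y\<^sup>2 * (r\<^sup>2 + 1) = int m - (x - r * y) * (x + r * y)"
        unfolding z(2)[symmetric] by (simp add: power2_eq_square algebra_simps)
      then show ?thesis using rx by simp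
    qed
    then have "int m dvd r\<^sup>2 + 1" using \<open>coprime y (int m)\<close>
      by (simp add: coprime_dvd_mult_right_iff coprime_commute)
    then have "r \<in> R" using m by (simp add: R_def r_def)
    then show "z \<in> (\<Union>r\<in>R. A r)" using rx z by (auto simp: A_def)
  qed
  then have "card ?P \<le> card (\<Union>r\<in>R. A r)" using finR finA by (intro card_mono) auto
  also have "\<dots> \<le> (\<Sum>r\<in>R. card (A r))" using finR by (rule card_UN_le)
  also have "\<dots> \<le> (\<Sum>r\<in>R. 4)"
    using card_sum_squares_root_le[of "int m"] m by (intro sum_mono) (auto simp: A_def R_def)
  also have "\<dots> = 4 * card R" by simp
  also have "\<dots> \<le> 8 * card {d. d dvd m}" using card_roots_minus_one_le[OF m] by (simp add: R_def)
  finally show ?thesis .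
qed

text \<open>Dividing by g = gcd x y leaves a primitive representation of m / g^2. There are no more
  such g than divisors of m, and m / g^2 has no more divisors than m, which produces the
  square.\<close>

lemma card_sum_squares_le:
  fixes m :: nat
  assumes m: "m > 0"
  shows "card {(x, y). x\<^sup>2 + y\<^sup>2 = int m} \<le> 8 * (card {d. d dvd m})\<^sup>2" (is "card ?S \<le> _")
proof -
  define P where "P = (\<lambda>m::nat. {(x, y). x\<^sup>2 + y\<^sup>2 = int m \<and> coprime x y})"
  define G where "G = {g. g\<^sup>2 dvd m}"
  define T where "T = (\<lambda>g. (\<lambda>(x, y). (int g * x, int g * y)) ` P (m div g\<^sup>2))"
  have GD: "G \<subseteq> {d. d dvd m}" by (auto simp: G_def power2_eq_square dest: dvd_mult_left)
  have finD: "finite {d. d dvd m}" using m by simp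
  have finG: "finite G" using GD finD by (rule finite_subset)
  have finP: "finite (P k)" for k
    by (rule finite_subset[OF _ finite_sum_squares[of "int k"]]) (auto simp: P_def)
  have "?S \<subseteq> (\<Union>g\<in>G. T g)"
  proof
    fix z assume "z \<in> ?S"
    then obtain x y where z: "z = (x, y)" "x\<^sup>2 + y\<^sup>2 = int m" by auto
    have "gcd x y \<noteq> 0" using z(2) m by auto
    then obtain x' y' where xy: "x = x' * gcd x y" "y = y' * gcd x y" "coprime x' y'"
      using gcd_coprime_exists by blast
    define g where "g = nat (gcd x y)"
    have g: "x = int g * x'" "y = int g * y'" "g > 0"
      using xy(1,2) \<open>gcd x y \<noteq> 0\<close> gcd_ge_0_int[of x y] unfolding g_def by (auto simp: mult.commute simp del: gcd_ge_0_int)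
    have eq: "int m = int (g\<^sup>2) * (x'\<^sup>2 + y'\<^sup>2)"
      unfolding z(2)[symmetric] g(1,2) by (simp add: power_mult_distrib algebra_simps)
    then have "int (g\<^sup>2) dvd int m" by (metis dvd_triv_left)
    then have "g\<^sup>2 dvd m" by (simp only: of_nat_dvd_iff)
    moreover have "int (m div g\<^sup>2) = x'\<^sup>2 + y'\<^sup>2"
      unfolding zdiv_int eq using g(3) by simp
    ultimately show "z \<in> (\<Union>g\<in>G. T g)"
      using xy(3) g(1,2) z(1) by (auto simp: G_def T_def P_def intro!: bexI[of _ g] image_eqI[of _ _ "(x', y')"])
  qed
  then have "card ?S \<le> card (\<Union>g\<in>G. T g)" using finG finP by (intro card_mono) (auto simp: T_def)
  also have "\<dots> \<le> (\<Sum>g\<in>G. card (T g))" using finG by (rule card_UN_le)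
  also have "\<dots> \<le> (\<Sum>g\<in>G. 8 * card {d. d dvd m})"
  proof (rule sum_mono)
    fix g assume g: "g \<in> G"
    then have dv: "m div g\<^sup>2 dvd m" by (simp add: G_def div_dvd_iff_mult) (metis dvd_div_mult_self dvd_triv_left)
    have pos: "m div g\<^sup>2 > 0" using dv m by (cases "m div g\<^sup>2") auto
    have "card (T g) \<le> card (P (m div g\<^sup>2))" unfolding T_def by (intro card_image_le finP)
    also have "\<dots> \<le> 8 * card {d. d dvd m div g\<^sup>2}"
      unfolding P_def by (rule card_primitive_sum_squares_le[OF pos])
    also have "\<dots> \<le> 8 * card {d. d dvd m}"
      using finD dv by (intro mult_left_mono card_mono) (auto intro: dvd_trans)
    finally show "card (T g) \<le> 8 * card {d. d dvd m}" .
  qed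
  also have "\<dots> = card G * (8 * card {d. d dvd m})" by simp
  also have "\<dots> \<le> card {d. d dvd m} * (8 * card {d. d dvd m})"
    using GD finD by (intro mult_right_mono card_mono) auto
  finally show ?thesis by (simp add: power2_eq_square algebra_simps)
qed

text \<open>The number of divisors enters squared, so the divisor bound is used with exponent
  \<epsilon> / 2.\<close>

lemma sum_squares_bound:
  fixes \<epsilon> :: real
  assumes "\<epsilon> > 0"
  shows "\<exists>C\<ge>1. \<forall>m::int. m > 0 \<longrightarrow> real (card {(x, y). x\<^sup>2 + y\<^sup>2 = m}) \<le> C * real_of_int m powr \<epsilon>"
proof -
  obtain C where C: "C \<ge> 1" "\<And>m::nat. m > 0 \<Longrightarrow> real (card {d. d dvd m}) \<le> C * real m powr (\<epsilon> / 2)"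
    using divisor_bound[of "\<epsilon> / 2"] assms by auto
  have "real (card {(x, y). x\<^sup>2 + y\<^sup>2 = m}) \<le> 8 * C\<^sup>2 * real_of_int m powr \<epsilon>" if "m > 0" for m :: int
  proof -
    obtain k where k: "m = int k" "k > 0" using \<open>m > 0\<close> zero_less_imp_eq_int[of m] by blast
    have "real (card {(x, y). x\<^sup>2 + y\<^sup>2 = m}) \<le> 8 * (real (card {d. d dvd k}))\<^sup>2"
      using of_nat_mono[OF card_sum_squares_le[OF k(2)], where 'a = real] unfolding k(1) by simp
    also have "\<dots> \<le> 8 * (C * real k powr (\<epsilon> / 2))\<^sup>2"
      using power_mono[OF C(2)[OF k(2)], of 2] by simp
    also have "\<dots> = 8 * C\<^sup>2 * real_of_int m powr \<epsilon>"
      using k by (simp add: power_mult_distrib power2_eq_square powr_add[symmetric])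
    finally show ?thesis .
  qed
  moreover have "8 * C\<^sup>2 \<ge> 1" using C(1) one_le_power[of C 2] by linarith
  ultimately show ?thesis by (intro exI[of _ "8 * C\<^sup>2"]) auto
qed

text \<open>Completing the square: \<open>2 n - a\<close> is a lattice point on the circle of radius \<open>\<surd>(2 j - |a|\<^sup>2)\<close>.\<close>

abbreviation circle :: "int \<Rightarrow> int \<Rightarrow> int \<Rightarrow> freq set" where
  "circle a b j \<equiv> {(p, q). p\<^sup>2 + q\<^sup>2 + (a - p)\<^sup>2 + (b - q)\<^sup>2 = j}"

lemma lattice_circle_bound:
  fixes \<epsilon> :: real
  assumes "\<epsilon> > 0"
  shows "\<exists>C\<ge>1. \<forall>(a::int) b j X. X \<ge> 1 \<and> real_of_int (2 * j) \<le> X \<longrightarrow>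
    finite (circle a b j) \<and>
    real (card (circle a b j)) \<le> C * X powr \<epsilon>"
proof -
  obtain C where C: "C \<ge> 1" "\<And>m::int. m > 0 \<Longrightarrow> real (card {(x, y). x\<^sup>2 + y\<^sup>2 = m}) \<le> C * real_of_int m powr \<epsilon>"
    using sum_squares_bound[OF assms] by auto
  have "finite (circle a b j) \<and>
    real (card (circle a b j)) \<le> C * X powr \<epsilon>"
    if X: "X \<ge> 1" "real_of_int (2 * j) \<le> X" for a b j :: int and X :: real
  proof -
    define m where "m = 2 * j - a\<^sup>2 - b\<^sup>2"
    let ?S = "{(x, y). x\<^sup>2 + y\<^sup>2 = m}" and ?L = "circle a b j"
    have inj: "inj_on (\<lambda>(p, q). (2 * p - a, 2 * q - b)) ?L" by (auto simp: inj_on_def)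
    have sub: "(\<lambda>(p, q). (2 * p - a, 2 * q - b)) ` ?L \<subseteq> ?S"
      by (auto simp: m_def power2_eq_square algebra_simps)
    have fin: "finite ?L" using sub finite_sum_squares inj by (meson inj_on_finite)
    have "real (card ?L) \<le> real (card ?S)"
      using card_inj_on_le[OF inj sub finite_sum_squares] by simp
    also have "\<dots> \<le> C * X powr \<epsilon>"
    proof (cases "m > 0")
      case True
      have "real_of_int m \<le> X" using X(2) zero_le_power2[of a] zero_le_power2[of b] unfolding m_def
        by (metis diff_left_mono diff_zero of_int_le_iff order_trans)
      then have "C * real_of_int m powr \<epsilon> \<le> C * X powr \<epsilon>"
        using C(1) True assms by (intro mult_left_mono powr_mono2) auto
      then show ?thesis using C(2)[OF True] by linarith
    next
      case False
      \<comment> \<open>The degenerate radius: at most the centre is left, and C \<ge> 1, X \<ge> 1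
        keep the right-hand side at least 1.\<close>
      have "?S \<subseteq> {(0, 0)}"
      proof
        fix z assume "z \<in> ?S"
        then obtain x y where z: "z = (x, y)" "x\<^sup>2 + y\<^sup>2 = m" by auto
        then have "x\<^sup>2 + y\<^sup>2 \<le> 0" using False by simp
        then have "x = 0 \<and> y = 0" by (simp add: sum_power2_le_zero_iff)
        then show "z \<in> {(0, 0)}" using z by simp
      qed
      then have "card ?S \<le> card {(0::int, 0::int)}" by (intro card_mono) auto
      moreover have "1 \<le> C * X powr \<epsilon>"
        using C(1) ge_one_powr_ge_zero[of X \<epsilon>] X(1) assms mult_mono[of 1 C 1 "X powr \<epsilon>"] by simp
      ultimately show ?thesis by simp
    qed
    finally show ?thesis using fin by blast
  qed
  then show ?thesis using C(1) by blast
qed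

section \<open>The maximal function of the Schroedinger flow\<close>

text \<open>An integer-valued squared length lets the time frequencies of a product of two waves be
  indexed by a finite integer interval.\<close>

definition nsq :: "freq \<Rightarrow> int" where
  "nsq n = (fst n)\<^sup>2 + (snd n)\<^sup>2"

lemma norm_fvec: "(norm (fvec n))\<^sup>2 = of_int (nsq n)"
  by (simp add: fvec_def nsq_def norm_Pair)

lemma nsq_nonneg: "nsq n \<ge> 0"
  by (simp add: nsq_def)

lemma nsq_sq: "n \<in> sq N \<Longrightarrow> nsq n \<le> 2 * (int N)\<^sup>2"
proof -
  assume "n \<in> sq N"
  then have "\<bar>fst n\<bar> \<le> \<bar>int N\<bar>" "\<bar>snd n\<bar> \<le> \<bar>int N\<bar>" by (auto simp: sq_def)
  then show ?thesis unfolding nsq_def by (simp only: abs_le_square_iff)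
qed

lemma nsq_pair_range:
  assumes "A \<subseteq> sq N"
  shows "(\<lambda>p. nsq (fst p) + nsq (snd p)) ` (A \<times> A) \<subseteq> {0..4 * (int N)\<^sup>2}"
proof clarsimp
  fix k l k' l' assume "(k, l) \<in> A" "(k', l') \<in> A"
  then have "(k, l) \<in> sq N" "(k', l') \<in> sq N" using assms by auto
  from this[THEN nsq_sq] show "0 \<le> nsq (k, l) + nsq (k', l') \<and> nsq (k, l) + nsq (k', l') \<le> 4 * (int N)\<^sup>2"
    using nsq_nonneg[of "(k, l)"] nsq_nonneg[of "(k', l')"] by linarith
qed

definition wave :: "real \<Rightarrow> point \<Rightarrow> freq \<Rightarrow> complex" where
  "wave t x n = cis (- (t * (norm (fvec n))\<^sup>2)) * char n x"

lemma cmod_sum_squared_le: "(cmod (\<Sum>i\<in>I. z i))\<^sup>2 \<le> real (card I) * (\<Sum>i\<in>I. (cmod (z i))\<^sup>2)"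
proof -
  have "(cmod (\<Sum>i\<in>I. z i))\<^sup>2 \<le> (\<Sum>i\<in>I. 1 * cmod (z i))\<^sup>2"
    by (intro power_mono) (auto intro: norm_sum)
  also have "\<dots> \<le> (\<Sum>i\<in>I. 1\<^sup>2) * (\<Sum>i\<in>I. (cmod (z i))\<^sup>2)"
    by (rule Cauchy_Schwarz_ineq_sum)
  finally show ?thesis by simp
qed

text \<open>The square of \<open>\<Sum> a\<^sub>n e\<^sup>i\<^sup>(\<^sup>n\<^sup>\<cdot>\<^sup>x\<^sup>-\<^sup>t\<^sup>|\<^sup>n\<^sup>|\<^sup>2\<^sup>)\<close> is a trigonometric polynomial in \<open>t\<close> with at most \<open>4 N\<^sup>2 + 1\<close>
  frequencies \<open>j\<close>, so Cauchy-Schwarz over \<open>j\<close> bounds its fourth power uniformly in \<open>t\<close>.\<close>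

definition quartic :: "nat \<Rightarrow> freq set \<Rightarrow> (freq \<Rightarrow> complex) \<Rightarrow> point \<Rightarrow> real" where
  "quartic N A a x = (4 * (real N)\<^sup>2 + 1) * (\<Sum>j\<in>{0..4 * (int N)\<^sup>2}.
     (cmod (\<Sum>p\<in>{p \<in> A \<times> A. nsq (fst p) + nsq (snd p) = j}.
        a (fst p) * a (snd p) * char (fst p + snd p) x))\<^sup>2)"

lemma quartic_nonneg: "quartic N A a x \<ge> 0"
  unfolding quartic_def by (intro mult_nonneg_nonneg sum_nonneg) auto

lemma quartic_measurable [measurable (raw)]:
  assumes [measurable]: "\<And>n. (\<lambda>z. a z n) \<in> borel_measurable M" "x \<in> borel_measurable M"
  shows "(\<lambda>z. quartic N A (a z) (x z)) \<in> borel_measurable M"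
  unfolding quartic_def by measurable

lemma cmod_pow4_le_quartic:
  assumes A: "A \<subseteq> sq N"
  shows "cmod (\<Sum>n\<in>A. a n * wave t x n) ^ 4 \<le> quartic N A a x"
proof -
  have fin: "finite A" using A finite_sq by (rule finite_subset)
  define F where "F = (\<Sum>n\<in>A. a n * (cis (- (t * (norm (fvec n))\<^sup>2)) * char n x))"
  define P where "P = (\<lambda>j. {p \<in> A \<times> A. nsq (fst p) + nsq (snd p) = j})"
  define G where "G = (\<lambda>j. \<Sum>p\<in>P j. a (fst p) * a (snd p) * char (fst p + snd p) x)"
  let ?h = "\<lambda>p. a (fst p) * (cis (- (t * (norm (fvec (fst p)))\<^sup>2)) * char (fst p) x) *
      (a (snd p) * (cis (- (t * (norm (fvec (snd p)))\<^sup>2)) * char (snd p) x))"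
  have "F * F = (\<Sum>p\<in>A \<times> A. ?h p)"
    unfolding F_def sum_product sum.cartesian_product by (intro sum.cong) auto
  also have "\<dots> = (\<Sum>j\<in>{0..4 * (int N)\<^sup>2}. \<Sum>p\<in>P j. ?h p)"
    unfolding P_def using fin nsq_pair_range[OF A] by (intro sum.group[symmetric]) auto
  also have "\<dots> = (\<Sum>j\<in>{0..4 * (int N)\<^sup>2}. cis (- (t * of_int j)) * G j)"
    unfolding G_def sum_distrib_left
  proof (intro sum.cong refl)
    fix j p assume "p \<in> P j"
    then have j: "j = nsq (fst p) + nsq (snd p)" by (simp add: P_def)
    show "?h p = cis (- (t * of_int j)) * (a (fst p) * a (snd p) * char (fst p + snd p) x)"
      unfolding j norm_fvec char_add of_int_add distrib_left minus_add_distrib cis_mult[symmetric]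
      by (simp add: mult_ac)
  qed
  finally have eq: "F * F = (\<Sum>j\<in>{0..4 * (int N)\<^sup>2}. cis (- (t * of_int j)) * G j)" .
  have "cmod F ^ 4 = (cmod (F * F))\<^sup>2"
    by (simp add: norm_mult power2_eq_square power4_eq_xxxx)
  also have "\<dots> \<le> real (card {0..4 * (int N)\<^sup>2}) * (\<Sum>j\<in>{0..4 * (int N)\<^sup>2}. (cmod (cis (- (t * of_int j)) * G j))\<^sup>2)"
    unfolding eq by (rule cmod_sum_squared_le)
  also have "\<dots> = quartic N A a x"
    by (simp add: quartic_def G_def P_def norm_mult nat_add_distrib nat_mult_distrib nat_power_eq)
  finally show ?thesis unfolding F_def wave_def .
qed

text \<open>For each time frequency j, the pairs are grouped by their sum, which is the spatial
  frequency, and Parseval in x applies. Cauchy-Schwarz inside a group costs its cardinality, at most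
  \<open>R\<close> by the lattice point count. Summing over j recovers every pair exactly once,
  hence the square of the sum of |a|^2.\<close>

lemma nn_integral_quartic_le:
  assumes A: "A \<subseteq> sq N"
    and R: "\<And>(b::int) c j. j \<le> 4 * (int N)\<^sup>2 \<Longrightarrow>
      finite (circle b c j) \<and>
      real (card (circle b c j)) \<le> R"
  shows "(\<integral>\<^sup>+x. ennreal (quartic N A a x) \<partial>torus) \<le>
    ennreal ((4 * (real N)\<^sup>2 + 1) * R * (\<Sum>n\<in>A. (cmod (a n))\<^sup>2)\<^sup>2)"
proof -
  have fin: "finite A" using A finite_sq by (rule finite_subset)
  define J where "J = {0..4 * (int N)\<^sup>2}"
  define P where "P = (\<lambda>j. {p \<in> A \<times> A. nsq (fst p) + nsq (snd p) = j})"
  have finP: "finite (P j)" for j using fin by (simp add: P_def)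
  define \<phi> :: "freq \<times> freq \<Rightarrow> freq" where "\<phi> = (\<lambda>p. fst p + snd p)"
  define h where "h = (\<lambda>p. a (fst p) * a (snd p))"
  define G where "G = (\<lambda>j x. \<Sum>p\<in>P j. h p * char (\<phi> p) x)"
  have G_eq: "G j x = (\<Sum>s\<in>\<phi> ` P j. (\<Sum>p\<in>{p \<in> P j. \<phi> p = s}. h p) * char s x)" for j x
    unfolding G_def sum.image_gen[OF finP, of "\<lambda>p. h p * char (\<phi> p) x" j \<phi>] sum_distrib_right
    by (intro sum.cong) auto
  have bound: "(\<integral>\<^sup>+x. ennreal ((cmod (G j x))\<^sup>2) \<partial>torus) \<le> ennreal (R * (\<Sum>p\<in>P j. (cmod (h p))\<^sup>2))"
    if j: "j \<in> J" for j
  proof -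
    have "(\<integral>\<^sup>+x. ennreal ((cmod (G j x))\<^sup>2) \<partial>torus) =
        ennreal (\<Sum>s\<in>\<phi> ` P j. (cmod (\<Sum>p\<in>{p \<in> P j. \<phi> p = s}. h p))\<^sup>2)"
      unfolding G_eq using finP by (intro parseval_finite) auto
    also have "\<dots> \<le> ennreal (\<Sum>s\<in>\<phi> ` P j. R * (\<Sum>p\<in>{p \<in> P j. \<phi> p = s}. (cmod (h p))\<^sup>2))"
    proof (intro ennreal_leI sum_mono)
      fix s assume "s \<in> \<phi> ` P j"
      let ?L = "circle (fst s) (snd s) j"
      have L: "finite ?L" "real (card ?L) \<le> R" using R[of j "fst s" "snd s"] j by (auto simp: J_def)
      have "card {p \<in> P j. \<phi> p = s} \<le> card ?L"
      \<comment> \<open>A pair with prescribed sum is determined by its first entry, and that entry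
        lies on the circle.\<close>
      proof (rule card_inj_on_le[where f = fst])
        show "inj_on fst {p \<in> P j. \<phi> p = s}"
          by (auto simp: inj_on_def \<phi>_def)
        show "fst ` {p \<in> P j. \<phi> p = s} \<subseteq> ?L"
          by (auto simp: P_def \<phi>_def nsq_def)
      qed (rule L)
      then have "real (card {p \<in> P j. \<phi> p = s}) \<le> R" using L by linarith
      then have "real (card {p \<in> P j. \<phi> p = s}) * (\<Sum>p\<in>{p \<in> P j. \<phi> p = s}. (cmod (h p))\<^sup>2)
          \<le> R * (\<Sum>p\<in>{p \<in> P j. \<phi> p = s}. (cmod (h p))\<^sup>2)"
        by (intro mult_right_mono sum_nonneg) auto
      with cmod_sum_squared_le show "(cmod (\<Sum>p\<in>{p \<in> P j. \<phi> p = s}. h p))\<^sup>2 \<le>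
          R * (\<Sum>p\<in>{p \<in> P j. \<phi> p = s}. (cmod (h p))\<^sup>2)"
        by (rule order_trans)
    qed
    also have "\<dots> = ennreal (R * (\<Sum>p\<in>P j. (cmod (h p))\<^sup>2))"
      unfolding sum_distrib_left[symmetric] by (subst sum.image_gen[OF finP, symmetric]) simp
    finally show ?thesis .
  qed
  have total: "(\<Sum>j\<in>J. \<Sum>p\<in>P j. (cmod (h p))\<^sup>2) = (\<Sum>n\<in>A. (cmod (a n))\<^sup>2)\<^sup>2"
  proof -
    have "(\<Sum>j\<in>J. \<Sum>p\<in>P j. (cmod (h p))\<^sup>2) = (\<Sum>p\<in>A \<times> A. (cmod (h p))\<^sup>2)"
      unfolding P_def using fin nsq_pair_range[OF A] by (intro sum.group) (auto simp: J_def)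
    also have "\<dots> = (\<Sum>n\<in>A. (cmod (a n))\<^sup>2)\<^sup>2"
      unfolding power2_eq_square[of "\<Sum>n\<in>A. (cmod (a n))\<^sup>2"] sum_product sum.cartesian_product
      by (intro sum.cong) (auto simp: h_def norm_mult power_mult_distrib)
    finally show ?thesis .
  qed
  have R0: "R \<ge> 0" using R[of 0 0 0] by (meson of_nat_0_le_iff order_trans zero_le_mult_iff zero_le_numeral zero_le_power2)
  have Gm [measurable]: "G j \<in> borel_measurable borel" for j unfolding G_def by measurable
  have "(\<integral>\<^sup>+x. ennreal (quartic N A a x) \<partial>torus) =
      (\<integral>\<^sup>+x. ennreal (4 * (real N)\<^sup>2 + 1) * (\<Sum>j\<in>J. ennreal ((cmod (G j x))\<^sup>2)) \<partial>torus)"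
    unfolding quartic_def G_def P_def h_def \<phi>_def J_def
    by (intro nn_integral_cong) (simp add: ennreal_mult sum_nonneg)
  also have "\<dots> = ennreal (4 * (real N)\<^sup>2 + 1) * (\<Sum>j\<in>J. \<integral>\<^sup>+x. ennreal ((cmod (G j x))\<^sup>2) \<partial>torus)"
    by (subst nn_integral_cmult, simp, subst nn_integral_sum) auto
  also have "\<dots> \<le> ennreal (4 * (real N)\<^sup>2 + 1) * (\<Sum>j\<in>J. ennreal (R * (\<Sum>p\<in>P j. (cmod (h p))\<^sup>2)))"
    by (intro mult_left_mono sum_mono bound) auto
  also have "\<dots> = ennreal ((4 * (real N)\<^sup>2 + 1) * R * (\<Sum>n\<in>A. (cmod (a n))\<^sup>2)\<^sup>2)"
    using R0 by (subst sum_ennreal) (auto simp: sum_distrib_left[symmetric] total ennreal_mult[symmetric] mult.assoc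
      simp del: ennreal_plus intro!: mult_nonneg_nonneg sum_nonneg)
  finally show ?thesis .
qed

text \<open>Integrates the pointwise bound X \<le> c + X^4 / c^3 over a probability space; each of
  the two terms contributes c. For c = 0 the function vanishes almost everywhere.\<close>

lemma nn_integral_le_of_pow4:
  fixes X :: "point \<Rightarrow> real"
  assumes [measurable]: "X \<in> borel_measurable borel" and X0: "\<And>x. X x \<ge> 0" and c: "c \<ge> 0"
    and le: "(\<integral>\<^sup>+x. ennreal (X x ^ 4) \<partial>torus) \<le> ennreal (c ^ 4)"
  shows "(\<integral>\<^sup>+x. ennreal (X x) \<partial>torus) \<le> ennreal (2 * c)"
proof (cases "c = 0")
  case True
  then have "(\<integral>\<^sup>+x. ennreal (X x ^ 4) \<partial>torus) = 0" using le by simp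
  then have "AE x in torus. ennreal (X x ^ 4) = 0" by (subst (asm) nn_integral_0_iff_AE) auto
  then have "AE x in torus. ennreal (X x) = 0"
    by eventually_elim (use X0 in \<open>simp add: ennreal_eq_0_iff power_le_zero_eq\<close>)
  then have "(\<integral>\<^sup>+x. ennreal (X x) \<partial>torus) = 0" by (subst nn_integral_0_iff_AE) auto
  then show ?thesis by simp
next
  case False
  then have c0: "c > 0" using c by simp
  have pt: "X x \<le> c + X x ^ 4 / c ^ 3" for x
  proof (cases "X x \<le> c")
    case True
    moreover have "X x ^ 4 / c ^ 3 \<ge> 0" using X0 c by simp
    ultimately show ?thesis by linarith
  next
    case False
    then have "c ^ 3 \<le> X x ^ 3" using c by (intro power_mono) auto
    then have "X x * c ^ 3 \<le> X x * X x ^ 3" using X0 by (intro mult_left_mono)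
    then have "X x \<le> X x ^ 4 / c ^ 3" using c0 by (simp add: field_simps eval_nat_numeral)
    then show ?thesis using c by linarith
  qed
  have "(\<integral>\<^sup>+x. ennreal (X x) \<partial>torus) \<le> (\<integral>\<^sup>+x. ennreal c + ennreal (1 / c ^ 3) * ennreal (X x ^ 4) \<partial>torus)"
    using pt c X0 by (intro nn_integral_mono) (simp add: ennreal_mult[symmetric] ennreal_plus[symmetric] del: ennreal_plus)
  also have "\<dots> = ennreal c + ennreal (1 / c ^ 3) * (\<integral>\<^sup>+x. ennreal (X x ^ 4) \<partial>torus)"
    by (simp add: nn_integral_add nn_integral_cmult torus.emeasure_space_1[simplified])
  also have "\<dots> \<le> ennreal c + ennreal (1 / c ^ 3) * ennreal (c ^ 4)"
    by (intro add_left_mono mult_left_mono le) auto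
  also have "\<dots> = ennreal (2 * c)"
    using c0 by (simp add: ennreal_mult[symmetric] ennreal_plus[symmetric] field_simps eval_nat_numeral del: ennreal_plus)
  finally show ?thesis .
qed

text \<open>Rademacher-Menshov: an initial segment of a block of length \<open>2 ^ k\<close> is a disjoint union of aligned
  dyadic intervals, one for each length.\<close>

lemma rademacher_menshov:
  fixes s :: "nat \<Rightarrow> complex"
  assumes c: "\<And>i j. j \<le> k \<Longrightarrow> Suc i * 2 ^ j \<le> 2 ^ k \<Longrightarrow> cmod (s (u + Suc i * 2 ^ j) - s (u + i * 2 ^ j)) \<le> c j"
    and l: "l \<le> 2 ^ k"
  shows "cmod (s (u + l) - s u) \<le> (\<Sum>j<Suc k. c j)"
proof -
  have c0: "c j \<ge> 0" if "j \<le> k" for j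
  proof -
    have "Suc 0 * 2 ^ j \<le> (2::nat) ^ k" using that by simp
    from order_trans[OF norm_ge_zero c[OF that this]] show ?thesis .
  qed
  \<comment> \<open>The number \<open>2 ^ i * (l div 2 ^ i)\<close> is \<open>l\<close> with its
    lowest i binary digits cleared. Clearing the next digit removes one aligned interval of length
    2^i if the digit is 1, and nothing if it is 0. At i = k + 1 nothing is left because l \<le>
    2^k.\<close>
  have "cmod (s (u + l) - s (u + 2 ^ i * (l div 2 ^ i))) \<le> (\<Sum>j<i. c j)" if "i \<le> Suc k" for i
    using that
  proof (induction i)
    case 0
    then show ?case by simp
  next
    case (Suc i)
    define q where "q = l div 2 ^ i"
    have q2: "l div 2 ^ Suc i = q div 2" unfolding q_def power_Suc2 by (rule div_mult2_eq)
    have "cmod (s (u + 2 ^ i * q) - s (u + 2 ^ Suc i * (q div 2))) \<le> c i"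
    proof (cases "even q")
      case True
      then have e: "2 ^ Suc i * (q div 2) = 2 ^ i * q" by simp
      show ?thesis unfolding e using c0 Suc.prems by simp
    next
      case False
      then obtain p where p: "q = Suc (2 * p)" by (elim oddE) simp
      have "q * 2 ^ i \<le> l" unfolding q_def by (simp add: div_times_less_eq_dividend)
      then show ?thesis
        using c[of i "2 * p"] l Suc.prems unfolding p by (simp add: mult_ac)
    qed
    then show ?case
      using Suc norm_triangle_ineq[of "s (u + l) - s (u + 2 ^ i * q)" "s (u + 2 ^ i * q) - s (u + 2 ^ Suc i * (q div 2))"]
      unfolding q2 by (simp add: q_def)
  qed
  from this[of "Suc k"] show ?thesis using l by (simp add: div_eq_0_iff le_less_trans)
qed

text \<open>The frequencies gained when the square cutoff runs through the i-th aligned interval of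
  length 2^j inside [2^k, 2^(k+1)].\<close>

definition ring :: "nat \<Rightarrow> nat \<Rightarrow> nat \<Rightarrow> freq set" where
  "ring k j i = sq (2 ^ k + Suc i * 2 ^ j) - sq (2 ^ k + i * 2 ^ j)"

definition block :: "nat \<Rightarrow> freq set" where
  "block k = sq (2 ^ Suc k) - sq (2 ^ k)"

text \<open>At each scale j the maximum over i is replaced by an l^4 sum. Its fourth power is a sum
  of quartics, each of which already dominates all times and is integrated by Parseval.\<close>

definition ring_max :: "nat \<Rightarrow> (freq \<Rightarrow> complex) \<Rightarrow> point \<Rightarrow> real" where
  "ring_max k a x = (\<Sum>j<Suc k. root 4 (\<Sum>i<2 ^ (k - j). quartic (2 ^ Suc k) (ring k j i) a x))"

lemma ring_max_measurable [measurable (raw)]: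
  assumes [measurable]: "\<And>n. (\<lambda>z. a z n) \<in> borel_measurable M" "x \<in> borel_measurable M"
  shows "(\<lambda>z. ring_max k (a z) (x z)) \<in> borel_measurable M"
  unfolding ring_max_def by measurable

lemma dyadic_end_le:
  fixes i j k :: nat
  assumes "j \<le> k"
  shows "Suc i * 2 ^ j \<le> 2 ^ k \<longleftrightarrow> i < 2 ^ (k - j)"
proof -
  have "(2::nat) ^ k = 2 ^ (k - j) * 2 ^ j" using assms by (simp add: power_add[symmetric])
  then have "Suc i * 2 ^ j \<le> 2 ^ k \<longleftrightarrow> Suc i \<le> 2 ^ (k - j)" by (simp only: mult_le_cancel2) simp
  then show ?thesis by (simp add: Suc_le_eq)
qed

lemma ring_subset_block:
  assumes "j \<le> k" "i < 2 ^ (k - j)"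
  shows "ring k j i \<subseteq> block k"
proof -
  have "Suc i * 2 ^ j \<le> 2 ^ k" using dyadic_end_le assms by blast
  then have "sq (2 ^ k + Suc i * 2 ^ j) \<subseteq> sq (2 ^ Suc k)" by (intro sq_mono) simp
  moreover have "sq (2 ^ k) \<subseteq> sq (2 ^ k + i * 2 ^ j)" by (intro sq_mono) simp
  ultimately show ?thesis by (auto simp: ring_def block_def)
qed

lemma ring_disjoint:
  assumes "i \<noteq> i'"
  shows "ring k j i \<inter> ring k j i' = {}"
proof -
  have *: "ring k j i \<inter> ring k j i' = {}" if "i < i'" for i i'
  proof -
    have "Suc i * 2 ^ j \<le> i' * 2 ^ j" using that by (intro mult_right_mono) auto
    then have "sq (2 ^ k + Suc i * 2 ^ j) \<subseteq> sq (2 ^ k + i' * 2 ^ j)" by (intro sq_mono) simp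
    then show ?thesis by (auto simp: ring_def)
  qed
  show ?thesis using assms *[of i i'] *[of i' i] by (metis Int_commute linorder_neqE_nat)
qed

text \<open>Each dyadic increment is a sum over one ring. Dominating the single index i by the sum
  over all i makes the bound the same for every cutoff \<open>m\<close> in the block and every time
  \<open>t\<close>.\<close>

lemma partial_sum_le_ring_max:
  assumes "2 ^ k \<le> m" "m \<le> 2 ^ Suc k"
  shows "cmod (\<Sum>n\<in>sq m - sq (2 ^ k). a n * wave t x n) \<le> ring_max k a x"
proof -
  let ?f = "\<lambda>n. a n * wave t x n"
  define s where "s = (\<lambda>m. \<Sum>n\<in>sq m. ?f n)"
  obtain l where l: "m = 2 ^ k + l" using assms(1) le_Suc_ex by blast
  have "cmod (s (2 ^ k + l) - s (2 ^ k)) \<le> ring_max k a x"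
    unfolding ring_max_def
  proof (rule rademacher_menshov)
    fix i j assume j: "j \<le> k" and i: "Suc i * 2 ^ j \<le> (2::nat) ^ k"
    have i': "i < 2 ^ (k - j)" using dyadic_end_le j i by blast
    have "cmod (s (2 ^ k + Suc i * 2 ^ j) - s (2 ^ k + i * 2 ^ j)) = cmod (\<Sum>n\<in>ring k j i. ?f n)"
      unfolding s_def ring_def by (subst sum_sq_diff) auto
    also have "\<dots> = root 4 (cmod (\<Sum>n\<in>ring k j i. ?f n) ^ 4)"
      by (simp add: real_root_power_cancel)
    also have "\<dots> \<le> root 4 (quartic (2 ^ Suc k) (ring k j i) a x)"
      using ring_subset_block[OF j i'] by (intro real_root_le_mono cmod_pow4_le_quartic) (auto simp: block_def)
    also have "\<dots> \<le> root 4 (\<Sum>i<2 ^ (k - j). quartic (2 ^ Suc k) (ring k j i) a x)"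
      using i' by (intro real_root_le_mono member_le_sum[of i "{..<2 ^ (k - j)}" "\<lambda>i. quartic (2 ^ Suc k) (ring k j i) a x"])
        (auto simp: quartic_nonneg)
    finally show "cmod (s (2 ^ k + Suc i * 2 ^ j) - s (2 ^ k + i * 2 ^ j)) \<le>
      root 4 (\<Sum>i<2 ^ (k - j). quartic (2 ^ Suc k) (ring k j i) a x)" .
  qed (use assms(2) l in simp)
  then show ?thesis using l assms(1) by (simp add: s_def sum_sq_diff)
qed

text \<open>At a fixed scale j the rings are disjoint, so their quartics together cost no more than
  one quartic of the whole block: about 2^(2k(1+\<epsilon>)) times the square of the energy. The
  fourth root gives 2^(k(1/2+\<epsilon>/2)), and the k + 1 scales are paid for with the remaining
  2^(k\<epsilon>/2).\<close>

lemma nn_integral_ring_max_le: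
  fixes \<epsilon> :: real
  assumes \<epsilon>: "\<epsilon> > 0"
  shows "\<exists>C>0. \<forall>k a. (\<integral>\<^sup>+x. ennreal (ring_max k a x) \<partial>torus) \<le>
    ennreal (C * 2 powr (real k * (1 / 2 + \<epsilon>)) * sqrt (\<Sum>n\<in>block k. (cmod (a n))\<^sup>2))"
proof -
  obtain C where C: "C \<ge> 1" "\<And>(a::int) b j X. X \<ge> 1 \<Longrightarrow> real_of_int (2 * j) \<le> X \<Longrightarrow>
    finite (circle a b j) \<and>
    real (card (circle a b j)) \<le> C * X powr \<epsilon>"
    using lattice_circle_bound[OF \<epsilon>] by blast
  \<comment> \<open>With N = 2^(k+1) the count 4 N^2 + 1 = 16 * 4^k + 1 is below 20 * 4^k. The
    energies satisfy j \<le> 4 N^2, so 2 j \<le> 8 N^2 = 32 * 4^k is the argument of the lattice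
    bound.\<close>
  define B where "B = 20 * C * 32 powr \<epsilon>"
  define D where "D = 2 * root 4 B * (1 + 2 / (\<epsilon> * ln 2))"
  have B: "B > 0" using C(1) by (simp add: B_def)
  have D: "D > 0" using B \<epsilon> by (auto simp: D_def intro!: mult_pos_pos add_pos_pos divide_pos_pos)
  have main: "(\<integral>\<^sup>+x. ennreal (ring_max k a x) \<partial>torus) \<le>
    ennreal (D * 2 powr (real k * (1 / 2 + \<epsilon>)) * sqrt (\<Sum>n\<in>block k. (cmod (a n))\<^sup>2))" for k a
  proof -
    define S where "S = (\<Sum>n\<in>block k. (cmod (a n))\<^sup>2)"
    have S0: "S \<ge> 0" unfolding S_def by (intro sum_nonneg) auto
    define N :: nat where "N = 2 ^ Suc k"
    define K where "K = B * 2 powr (2 * real k + 2 * real k * \<epsilon>)"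
    have K0: "K > 0" using B by (simp add: K_def)
    have KN: "(4 * (real N)\<^sup>2 + 1) * (C * (8 * (real N)\<^sup>2) powr \<epsilon>) \<le> K"
    proof -
      have N2: "(real N)\<^sup>2 = 4 * 2 powr (2 * real k)"
        unfolding N_def by (simp add: powr_mult_base powr_realpow[symmetric] power2_eq_square powr_add[symmetric]) (simp add: powr_add)
      have "1 \<le> (2::real) powr (2 * real k)" by (intro ge_one_powr_ge_zero) auto
      then have 1: "4 * (real N)\<^sup>2 + 1 \<le> 20 * 2 powr (2 * real k)" unfolding N2 by linarith
      have 2: "(8 * (real N)\<^sup>2) powr \<epsilon> = 32 powr \<epsilon> * 2 powr (2 * real k * \<epsilon>)"
        unfolding N2 by (simp add: powr_mult powr_powr)
      have "(4 * (real N)\<^sup>2 + 1) * (C * (8 * (real N)\<^sup>2) powr \<epsilon>) \<le>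
          20 * 2 powr (2 * real k) * (C * (32 powr \<epsilon> * 2 powr (2 * real k * \<epsilon>)))"
        unfolding 2 using 1 C(1) by (intro mult_right_mono) auto
      then show ?thesis by (simp add: K_def B_def powr_add mult_ac)
    qed
    have level: "(\<integral>\<^sup>+x. ennreal (root 4 (\<Sum>i<2 ^ (k - j). quartic N (ring k j i) a x)) \<partial>torus) \<le>
        ennreal (2 * (root 4 K * sqrt S))" if j: "j < Suc k" for j
    proof (rule nn_integral_le_of_pow4)
      have "(\<integral>\<^sup>+x. ennreal (root 4 (\<Sum>i<2 ^ (k - j). quartic N (ring k j i) a x) ^ 4) \<partial>torus) =
          (\<integral>\<^sup>+x. (\<Sum>i<2 ^ (k - j). ennreal (quartic N (ring k j i) a x)) \<partial>torus)"
        by (intro nn_integral_cong) (simp add: quartic_nonneg sum_nonneg)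
      also have "\<dots> = (\<Sum>i<2 ^ (k - j). \<integral>\<^sup>+x. ennreal (quartic N (ring k j i) a x) \<partial>torus)"
        by (rule nn_integral_sum) auto
      also have "\<dots> \<le> (\<Sum>i<2 ^ (k - j). ennreal (K * (\<Sum>n\<in>ring k j i. (cmod (a n))\<^sup>2) * S))"
      proof (intro sum_mono)
        fix i assume "i \<in> {..<(2::nat) ^ (k - j)}"
        then have sub: "ring k j i \<subseteq> block k" using j by (intro ring_subset_block) auto
        let ?T = "\<Sum>n\<in>ring k j i. (cmod (a n))\<^sup>2"
        have T: "0 \<le> ?T" "?T \<le> S"
          unfolding S_def using sub by (auto intro!: sum_nonneg sum_mono2 simp: block_def)
        have "(\<integral>\<^sup>+x. ennreal (quartic N (ring k j i) a x) \<partial>torus) \<le>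
          ennreal ((4 * (real N)\<^sup>2 + 1) * (C * (8 * (real N)\<^sup>2) powr \<epsilon>) * ?T\<^sup>2)"
        proof (rule nn_integral_quartic_le)
          show "ring k j i \<subseteq> sq N" using sub by (auto simp: block_def N_def)
        next
          fix b c j :: int assume "j \<le> 4 * (int N)\<^sup>2"
          then have "real_of_int j \<le> real_of_int (4 * (int N)\<^sup>2)" by (simp only: of_int_le_iff)
          then have j: "real_of_int (2 * j) \<le> 8 * (real N)\<^sup>2" by simp
          have "(1::real) \<le> (real N)\<^sup>2" using one_le_power[of "2::real" "Suc k"] by (intro one_le_power) (simp add: N_def)
          then show "finite (circle b c j) \<and>
            real (card (circle b c j)) \<le> C * (8 * (real N)\<^sup>2) powr \<epsilon>"
            using C(2)[OF _ j] by simp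
        qed
        also have "\<dots> \<le> ennreal (K * ?T\<^sup>2)"
          by (intro ennreal_leI mult_right_mono KN) auto
        \<comment> \<open>Only one of the two factors \<open>?T\<close> is enlarged to the energy
          \<open>S\<close> of the block; the other is kept so that disjointness can be used in the
          sum over i.\<close>
        also have "\<dots> \<le> ennreal (K * ?T * S)"
          using T K0 by (intro ennreal_leI) (simp add: power2_eq_square mult.assoc mult_left_mono)
        finally show "(\<integral>\<^sup>+x. ennreal (quartic N (ring k j i) a x) \<partial>torus) \<le> ennreal (K * ?T * S)" .
      qed
      also have "\<dots> = ennreal (K * (\<Sum>i<2 ^ (k - j). \<Sum>n\<in>ring k j i. (cmod (a n))\<^sup>2) * S)"
        using K0 S0 by (subst sum_ennreal) (auto simp: sum_distrib_left sum_distrib_right intro!: mult_nonneg_nonneg sum_nonneg)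
      also have "\<dots> \<le> ennreal (K * S * S)"
      proof (intro ennreal_leI mult_right_mono mult_left_mono)
        have "(\<Sum>i<2 ^ (k - j). \<Sum>n\<in>ring k j i. (cmod (a n))\<^sup>2) =
          (\<Sum>n\<in>(\<Union>i<2 ^ (k - j). ring k j i). (cmod (a n))\<^sup>2)"
          using ring_disjoint by (intro sum.UNION_disjoint[symmetric]) (auto simp: ring_def)
        also have "\<dots> \<le> S"
        proof -
          have "(\<Union>i<2 ^ (k - j). ring k j i) \<subseteq> block k"
            using ring_subset_block[of j k] j by (intro UN_least) auto
          then show ?thesis unfolding S_def by (intro sum_mono2) (auto simp: block_def)
        qed
        finally show "(\<Sum>i<2 ^ (k - j). \<Sum>n\<in>ring k j i. (cmod (a n))\<^sup>2) \<le> S" .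
      qed (use K0 S0 in auto)
      also have "K * S * S = (root 4 K * sqrt S) ^ 4"
      proof -
        have "sqrt S ^ 4 = (sqrt S)\<^sup>2 * (sqrt S)\<^sup>2" by (simp only: power_add[symmetric]) simp
        also have "\<dots> = S * S" using S0 by simp
        finally show ?thesis using K0 by (simp add: power_mult_distrib mult.assoc)
      qed
      finally show "(\<integral>\<^sup>+x. ennreal (root 4 (\<Sum>i<2 ^ (k - j). quartic N (ring k j i) a x) ^ 4) \<partial>torus) \<le>
        ennreal ((root 4 K * sqrt S) ^ 4)" .
    qed (use K0 S0 in \<open>auto intro!: sum_nonneg quartic_nonneg real_root_ge_zero\<close>)
    have "(\<integral>\<^sup>+x. ennreal (ring_max k a x) \<partial>torus) =
      (\<Sum>j<Suc k. \<integral>\<^sup>+x. ennreal (root 4 (\<Sum>i<2 ^ (k - j). quartic N (ring k j i) a x)) \<partial>torus)"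
    proof -
      have "ennreal (ring_max k a x) = (\<Sum>j<Suc k. ennreal (root 4 (\<Sum>i<2 ^ (k - j). quartic N (ring k j i) a x)))" for x
        unfolding ring_max_def N_def by (intro sum_ennreal[symmetric] real_root_ge_zero sum_nonneg quartic_nonneg)
      then show ?thesis by (simp only:) (rule nn_integral_sum, simp)
    qed
    also have "\<dots> \<le> (\<Sum>j<Suc k. ennreal (2 * (root 4 K * sqrt S)))"
      by (intro sum_mono level) auto
    also have "\<dots> = ennreal (real (Suc k) * (2 * (root 4 K * sqrt S)))"
      using K0 S0 by (simp add: ennreal_mult ennreal_of_nat_eq_real_of_nat del: of_nat_Suc)
    also have "\<dots> \<le> ennreal (D * 2 powr (real k * (1 / 2 + \<epsilon>)) * sqrt S)"
    proof (rule ennreal_leI)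
      have "1 + real k * (\<epsilon> / 2 * ln 2) \<le> exp (real k * (\<epsilon> / 2 * ln 2))" by (rule exp_ge_add_one_self)
      also have "\<dots> = 2 powr (real k * (\<epsilon> / 2))" by (simp add: powr_def)
      finally have e: "1 + real k * (\<epsilon> / 2 * ln 2) \<le> 2 powr (real k * (\<epsilon> / 2))" .
      have "real (Suc k) \<le> (1 + 2 / (\<epsilon> * ln 2)) * (1 + real k * (\<epsilon> / 2 * ln 2))"
        using \<epsilon> by (simp add: field_simps)
      also have "\<dots> \<le> (1 + 2 / (\<epsilon> * ln 2)) * 2 powr (real k * (\<epsilon> / 2))"
        using e \<epsilon> by (intro mult_left_mono) auto
      finally have Sk: "real (Suc k) \<le> (1 + 2 / (\<epsilon> * ln 2)) * 2 powr (real k * (\<epsilon> / 2))" .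
      have rK: "root 4 K = root 4 B * 2 powr (real k * (1 / 2 + \<epsilon> / 2))"
      proof -
        have "(2 * real k + 2 * real k * \<epsilon>) * (1 / 4) = real k * (1 / 2 + \<epsilon> / 2)" by (simp add: algebra_simps)
        then show ?thesis unfolding K_def
          by (simp only: real_root_mult) (simp add: root_powr_inverse powr_powr)
      qed
      have "real (Suc k) * (2 * (root 4 K * sqrt S)) \<le>
          ((1 + 2 / (\<epsilon> * ln 2)) * 2 powr (real k * (\<epsilon> / 2))) * (2 * (root 4 K * sqrt S))"
        using K0 S0 by (intro mult_right_mono Sk) auto
      also have "\<dots> = D * (2 powr (real k * (\<epsilon> / 2)) * 2 powr (real k * (1 / 2 + \<epsilon> / 2))) * sqrt S"
        unfolding rK D_def by (simp only: mult_ac)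
      also have "2 powr (real k * (\<epsilon> / 2)) * 2 powr (real k * (1 / 2 + \<epsilon> / 2)) = (2::real) powr (real k * (1 / 2 + \<epsilon>))"
        by (simp add: powr_add[symmetric] field_simps)
      finally show "real (Suc k) * (2 * (root 4 K * sqrt S)) \<le> D * 2 powr (real k * (1 / 2 + \<epsilon>)) * sqrt S" .
    qed
    finally show ?thesis by (simp add: S_def)
  qed
  then show ?thesis using D by blast
qed

section \<open>Fourier inversion in time\<close>

text \<open>The characteristic function of the standard normal law, rescaled. Damping time
  frequencies by exp (-(s \<tau>)^2 / 2) thus amounts to averaging in time against a normal density
  of deviation s, with the factor 2 \<pi> of Fourier inversion.\<close>

lemma gaussian_fourier:
  fixes s u :: real
  assumes s: "s > 0"
  shows "(LINT \<tau>|lborel. cis (u * \<tau>) * of_real (exp (- (s * \<tau>)\<^sup>2 / 2))) = of_real (2 * pi * normal_density 0 s u)"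
    and "integrable lborel (\<lambda>\<tau>. exp (- (s * \<tau>)\<^sup>2 / 2))"
proof -
  have E: "exp (- (s * \<tau>)\<^sup>2 / 2) = sqrt (2 * pi) * std_normal_density (0 + s * \<tau>)" for \<tau>
    by (simp add: normal_density_def)
  show int: "integrable lborel (\<lambda>\<tau>. exp (- (s * \<tau>)\<^sup>2 / 2))"
    unfolding E using s by (intro integrable_mult_right lborel_integrable_real_affine integrable_normal_density) auto
  have "of_real (exp (- (u / s)\<^sup>2 / 2)) = Characteristic_Functions.char std_normal_distribution (u / s)"
    by (simp add: char_std_normal_distribution)
  also have "\<dots> = (LINT x|lborel. std_normal_density x *\<^sub>R cis (u / s * x))"
    unfolding Characteristic_Functions.char_def
    by (subst integral_density) (auto simp: cis_conv_exp)
  also have "\<dots> = \<bar>s\<bar> *\<^sub>R (LINT \<tau>|lborel. std_normal_density (0 + s * \<tau>) *\<^sub>R cis (u / s * (0 + s * \<tau>)))"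
    using s by (intro lborel_integral_real_affine) auto
  also have "\<dots> = s *\<^sub>R (LINT \<tau>|lborel. (1 / sqrt (2 * pi)) *\<^sub>R (cis (u * \<tau>) * of_real (exp (- (s * \<tau>)\<^sup>2 / 2))))"
  proof -
    have "std_normal_density (0 + s * \<tau>) *\<^sub>R cis (u / s * (0 + s * \<tau>)) =
        (1 / sqrt (2 * pi)) *\<^sub>R (cis (u * \<tau>) * of_real (exp (- (s * \<tau>)\<^sup>2 / 2)))" for \<tau>
      using s by (simp add: std_normal_density_def scaleR_conv_of_real)
    then show ?thesis using s by simp
  qed
  also have "\<dots> = of_real (s / sqrt (2 * pi)) * (LINT \<tau>|lborel. cis (u * \<tau>) * of_real (exp (- (s * \<tau>)\<^sup>2 / 2)))"
    by (simp add: scaleR_conv_of_real)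
  finally have "of_real (sqrt (2 * pi) / s) * of_real (exp (- (u / s)\<^sup>2 / 2)) =
      (LINT \<tau>|lborel. cis (u * \<tau>) * of_real (exp (- (s * \<tau>)\<^sup>2 / 2)))"
    using s by (simp add: field_simps)
  moreover have "sqrt (2 * pi) / s * exp (- (u / s)\<^sup>2 / 2) = 2 * pi * normal_density 0 s u"
    using s by (simp add: normal_density_def real_sqrt_mult power_divide field_simps)
  ultimately show "(LINT \<tau>|lborel. cis (u * \<tau>) * of_real (exp (- (s * \<tau>)\<^sup>2 / 2))) = of_real (2 * pi * normal_density 0 s u)"
    by (metis of_real_mult)
qed

lemma integrable_mult_of_square_integrable:
  fixes f g :: "real \<Rightarrow> complex"
  assumes [measurable]: "f \<in> borel_measurable lborel" "g \<in> borel_measurable lborel"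
    and "integrable lborel (\<lambda>t. (cmod (f t))\<^sup>2)" "integrable lborel (\<lambda>t. (cmod (g t))\<^sup>2)"
  shows "integrable lborel (\<lambda>t. f t * g t)"
proof (rule Bochner_Integration.integrable_bound)
  show "integrable lborel (\<lambda>t. (cmod (f t))\<^sup>2 + (cmod (g t))\<^sup>2)" using assms by simp
  show "AE t in lborel. norm (f t * g t) \<le> norm ((cmod (f t))\<^sup>2 + (cmod (g t))\<^sup>2)"
  proof (rule AE_I2)
    fix t
    have "0 \<le> (cmod (f t) - cmod (g t))\<^sup>2" "0 \<le> cmod (f t) * cmod (g t)" by auto
    then have "cmod (f t) * cmod (g t) \<le> (cmod (f t))\<^sup>2 + (cmod (g t))\<^sup>2"
      unfolding power2_diff by linarith
    then show "norm (f t * g t) \<le> norm ((cmod (f t))\<^sup>2 + (cmod (g t))\<^sup>2)" by (simp add: norm_mult)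
  qed
qed auto

lemma normal_density_square_integrable:
  assumes s: "s > 0"
  shows "integrable lborel (\<lambda>t. (normal_density 0 s (t0 - t))\<^sup>2)"
proof (rule Bochner_Integration.integrable_bound)
  have "integrable lborel (\<lambda>t. normal_density 0 s (t0 + (-1) * t))"
    using s by (intro lborel_integrable_real_affine integrable_normal_density) auto
  then show "integrable lborel (\<lambda>t. 1 / sqrt (2 * pi * s\<^sup>2) * normal_density 0 s (t0 - t))" by simp
  show "AE t in lborel. norm ((normal_density 0 s (t0 - t))\<^sup>2) \<le> norm (1 / sqrt (2 * pi * s\<^sup>2) * normal_density 0 s (t0 - t))"
  proof (rule AE_I2)
    fix t
    have "normal_density 0 s (t0 - t) \<le> 1 / sqrt (2 * pi * s\<^sup>2) * 1"
      unfolding normal_density_def by (intro mult_left_mono) auto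
    then show "norm ((normal_density 0 s (t0 - t))\<^sup>2) \<le> norm (1 / sqrt (2 * pi * s\<^sup>2) * normal_density 0 s (t0 - t))"
      using mult_right_mono[of "normal_density 0 s (t0 - t)" "1 / sqrt (2 * pi * s\<^sup>2)" "normal_density 0 s (t0 - t)"]
      by (simp add: power2_eq_square abs_mult)
  qed
qed auto

text \<open>As \<open>g\<close> is merely square integrable, its transform \<Gamma> is known only as
  an L^2 limit of transforms of truncations, and Fubini cannot be applied to it directly. For
  truncations Fubini is available; the limit is taken on the frequency side by Cauchy-Schwarz, the
  Gaussian being in L^2, and on the time side by dominated convergence.\<close>

lemma gaussian_pairing:
  fixes g \<Gamma> :: "real \<Rightarrow> complex"
  assumes [measurable]: "g \<in> borel_measurable lborel" "\<Gamma> \<in> borel_measurable lborel"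
    and g2: "integrable lborel (\<lambda>t. (cmod (g t))\<^sup>2)"
    and \<Gamma>1: "integrable lborel \<Gamma>"
    and lim: "((\<lambda>T. \<integral>\<^sup>+\<tau>. ennreal ((cmod (\<Gamma> \<tau> - (LINT t:{-T..T}|lborel. g t * cis (- (\<tau> * t)))))\<^sup>2) \<partial>lborel)
      \<longlongrightarrow> 0) at_top"
    and s: "s > 0"
  shows "(LINT \<tau>|lborel. \<Gamma> \<tau> * (cis (\<tau> * t0) * of_real (exp (- (s * \<tau>)\<^sup>2 / 2)))) =
    2 * pi * (LINT t|lborel. g t * of_real (normal_density 0 s (t0 - t)))"
proof -
  define \<phi> where "\<phi> = (\<lambda>\<tau>. cis (\<tau> * t0) * of_real (exp (- (s * \<tau>)\<^sup>2 / 2)) :: complex)"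
  define h where "h = (\<lambda>m::nat. \<lambda>t. indicator {-real m..real m} t *\<^sub>R g t)"
  define F where "F = (\<lambda>m \<tau>. LINT t|lborel. h m t * cis (- (\<tau> * t)))"
  define B where "B = (\<integral>\<^sup>+\<tau>. ennreal ((cmod (\<phi> \<tau>))\<^sup>2) \<partial>lborel)"
  have [measurable]: "\<phi> \<in> borel_measurable borel" unfolding \<phi>_def by measurable
  have [measurable]: "h m \<in> borel_measurable borel" for m unfolding h_def by measurable
  have [measurable]: "F m \<in> borel_measurable borel" for m
    unfolding F_def by measurable
  have norm_\<phi>: "cmod (\<phi> \<tau>) = exp (- (s * \<tau>)\<^sup>2 / 2)" for \<tau> by (simp add: \<phi>_def norm_mult)
  have \<phi>1: "integrable lborel \<phi>"
    by (rule Bochner_Integration.integrable_bound[OF gaussian_fourier(2)[OF s]]) (auto simp: norm_\<phi>)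
  have \<phi>2: "integrable lborel (\<lambda>\<tau>. (cmod (\<phi> \<tau>))\<^sup>2)"
    by (rule Bochner_Integration.integrable_bound[OF gaussian_fourier(2)[OF s]])
      (auto simp: norm_\<phi> power2_eq_square mult_left_le)
  have B: "B < \<top>" using \<phi>2 unfolding integrable_iff_bounded B_def by simp
  have h1: "integrable lborel (h m)" for m
  proof (rule Bochner_Integration.integrable_bound)
    show "integrable lborel (\<lambda>t. indicator {-real m..real m} t + (cmod (g t))\<^sup>2)"
      using g2 by (intro Bochner_Integration.integrable_add integrable_real_indicator) auto
    show "AE t in lborel. norm (h m t) \<le> norm (indicator {-real m..real m} t + (cmod (g t))\<^sup>2)"
    proof (rule AE_I2)
      fix t
      have "0 \<le> (cmod (g t) - 1)\<^sup>2" "0 \<le> cmod (g t)" by auto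
      then have "cmod (g t) \<le> 1 + (cmod (g t))\<^sup>2" unfolding power2_diff one_power2 by linarith
      then show "norm (h m t) \<le> norm (indicator {-real m..real m} t + (cmod (g t))\<^sup>2)"
        by (auto simp: h_def indicator_def)
    qed
  qed auto
  have Fbd: "cmod (F m \<tau>) \<le> (LINT t|lborel. cmod (h m t))" for m \<tau>
    unfolding F_def by (rule order_trans[OF integral_norm_bound]) (simp add: norm_mult)
  have F\<phi>: "integrable lborel (\<lambda>\<tau>. F m \<tau> * \<phi> \<tau>)" for m
    by (rule Bochner_Integration.integrable_bound[OF integrable_mult_right[OF integrable_norm[OF \<phi>1], of "LINT t|lborel. cmod (h m t)"]])
      (auto simp: norm_mult intro!: mult_right_mono order_trans[OF Fbd])
  have \<Gamma>\<phi>: "integrable lborel (\<lambda>\<tau>. \<Gamma> \<tau> * \<phi> \<tau>)"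
    by (rule Bochner_Integration.integrable_bound[OF \<Gamma>1]) (auto simp: norm_mult norm_\<phi> mult_left_le)
  have fub: "(LINT \<tau>|lborel. F m \<tau> * \<phi> \<tau>) = (LINT t|lborel. h m t * (2 * pi * of_real (normal_density 0 s (t0 - t))))" for m
  proof -
    define f where "f = (\<lambda>\<tau> t. h m t * cis (- (\<tau> * t)) * \<phi> \<tau>)"
    have nf: "norm (f \<tau> t) = cmod (h m t) * cmod (\<phi> \<tau>)" for \<tau> t by (simp add: f_def norm_mult)
    have [measurable]: "(\<lambda>(\<tau>, t). f \<tau> t) \<in> borel_measurable (lborel \<Otimes>\<^sub>M lborel)" unfolding f_def by measurable
    have "integrable (lborel \<Otimes>\<^sub>M lborel) (\<lambda>(\<tau>, t). f \<tau> t)"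
    proof (rule lborel_pair.Fubini_integrable)
      show "integrable lborel (\<lambda>\<tau>. LINT t|lborel. norm (case (\<tau>, t) of (\<tau>, t) \<Rightarrow> f \<tau> t))"
        using \<phi>1 by (simp add: nf)
      show "AE \<tau> in lborel. integrable lborel (\<lambda>t. case (\<tau>, t) of (\<tau>, t) \<Rightarrow> f \<tau> t)"
      proof (rule AE_I2)
        fix \<tau>
        show "integrable lborel (\<lambda>t. case (\<tau>, t) of (\<tau>, t) \<Rightarrow> f \<tau> t)"
          by (rule Bochner_Integration.integrable_bound[OF integrable_mult_left[OF integrable_norm[OF h1[of m]], of "cmod (\<phi> \<tau>)"]])
            (simp add: f_def, simp add: nf)
      qed
    qed simp
    then have "(LINT t|lborel. LINT \<tau>|lborel. f \<tau> t) = (LINT \<tau>|lborel. LINT t|lborel. f \<tau> t)"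
      by (rule lborel_pair.Fubini_integral)
    moreover have "(LINT t|lborel. f \<tau> t) = F m \<tau> * \<phi> \<tau>" for \<tau>
      unfolding f_def F_def by simp
    moreover have "(LINT \<tau>|lborel. f \<tau> t) = h m t * (2 * pi * of_real (normal_density 0 s (t0 - t)))" for t
    proof -
      have "f \<tau> t = h m t * (cis ((t0 - t) * \<tau>) * of_real (exp (- (s * \<tau>)\<^sup>2 / 2)))" for \<tau>
      proof -
        have "cis (- (\<tau> * t)) * cis (\<tau> * t0) = cis ((t0 - t) * \<tau>)" by (simp add: cis_mult algebra_simps)
        then show ?thesis by (simp add: f_def \<phi>_def mult.assoc[symmetric])
      qed
      then show ?thesis by (simp only: integral_mult_right_zero gaussian_fourier(1)[OF s]) simp
    qed
    ultimately show ?thesis by simp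
  qed
  have "(\<lambda>m. LINT \<tau>|lborel. F m \<tau> * \<phi> \<tau>) \<longlonglongrightarrow> (LINT \<tau>|lborel. \<Gamma> \<tau> * \<phi> \<tau>)"
  proof -
    let ?\<Delta> = "\<lambda>m. (LINT \<tau>|lborel. F m \<tau> * \<phi> \<tau>) - (LINT \<tau>|lborel. \<Gamma> \<tau> * \<phi> \<tau>)"
    define e where "e = (\<lambda>m::nat. \<integral>\<^sup>+\<tau>. ennreal ((cmod (\<Gamma> \<tau> - F m \<tau>))\<^sup>2) \<partial>lborel)"
    have "e \<longlonglongrightarrow> 0"
      using filterlim_compose[OF lim filterlim_real_sequentially]
      by (simp add: e_def F_def h_def set_lebesgue_integral_def)
    then have eB: "(\<lambda>m. e m * B) \<longlonglongrightarrow> 0 * B"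
      using B by (intro tendsto_mult_ennreal tendsto_const) auto
    let ?J = "\<lambda>m. \<integral>\<^sup>+\<tau>. ennreal (cmod (\<Gamma> \<tau> - F m \<tau>)) * ennreal (cmod (\<phi> \<tau>)) \<partial>lborel"
    have le: "ennreal ((cmod (?\<Delta> m))\<^sup>2) \<le> e m * B" for m
    proof -
      have "?\<Delta> m = (LINT \<tau>|lborel. (F m \<tau> - \<Gamma> \<tau>) * \<phi> \<tau>)"
        using F\<phi> \<Gamma>\<phi> by (simp add: left_diff_distrib)
      then have "ennreal (cmod (?\<Delta> m))
          \<le> (\<integral>\<^sup>+\<tau>. ennreal (cmod ((F m \<tau> - \<Gamma> \<tau>) * \<phi> \<tau>)) \<partial>lborel)"
        using integral_norm_bound_ennreal[of lborel "\<lambda>\<tau>. (F m \<tau> - \<Gamma> \<tau>) * \<phi> \<tau>"] F\<phi> \<Gamma>\<phi>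
        by (simp add: left_diff_distrib)
      also have "\<dots> = ?J m"
        by (intro nn_integral_cong) (simp add: norm_mult norm_minus_commute ennreal_mult)
      finally have "(ennreal (cmod (?\<Delta> m)))\<^sup>2
          \<le> (?J m)\<^sup>2"
        by (rule power_mono) simp
      also have "\<dots> \<le> e m * B"
        unfolding e_def B_def
        using Cauchy_Schwarz_nn_integral[of "\<lambda>\<tau>. ennreal (cmod (\<Gamma> \<tau> - F m \<tau>))" lborel "\<lambda>\<tau>. ennreal (cmod (\<phi> \<tau>))"]
        by (simp add: ennreal_power)
      finally show ?thesis by (simp add: ennreal_power)
    qed
    have "(\<lambda>m. ennreal ((cmod (?\<Delta> m))\<^sup>2)) \<longlonglongrightarrow> ennreal 0"
    proof (rule tendsto_sandwich[where f = "\<lambda>_. ennreal 0" and h = "\<lambda>m. e m * B"])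
      show "(\<lambda>m. e m * B) \<longlonglongrightarrow> ennreal 0" using eB by simp
    qed (simp_all add: le)
    then have "(\<lambda>m. (cmod (?\<Delta> m))\<^sup>2) \<longlonglongrightarrow> 0"
      by (rule tendsto_ennreal_iff[THEN iffD1, rotated -1]) simp_all
    from tendsto_real_sqrt[OF this] have "(\<lambda>m. cmod (?\<Delta> m)) \<longlonglongrightarrow> 0"
      by simp
    then show ?thesis by (simp add: tendsto_norm_zero_iff LIM_zero_iff)
  qed
  moreover have "(\<lambda>m. LINT t|lborel. h m t * (2 * pi * of_real (normal_density 0 s (t0 - t)))) \<longlonglongrightarrow>
      (LINT t|lborel. g t * (2 * pi * of_real (normal_density 0 s (t0 - t))))"
  proof (rule integral_dominated_convergence)
    let ?N = "\<lambda>t. 2 * pi * of_real (normal_density 0 s (t0 - t)) :: complex"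
    have "integrable lborel (\<lambda>t. g t * of_real (normal_density 0 s (t0 - t)))"
      using g2 normal_density_square_integrable[OF s] by (intro integrable_mult_of_square_integrable) auto
    then have "integrable lborel (\<lambda>t. 2 * pi * (g t * of_real (normal_density 0 s (t0 - t))))"
      by (rule integrable_mult_right)
    then have "integrable lborel (\<lambda>t. g t * ?N t)" by (simp add: mult_ac)
    then show "integrable lborel (\<lambda>t. cmod (g t * ?N t))" by (rule integrable_norm)
    show "AE t in lborel. norm (h m t * ?N t) \<le> cmod (g t * ?N t)" for m
      by (auto simp: h_def indicator_def)
    show "AE t in lborel. (\<lambda>m. h m t * ?N t) \<longlonglongrightarrow> g t * ?N t"
    proof (rule AE_I2)
      fix t :: real
      obtain m0 where "\<bar>t\<bar> \<le> real m0" using real_arch_simple by blast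
      then have "h m t * ?N t = g t * ?N t" if "m \<ge> m0" for m
        using that by (auto simp: h_def indicator_def)
      then show "(\<lambda>m. h m t * ?N t) \<longlonglongrightarrow> g t * ?N t"
        by (intro tendsto_eventually) (auto simp: eventually_sequentially)
    qed
  qed auto
  ultimately have "(LINT \<tau>|lborel. \<Gamma> \<tau> * \<phi> \<tau>) = (LINT t|lborel. g t * (2 * pi * of_real (normal_density 0 s (t0 - t))))"
    unfolding fub by (rule LIMSEQ_unique)
  also have "\<dots> = 2 * pi * (LINT t|lborel. g t * of_real (normal_density 0 s (t0 - t)))"
    by (subst integral_mult_right_zero[symmetric]) (simp add: mult_ac)
  finally show ?thesis unfolding \<phi>_def .
qed

text \<open>Gaussian summation: as the deviation tends to 0, the frequency side converges because
  \<Gamma> is integrable, while the time side is an approximate identity at \<open>t0\<close>. The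
  value \<open>d\<close> is tied to \<open>g\<close> only by essential continuity near
  \<open>t0\<close>, since \<open>g\<close> will come from an extension that is determined up to
  null sets.\<close>

lemma fourier_inversion:
  fixes g \<Gamma> :: "real \<Rightarrow> complex" and d :: complex
  assumes [measurable]: "g \<in> borel_measurable lborel" "\<Gamma> \<in> borel_measurable lborel"
    and g2: "integrable lborel (\<lambda>t. (cmod (g t))\<^sup>2)"
    and \<Gamma>1: "integrable lborel \<Gamma>"
    and lim: "((\<lambda>T. \<integral>\<^sup>+\<tau>. ennreal ((cmod (\<Gamma> \<tau> - (LINT t:{-T..T}|lborel. g t * cis (- (\<tau> * t)))))\<^sup>2) \<partial>lborel)
      \<longlongrightarrow> 0) at_top"
    and cont: "\<And>e. e > 0 \<Longrightarrow> \<exists>\<eta>>0. AE t in lborel. \<bar>t0 - t\<bar> < \<eta> \<longrightarrow> cmod (g t - d) \<le> e"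
  shows "(LINT \<tau>|lborel. \<Gamma> \<tau> * cis (\<tau> * t0)) = 2 * pi * d"
proof -
  define s where "s = (\<lambda>m::nat. inverse (real (Suc m)))"
  have s0: "s m > 0" "s m \<le> 1" for m by (auto simp: s_def inverse_le_1_iff)
  have slim: "s \<longlonglongrightarrow> 0" unfolding s_def by (rule LIMSEQ_inverse_real_of_nat)
  let ?N = "\<lambda>m t. normal_density 0 (s m) (t0 - t)"
  have Nint: "integrable lborel (?N m)" "(LINT t|lborel. ?N m t) = 1" for m
  proof -
    show "integrable lborel (?N m)"
      using lborel_integrable_real_affine[of "normal_density 0 (s m)" "-1" t0] s0 by simp
    show "(LINT t|lborel. ?N m t) = 1"
      using lborel_integral_real_affine[of "-1" "normal_density 0 (s m)" t0] s0 by simp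
  qed
  have gN: "integrable lborel (\<lambda>t. g t * of_real (?N m t))" for m
    using g2 normal_density_square_integrable[OF s0(1)] by (intro integrable_mult_of_square_integrable) auto
  let ?\<Phi> = "\<lambda>m \<tau>. \<Gamma> \<tau> * (cis (\<tau> * t0) * of_real (exp (- (s m * \<tau>)\<^sup>2 / 2)))"
  have L1: "(\<lambda>m. LINT \<tau>|lborel. ?\<Phi> m \<tau>) \<longlonglongrightarrow>
      (LINT \<tau>|lborel. \<Gamma> \<tau> * cis (\<tau> * t0))"
  proof (rule integral_dominated_convergence)
    show "integrable lborel (\<lambda>\<tau>. cmod (\<Gamma> \<tau>))" using \<Gamma>1 by (rule integrable_norm)
    show "AE \<tau> in lborel. (\<lambda>m. ?\<Phi> m \<tau>) \<longlonglongrightarrow> \<Gamma> \<tau> * cis (\<tau> * t0)"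
    proof (rule AE_I2)
      fix \<tau>
      have "(\<lambda>m. ?\<Phi> m \<tau>) \<longlonglongrightarrow>
          \<Gamma> \<tau> * (cis (\<tau> * t0) * of_real (exp (- (0 * \<tau>)\<^sup>2 / 2)))"
        by (intro tendsto_intros slim) auto
      then show "(\<lambda>m. ?\<Phi> m \<tau>) \<longlonglongrightarrow> \<Gamma> \<tau> * cis (\<tau> * t0)" by simp
    qed
  qed (auto simp: norm_mult mult_left_le)
  let ?A = "\<lambda>m. LINT t|lborel. g t * of_real (?N m t)"
  have L2: "(\<lambda>m. ?A m) \<longlonglongrightarrow> d"
  proof (rule LIMSEQ_I)
    fix r :: real assume r: "r > 0"
    obtain \<eta> where \<eta>: "\<eta> > 0" "AE t in lborel. \<bar>t0 - t\<bar> < \<eta> \<longrightarrow> cmod (g t - d) \<le> r / 2"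
      using cont[of "r / 2"] r by auto
    \<comment> \<open>A fixed Gaussian weight makes \<open>g\<close>, which is only in L^2,
      integrable; away from \<open>t0\<close> every kernel is at most a multiple of its deviation
      times this weight.\<close>
    define w where "w = (\<lambda>t. (cmod (g t) + cmod d) * exp (- (t0 - t)\<^sup>2 / 4))"
    define W where "W = (LINT t|lborel. w t)"
    have wint: "integrable lborel w"
    proof -
      have e: "exp (- (t0 - t)\<^sup>2 / 4) = sqrt (4 * pi) * normal_density 0 (sqrt 2) (t0 - t)" for t
        by (simp add: normal_density_def)
      have 1: "integrable lborel (\<lambda>t. normal_density 0 (sqrt 2) (t0 - t))"
        using lborel_integrable_real_affine[of "normal_density 0 (sqrt 2)" "-1" t0] by simp
      have 2: "integrable lborel (\<lambda>t. cmod (g t * of_real (normal_density 0 (sqrt 2) (t0 - t))))"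
        using g2 normal_density_square_integrable[of "sqrt 2"]
        by (intro integrable_norm integrable_mult_of_square_integrable) auto
      have "integrable lborel (\<lambda>t. sqrt (4 * pi) * (cmod (g t * of_real (normal_density 0 (sqrt 2) (t0 - t)))
          + cmod d * normal_density 0 (sqrt 2) (t0 - t)))"
        by (intro integrable_mult_right Bochner_Integration.integrable_add 1 2)
      then show ?thesis unfolding w_def e by (simp add: norm_mult algebra_simps)
    qed
    \<comment> \<open>The exponent is halved. One half, at distance at least \<eta>, yields exp (-z)
      \<le> 1 / z = 4 \<sigma>^2 / \<eta>^2, which beats the normalisation 1 / \<sigma>; the other
      half is below the fixed Gaussian as \<sigma> \<le> 1.\<close>
    have tail: "?N m t \<le> 4 * s m / \<eta>\<^sup>2 * exp (- (t0 - t)\<^sup>2 / 4)" if "\<bar>t0 - t\<bar> \<ge> \<eta>" for m t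
    proof -
      define \<sigma> where "\<sigma> = s m"
      have \<sigma>: "0 < \<sigma>" "\<sigma> \<le> 1" using s0 by (auto simp: \<sigma>_def)
      have u2: "\<eta>\<^sup>2 \<le> (t0 - t)\<^sup>2" using that \<eta> by (metis abs_le_square_iff abs_of_pos)
      have "\<sigma>\<^sup>2 \<le> 1" using \<sigma> by (simp add: power_le_one)
      then have a: "(t0 - t)\<^sup>2 / 4 \<le> (t0 - t)\<^sup>2 / (4 * \<sigma>\<^sup>2)" using \<sigma> by (intro divide_left_mono) auto
      have b: "\<eta>\<^sup>2 / (4 * \<sigma>\<^sup>2) \<le> (t0 - t)\<^sup>2 / (4 * \<sigma>\<^sup>2)" using u2 by (intro divide_right_mono) auto
      have c: "(t0 - t)\<^sup>2 / (2 * \<sigma>\<^sup>2) = (t0 - t)\<^sup>2 / (4 * \<sigma>\<^sup>2) + (t0 - t)\<^sup>2 / (4 * \<sigma>\<^sup>2)" by simp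
      define z where "z = \<eta>\<^sup>2 / (4 * \<sigma>\<^sup>2)"
      have z: "z > 0" using \<eta> \<sigma> by (simp add: z_def)
      have "z \<le> exp z" using exp_ge_add_one_self[of z] by linarith
      then have "exp (- z) \<le> 1 / z"
        using z by (simp add: exp_minus field_simps)
      then have d: "exp (- z) \<le> 4 * \<sigma>\<^sup>2 / \<eta>\<^sup>2" by (simp add: z_def)
      have "sqrt (2 * pi * \<sigma>\<^sup>2) \<ge> sqrt (\<sigma>\<^sup>2)" using pi_ge_two \<sigma> by (intro real_sqrt_le_mono) (simp add: field_simps)
      then have q: "1 / sqrt (2 * pi * \<sigma>\<^sup>2) \<le> 1 / \<sigma>" using \<sigma> by (intro divide_left_mono) auto
      have "?N m t = 1 / sqrt (2 * pi * \<sigma>\<^sup>2) * exp (- (t0 - t)\<^sup>2 / (2 * \<sigma>\<^sup>2))"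
        by (simp add: normal_density_def \<sigma>_def)
      also have "\<dots> \<le> 1 / \<sigma> * exp (- (z + (t0 - t)\<^sup>2 / 4))"
        using a b c q \<sigma> unfolding z_def by (intro mult_mono) auto
      also have "\<dots> = 1 / \<sigma> * exp (- z) * exp (- (t0 - t)\<^sup>2 / 4)" by (simp add: exp_add[symmetric])
      also have "\<dots> \<le> 1 / \<sigma> * (4 * \<sigma>\<^sup>2 / \<eta>\<^sup>2) * exp (- (t0 - t)\<^sup>2 / 4)"
        using d \<sigma> by (intro mult_right_mono mult_left_mono) auto
      also have "\<dots> = 4 * \<sigma> / \<eta>\<^sup>2 * exp (- (t0 - t)\<^sup>2 / 4)" using \<sigma> by (simp add: power2_eq_square)
      finally show ?thesis by (simp add: \<sigma>_def)
    qed
    have est: "cmod (?A m - d) \<le> r / 2 + 4 * s m / \<eta>\<^sup>2 * W" for m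
    proof -
      have dN: "integrable lborel (\<lambda>t. d * of_real (?N m t))"
        using Nint(1)[of m] by (intro integrable_mult_right integrable_of_real)
      have "(LINT t|lborel. d * of_real (?N m t)) = d"
        using Nint(1)[of m] Nint(2)[of m] by (simp add: integral_of_real)
      then have "?A m - d =
          ?A m - (LINT t|lborel. d * of_real (?N m t))" by simp
      also have "\<dots> = (LINT t|lborel. g t * of_real (?N m t) - d * of_real (?N m t))"
        by (rule Bochner_Integration.integral_diff[symmetric, OF gN dN])
      finally have eq: "?A m - d = (LINT t|lborel. g t * of_real (?N m t) - d * of_real (?N m t))" .
      have "cmod (LINT t|lborel. g t * of_real (?N m t) - d * of_real (?N m t)) \<le>
          (LINT t|lborel. cmod (g t * of_real (?N m t) - d * of_real (?N m t)))"
        by (rule integral_norm_bound)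
      also have "\<dots> \<le> (LINT t|lborel. r / 2 * ?N m t + 4 * s m / \<eta>\<^sup>2 * w t)"
      proof (rule integral_mono_AE)
        show "integrable lborel (\<lambda>t. cmod (g t * of_real (?N m t) - d * of_real (?N m t)))"
          using gN dN by (intro integrable_norm Bochner_Integration.integrable_diff)
        show "integrable lborel (\<lambda>t. r / 2 * ?N m t + 4 * s m / \<eta>\<^sup>2 * w t)"
          using Nint wint by (intro Bochner_Integration.integrable_add integrable_mult_right)
        show "AE t in lborel. cmod (g t * of_real (?N m t) - d * of_real (?N m t)) \<le> r / 2 * ?N m t + 4 * s m / \<eta>\<^sup>2 * w t"
          using \<eta>(2)
        proof eventually_elim
          case (elim t)
          have eq: "cmod (g t * of_real (?N m t) - d * of_real (?N m t)) = cmod (g t - d) * ?N m t"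
            by (simp add: left_diff_distrib[symmetric] norm_mult)
          show ?case
          proof (cases "\<bar>t0 - t\<bar> < \<eta>")
            case True
            have "cmod (g t - d) * ?N m t \<le> r / 2 * ?N m t" using elim True by (intro mult_right_mono) auto
            moreover have "0 \<le> 4 * s m / \<eta>\<^sup>2 * w t" using s0[of m] by (auto simp: w_def intro!: mult_nonneg_nonneg)
            ultimately show ?thesis unfolding eq by linarith
          next
            case False
            have "cmod (g t - d) * ?N m t \<le> (cmod (g t) + cmod d) * (4 * s m / \<eta>\<^sup>2 * exp (- (t0 - t)\<^sup>2 / 4))"
              using False by (intro mult_mono tail norm_triangle_ineq4) auto
            then have "cmod (g t - d) * ?N m t \<le> 4 * s m / \<eta>\<^sup>2 * w t" by (simp add: w_def mult_ac)
            moreover have "0 \<le> r / 2 * ?N m t" using r by simp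
            ultimately show ?thesis unfolding eq by linarith
          qed
        qed
      qed
      also have "\<dots> = (LINT t|lborel. r / 2 * ?N m t) + (LINT t|lborel. 4 * s m / \<eta>\<^sup>2 * w t)"
        using Nint(1) wint by (intro Bochner_Integration.integral_add integrable_mult_right)
      also have "\<dots> = r / 2 + 4 * s m / \<eta>\<^sup>2 * W"
        by (simp only: integral_mult_right_zero Nint(2) W_def)
      finally show ?thesis unfolding eq .
    qed
    have "(\<lambda>m. 4 * s m / \<eta>\<^sup>2 * W) \<longlonglongrightarrow> 4 * 0 / \<eta>\<^sup>2 * W"
      using \<eta> by (intro tendsto_intros slim) auto
    then have "(\<lambda>m. 4 * s m / \<eta>\<^sup>2 * W) \<longlonglongrightarrow> 0" by simp
    from order_tendstoD(2)[OF this, of "r / 2"] r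
    obtain m0 where m0: "\<And>m. m \<ge> m0 \<Longrightarrow> 4 * s m / \<eta>\<^sup>2 * W < r / 2" by (auto simp: eventually_sequentially)
    show "\<exists>m0. \<forall>m\<ge>m0. cmod (?A m - d) < r"
    proof (intro exI allI impI)
      fix m assume "m \<ge> m0"
      from est[of m] m0[OF this] show "cmod (?A m - d) < r" by linarith
    qed
  qed
  have "(\<lambda>m. 2 * pi * ?A m) \<longlonglongrightarrow> 2 * pi * d"
    by (intro tendsto_intros L2)
  then show ?thesis
    using L1 unfolding gaussian_pairing[OF assms(1-5) s0(1)] by (intro LIMSEQ_unique) 
qed

section \<open>Curves in Bourgain spaces\<close>

lemma jbr_ge_1: "jbr v \<ge> 1"
  by (simp add: jbr_def)

lemma jbr_pos: "jbr v > 0"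
  using jbr_ge_1[of v] by linarith

lemma jbr_ge_norm: "jbr v \<ge> norm v"
  unfolding jbr_def by (rule real_le_rsqrt) simp

lemma jbr_real_measurable [measurable]: "(jbr :: real \<Rightarrow> real) \<in> borel_measurable borel"
  unfolding jbr_def by measurable

text \<open>Comparison with a power of 1 + |\<tau>|, which has an explicit antiderivative. It is
  applied with p = 2 b, so this is where b > 1/2 acts.\<close>

lemma nn_integral_jbr_finite:
  assumes p: "p > 1"
  shows "(\<integral>\<^sup>+\<tau>. ennreal (jbr (\<tau>::real) powr (- p)) \<partial>lborel) < \<infinity>"
proof -
  define f where "f = (\<lambda>\<tau>::real. 2 powr p * (1 + \<tau>) powr (- p))"
  define F where "F = (\<lambda>\<tau>::real. 2 powr p * ((1 + \<tau>) powr (1 - p) / (1 - p)))"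
  have [measurable]: "f \<in> borel_measurable borel" unfolding f_def by measurable
  have half: "(\<integral>\<^sup>+\<tau>. ennreal (f \<tau>) * indicator {0..} \<tau> \<partial>lborel) = ennreal (0 - F 0)"
  proof (rule nn_integral_FTC_atLeast)
    fix \<tau> :: real assume "0 \<le> \<tau>"
    then have "DERIV (\<lambda>\<tau>. (1 + \<tau>) powr (1 - p)) \<tau> :> (1 - p) * (1 + \<tau>) powr (1 - p - of_nat 1) * 1"
      by (intro DERIV_fun_powr) (auto intro!: derivative_eq_intros)
    then have "DERIV F \<tau> :> 2 powr p * ((1 - p) * (1 + \<tau>) powr (1 - p - of_nat 1) * 1 / (1 - p))"
      unfolding F_def by (intro DERIV_cmult DERIV_cdivide)
    then show "DERIV F \<tau> :> f \<tau>" using p by (simp add: f_def)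
    show "0 \<le> f \<tau>" by (simp add: f_def)
  next
    have "((\<lambda>\<tau>::real. (1 + \<tau>) powr (1 - p)) \<longlongrightarrow> 0) at_top"
      using p by (intro tendsto_neg_powr filterlim_tendsto_add_at_top[OF tendsto_const] filterlim_ident) auto
    then have "((\<lambda>\<tau>::real. 2 powr p * ((1 + \<tau>) powr (1 - p) / (1 - p))) \<longlongrightarrow> 2 powr p * (0 / (1 - p))) at_top"
      using p by (intro tendsto_intros) auto
    then show "(F \<longlongrightarrow> 0) at_top" by (simp add: F_def)
  qed simp
  have pt: "ennreal (jbr \<tau> powr (- p)) \<le> ennreal (f \<tau>) * indicator {0..} \<tau> + ennreal (f (- \<tau>)) * indicator {0..} (- \<tau>)" for \<tau> :: real
  proof -
    have "(1 + \<bar>\<tau>\<bar>) / 2 \<le> jbr \<tau>" using jbr_ge_1[of \<tau>] jbr_ge_norm[of \<tau>] by simp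
    then have "jbr \<tau> powr (- p) \<le> ((1 + \<bar>\<tau>\<bar>) / 2) powr (- p)" using p by (intro powr_mono2') auto
    also have "\<dots> = f \<bar>\<tau>\<bar>" by (simp add: f_def powr_divide powr_minus field_simps)
    finally have "jbr \<tau> powr (- p) \<le> f \<bar>\<tau>\<bar>" .
    then show ?thesis by (cases "\<tau> \<ge> 0") (auto simp: indicator_def abs_if intro!: ennreal_leI add_increasing2)
  qed
  have "(\<integral>\<^sup>+\<tau>. ennreal (jbr (\<tau>::real) powr (- p)) \<partial>lborel) \<le>
     (\<integral>\<^sup>+\<tau>. ennreal (f \<tau>) * indicator {0..} \<tau> + ennreal (f (- \<tau>)) * indicator {0..} (- \<tau>) \<partial>lborel)"
    by (intro nn_integral_mono pt)
  also have "\<dots> = (\<integral>\<^sup>+\<tau>. ennreal (f \<tau>) * indicator {0..} \<tau> \<partial>lborel) + (\<integral>\<^sup>+\<tau>. ennreal (f (- \<tau>)) * indicator {0..} (- \<tau>) \<partial>lborel)"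
    by (rule nn_integral_add) auto
  also have "(\<integral>\<^sup>+\<tau>. ennreal (f (- \<tau>)) * indicator {0..} (- \<tau>) \<partial>lborel) = (\<integral>\<^sup>+\<tau>. ennreal (f \<tau>) * indicator {0..} \<tau> \<partial>lborel)"
    using nn_integral_real_affine[of "\<lambda>\<tau>. ennreal (f \<tau>) * indicator {0..} \<tau>" "-1" 0] by simp
  finally show ?thesis unfolding half by (rule le_less_trans) simp
qed

lemma jbr_fvec_ge:
  assumes "n \<notin> sq N"
  shows "jbr (fvec n) \<ge> real N"
proof -
  have "int N < \<bar>fst n\<bar> \<or> int N < \<bar>snd n\<bar>" using assms by (cases n) (auto simp: sq_def)
  then have "real N \<le> \<bar>real_of_int (fst n)\<bar> \<or> real N \<le> \<bar>real_of_int (snd n)\<bar>"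
    by (metis less_imp_le of_int_abs of_int_le_iff of_int_of_nat_eq)
  then have "real N \<le> norm (fvec n)"
    using norm_fst_le[of "fst (fvec n)" "snd (fvec n)"] norm_snd_le[of "snd (fvec n)" "fst (fvec n)"]
    by (auto simp: fvec_def)
  then show ?thesis using jbr_ge_norm[of "fvec n"] by linarith
qed

lemma block_disjoint: "disjoint_family block"
proof -
  have *: "block i \<inter> block j = {}" if "i < j" for i j
  proof -
    have "(2::nat) ^ Suc i \<le> 2 ^ j" using that by (intro power_increasing) auto
    then have "sq (2 ^ Suc i) \<subseteq> sq (2 ^ j)" by (rule sq_mono)
    then show ?thesis by (auto simp: block_def)
  qed
  show ?thesis
    unfolding disjoint_family_on_def using * by (metis Int_commute linorder_neqE_nat)
qed

lemma sum_block_le: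
  fixes v :: "freq \<Rightarrow> ennreal"
  shows "(\<Sum>k. \<Sum>n\<in>block k. v n) \<le> (\<integral>\<^sup>+n. v n \<partial>count_space UNIV)"
proof -
  have fin: "finite (block k)" for k by (simp add: block_def)
  have "(\<Sum>k. \<Sum>n\<in>block k. v n) = (\<Sum>k. \<integral>\<^sup>+n. v n * indicator (block k) n \<partial>count_space UNIV)"
    using fin by (intro suminf_cong)
      (simp add: nn_integral_count_space_indicator[symmetric] nn_integral_count_space_finite)
  also have "\<dots> = (\<integral>\<^sup>+n. (\<Sum>k. v n * indicator (block k) n) \<partial>count_space UNIV)"
    by (rule nn_integral_suminf[symmetric]) simp
  also have "\<dots> \<le> (\<integral>\<^sup>+n. v n \<partial>count_space UNIV)"
  proof (rule nn_integral_mono)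
    fix n
    have "(\<Sum>k. v n * indicator (block k) n) = v n * indicator (\<Union>k. block k) n"
      by (simp add: suminf_indicator[OF block_disjoint])
    also have "\<dots> \<le> v n" by (simp add: indicator_def)
    finally show "(\<Sum>k. v n * indicator (block k) n) \<le> v n" .
  qed
  finally show ?thesis .
qed

lemma mult_le_sum_squares: "x * y \<le> x\<^sup>2 + y\<^sup>2" for x y :: real
proof -
  have "0 \<le> (x - y)\<^sup>2" "0 \<le> (x + y)\<^sup>2" by auto
  then show ?thesis unfolding power2_diff power2_sum by linarith
qed

section \<open>Curves as superpositions of free solutions\<close>

definition X_weight :: "real \<Rightarrow> real \<Rightarrow> (freq \<Rightarrow> real \<Rightarrow> complex) \<Rightarrow> freq \<Rightarrow> ennreal" where
  "X_weight s b \<Gamma> n = (\<integral>\<^sup>+\<tau>. ennreal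
        (jbr (fvec n) powr (2 * s) * jbr (\<tau> + (norm (fvec n))\<^sup>2) powr (2 * b) * (cmod (\<Gamma> n \<tau>))\<^sup>2) \<partial>lborel)"

definition X_energy :: "real \<Rightarrow> real \<Rightarrow> (freq \<Rightarrow> real \<Rightarrow> complex) \<Rightarrow> ennreal" where
  "X_energy s b \<Gamma> = (\<integral>\<^sup>+n. X_weight s b \<Gamma> n \<partial>count_space UNIV)"

context
  fixes \<Gamma> :: "freq \<Rightarrow> real \<Rightarrow> complex" and s b :: real
  assumes \<Gamma>_meas [measurable]: "\<And>n. \<Gamma> n \<in> borel_measurable lborel"
    and s: "s > 1 / 2" and b: "b > 1 / 2"
    and fin: "X_energy s b \<Gamma> < \<infinity>"
begin

text \<open>After this translation the modulation weight is the same for all n, so a single value of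
  \<rho> carries the data of one free solution.\<close>

abbreviation shifted :: "freq \<Rightarrow> real \<Rightarrow> complex" where
  "shifted n \<rho> \<equiv> \<Gamma> n (\<rho> - (norm (fvec n))\<^sup>2)"

lemma X_weight_shift:
  "X_weight s b \<Gamma> n = (\<integral>\<^sup>+\<rho>. ennreal (jbr (fvec n) powr (2 * s) * jbr \<rho> powr (2 * b) *
     (cmod (shifted n \<rho>))\<^sup>2) \<partial>lborel)"
  unfolding X_weight_def
  by (subst nn_integral_real_affine[of _ 1 "- (norm (fvec n))\<^sup>2"]) (auto simp: algebra_simps)

text \<open>The function is the product of \<open>jbr \<rho> powr (- b)\<close>, square integrable
  because b > 1/2, and a factor whose square is controlled by the energy.\<close>

lemma integrable_shift: "integrable lborel (\<lambda>\<rho>. shifted n \<rho>)"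
  unfolding integrable_iff_bounded
proof
  have "ennreal (cmod (shifted n \<rho>)) \<le> ennreal (jbr \<rho> powr (- (2 * b))) +
      ennreal (jbr (fvec n) powr (2 * s) * jbr \<rho> powr (2 * b) * (cmod (shifted n \<rho>))\<^sup>2)" for \<rho>
  proof -
    let ?g = "cmod (shifted n \<rho>)"
    have "jbr \<rho> powr (- b) * (jbr \<rho> powr b * ?g) \<le> (jbr \<rho> powr (- b))\<^sup>2 + (jbr \<rho> powr b * ?g)\<^sup>2"
      by (rule mult_le_sum_squares)
    moreover have "jbr \<rho> powr (- b) * (jbr \<rho> powr b * ?g) = ?g"
      using jbr_pos[of \<rho>] by (simp add: mult.assoc[symmetric] powr_add[symmetric])
    moreover have "(jbr \<rho> powr (- b))\<^sup>2 = jbr \<rho> powr (- (2 * b))" "(jbr \<rho> powr b)\<^sup>2 = jbr \<rho> powr (2 * b)"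
      by (simp_all add: power2_eq_square powr_add[symmetric])
    moreover have "jbr \<rho> powr (2 * b) * ?g\<^sup>2 \<le> jbr (fvec n) powr (2 * s) * (jbr \<rho> powr (2 * b) * ?g\<^sup>2)"
      using mult_right_mono[of 1 "jbr (fvec n) powr (2 * s)" "jbr \<rho> powr (2 * b) * ?g\<^sup>2"]
        ge_one_powr_ge_zero[OF jbr_ge_1, of "2 * s" "fvec n"] s by simp
    ultimately have "?g \<le> jbr \<rho> powr (- (2 * b)) + jbr (fvec n) powr (2 * s) * jbr \<rho> powr (2 * b) * ?g\<^sup>2"
      by (simp add: power_mult_distrib mult.assoc)
    then show ?thesis by (subst ennreal_plus[symmetric]) (simp, simp, rule ennreal_leI)
  qed
  then have "(\<integral>\<^sup>+\<rho>. ennreal (cmod (shifted n \<rho>)) \<partial>lborel) \<le>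
      (\<integral>\<^sup>+\<rho>. ennreal (jbr \<rho> powr (- (2 * b))) + ennreal (jbr (fvec n) powr (2 * s) * jbr \<rho> powr (2 * b) *
        (cmod (shifted n \<rho>))\<^sup>2) \<partial>lborel)"
    by (intro nn_integral_mono)
  also have "\<dots> = (\<integral>\<^sup>+\<rho>. ennreal (jbr (\<rho>::real) powr (- (2 * b))) \<partial>lborel) + X_weight s b \<Gamma> n"
    unfolding X_weight_shift by (rule nn_integral_add) auto
  also have "\<dots> < \<infinity>"
  proof -
    have "X_weight s b \<Gamma> n \<le> (\<integral>\<^sup>+n. X_weight s b \<Gamma> n \<partial>count_space UNIV)"
      by (rule nn_integral_ge_point) simp
    then have "X_weight s b \<Gamma> n < \<infinity>" using fin unfolding X_energy_def by (rule le_less_trans)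
    then show ?thesis using nn_integral_jbr_finite[of "2 * b"] b by simp
  qed
  finally show "(\<integral>\<^sup>+\<rho>. ennreal (cmod (shifted n \<rho>)) \<partial>lborel) < \<infinity>" .
qed measurable

lemma integrable_\<Gamma>: "integrable lborel (\<Gamma> n)"
  using lborel_integrable_real_affine[OF integrable_shift, of 1 n "(norm (fvec n))\<^sup>2"] by simp

text \<open>The inversion integral converges absolutely, so it has a value at every single
  \<open>t\<close>: the continuous representative of coefficients that the extension fixes only for
  almost every time.\<close>

definition curve :: "freq \<Rightarrow> real \<Rightarrow> complex" where
  "curve n t = (LINT \<tau>|lborel. \<Gamma> n \<tau> * cis (\<tau> * t)) / (2 * pi)"


lemma curve_eqI: "(LINT \<tau>|lborel. \<Gamma> n \<tau> * cis (\<tau> * t)) = 2 * pi * d \<Longrightarrow> curve n t = d" for d :: complex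
  by (simp add: curve_def)

lemma continuous_on_curve: "continuous_on UNIV (curve n)"
  unfolding continuous_on_sequentially comp_def
proof (intro allI ballI impI, elim conjE)
  fix x :: "nat \<Rightarrow> real" and t assume x: "x \<longlonglongrightarrow> t"
  have "(\<lambda>i. LINT \<tau>|lborel. \<Gamma> n \<tau> * cis (\<tau> * x i)) \<longlonglongrightarrow> (LINT \<tau>|lborel. \<Gamma> n \<tau> * cis (\<tau> * t))"
  proof (rule integral_dominated_convergence)
    show "integrable lborel (\<lambda>\<tau>. cmod (\<Gamma> n \<tau>))" using integrable_\<Gamma> by (rule integrable_norm)
    show "AE \<tau> in lborel. (\<lambda>i. \<Gamma> n \<tau> * cis (\<tau> * x i)) \<longlonglongrightarrow> \<Gamma> n \<tau> * cis (\<tau> * t)"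
      by (intro AE_I2 tendsto_intros x)
  qed (auto simp: norm_mult)
  then show "(\<lambda>i. curve n (x i)) \<longlonglongrightarrow> curve n t"
    unfolding curve_def by (intro tendsto_intros) auto
qed

text \<open>Modulating each time frequency \<open>\<rho> = \<tau> + |n|\<^sup>2\<close> separately exhibits the curve as a superposition of free
  solutions.\<close>

lemma cmod_sum_curve_le:
  assumes A: "finite A"
  shows "ennreal (cmod (\<Sum>n\<in>A. curve n t * char n x)) \<le>
    (\<integral>\<^sup>+\<rho>. ennreal (cmod (\<Sum>n\<in>A. shifted n \<rho> * wave t x n)) \<partial>lborel)"
proof -
  define f where "f = (\<lambda>n \<rho>. shifted n \<rho> * cis ((\<rho> - (norm (fvec n))\<^sup>2) * t) * char n x)"
  have int: "integrable lborel (f n)" for n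
    by (rule Bochner_Integration.integrable_bound[OF integrable_shift[of n]]) (simp add: f_def, simp add: f_def norm_mult)
  have c: "curve n t * char n x = (LINT \<rho>|lborel. f n \<rho>) / (2 * pi)" for n
  proof -
    have "(LINT \<tau>|lborel. \<Gamma> n \<tau> * cis (\<tau> * t)) =
      (LINT \<rho>|lborel. shifted n \<rho> * cis ((\<rho> - (norm (fvec n))\<^sup>2) * t))"
      using lborel_integral_real_affine[of 1 "\<lambda>\<tau>. \<Gamma> n \<tau> * cis (\<tau> * t)" "- (norm (fvec n))\<^sup>2"]
      by simp
    then show ?thesis by (simp add: curve_def f_def)
  qed
  have "(\<Sum>n\<in>A. curve n t * char n x) = (LINT \<rho>|lborel. (\<Sum>n\<in>A. f n \<rho>)) / (2 * pi)"
    unfolding c sum_divide_distrib[symmetric] by (subst Bochner_Integration.integral_sum) (use int in auto)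
  then have "cmod (\<Sum>n\<in>A. curve n t * char n x) = cmod (LINT \<rho>|lborel. (\<Sum>n\<in>A. f n \<rho>)) / (2 * pi)"
    by (simp add: norm_divide norm_mult)
  also have "\<dots> \<le> cmod (LINT \<rho>|lborel. (\<Sum>n\<in>A. f n \<rho>))"
    using mult_left_mono[of 1 "2 * pi" "cmod (LINT \<rho>|lborel. (\<Sum>n\<in>A. f n \<rho>))"] pi_ge_two
    by (simp add: pos_divide_le_eq)
  finally have "cmod (\<Sum>n\<in>A. curve n t * char n x) \<le> cmod (LINT \<rho>|lborel. (\<Sum>n\<in>A. f n \<rho>))" .
  then have "ennreal (cmod (\<Sum>n\<in>A. curve n t * char n x)) \<le> ennreal (cmod (LINT \<rho>|lborel. (\<Sum>n\<in>A. f n \<rho>)))"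
    by (intro ennreal_leI) simp
  also have "\<dots> \<le> (\<integral>\<^sup>+\<rho>. ennreal (cmod (\<Sum>n\<in>A. f n \<rho>)) \<partial>lborel)"
    using int by (intro integral_norm_bound_ennreal Bochner_Integration.integrable_sum)
  also have "(\<lambda>\<rho>. cmod (\<Sum>n\<in>A. f n \<rho>)) =
    (\<lambda>\<rho>. cmod (\<Sum>n\<in>A. shifted n \<rho> * wave t x n))"
  proof
    fix \<rho>
    have "f n \<rho> = cis (\<rho> * t) * (shifted n \<rho> * wave t x n)" for n
    proof -
      have "cis ((\<rho> - (norm (fvec n))\<^sup>2) * t) = cis (\<rho> * t) * cis (- (t * (norm (fvec n))\<^sup>2))"
        by (simp add: cis_mult algebra_simps)
      then show ?thesis by (simp add: f_def wave_def mult_ac)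
    qed
    then show "cmod (\<Sum>n\<in>A. f n \<rho>) =
      cmod (\<Sum>n\<in>A. shifted n \<rho> * wave t x n)"
      by (simp add: sum_distrib_left[symmetric] norm_mult)
  qed
  finally show ?thesis .
qed

text \<open>Minkowski's principle: the maximal function of a superposition is at most the
  superposition of the maximal functions.\<close>

definition curve_max :: "nat \<Rightarrow> point \<Rightarrow> ennreal" where
  "curve_max k x = (\<integral>\<^sup>+\<rho>. ennreal (ring_max k (\<lambda>n. shifted n \<rho>) x) \<partial>lborel)"

lemma partial_sum_le_curve_max:
  assumes "2 ^ k \<le> m" "m \<le> 2 ^ Suc k"
  shows "ennreal (cmod ((\<Sum>n\<in>sq m. curve n t * char n x) - (\<Sum>n\<in>sq (2 ^ k). curve n t * char n x))) \<le> curve_max k x"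
  unfolding sum_sq_diff[OF assms(1)] curve_max_def
  by (rule order_trans[OF cmod_sum_curve_le])
    (auto intro!: nn_integral_mono ennreal_leI partial_sum_le_ring_max[OF assms] del: disjE)

lemma curve_max_measurable [measurable]: "curve_max k \<in> borel_measurable borel"
proof -
  have [measurable]: "(\<lambda>(x, \<rho>). ennreal (ring_max k (\<lambda>n. shifted n \<rho>) x)) \<in> borel_measurable (borel \<Otimes>\<^sub>M lborel)"
    by measurable
  show ?thesis unfolding curve_max_def by measurable
qed

text \<open>The maximal estimate is applied for each \<rho> to data \<open>shifted n \<rho>\<close>.
  Its bound is split as X Y \<le> X^2 + Y^2, where X^2 decays geometrically in k and is integrable
  in \<rho>, and Y^2 is at most the part of the energy density carried by the block.\<close>

lemma nn_integral_curve_max: "(\<integral>\<^sup>+x. (\<Sum>k. curve_max k x) \<partial>torus) < \<infinity>"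
proof -
  \<comment> \<open>Chosen so that s = 1/2 + \<epsilon> + \<epsilon>/2: the maximal estimate spends
    1/2 + \<epsilon>, and \<epsilon>/2 is kept for summation over the blocks.\<close>
  define \<epsilon> where "\<epsilon> = (2 * s - 1) / 3"
  have \<epsilon>: "\<epsilon> > 0" using s by (simp add: \<epsilon>_def)
  obtain C where C: "C > 0" "\<And>k a. (\<integral>\<^sup>+x. ennreal (ring_max k a x) \<partial>torus) \<le>
    ennreal (C * 2 powr (real k * (1 / 2 + \<epsilon>)) * sqrt (\<Sum>n\<in>block k. (cmod (a n))\<^sup>2))"
    using nn_integral_ring_max_le[OF \<epsilon>] by blast
  define I where "I = (\<integral>\<^sup>+\<tau>. ennreal (jbr (\<tau>::real) powr (- (2 * b))) \<partial>lborel)"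
  have I: "I < \<infinity>" unfolding I_def using b by (intro nn_integral_jbr_finite) simp
  have bound: "(\<integral>\<^sup>+x. curve_max k x \<partial>torus) \<le> ennreal C * (ennreal ((2 powr (- \<epsilon>)) ^ k) * I + (\<Sum>n\<in>block k. X_weight s b \<Gamma> n))" for k
  proof -
    interpret pair_sigma_finite torus "lborel :: real measure" ..
    define S where "S = (\<lambda>\<rho>. \<Sum>n\<in>block k. (cmod (shifted n \<rho>))\<^sup>2)"
    define w where "w = (\<lambda>n \<rho>. jbr (fvec n) powr (2 * s) * jbr \<rho> powr (2 * b) * (cmod (shifted n \<rho>))\<^sup>2)"
    have w0: "w n \<rho> \<ge> 0" for n \<rho> by (simp add: w_def)
    have [measurable]: "w n \<in> borel_measurable borel" for n unfolding w_def by measurable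
    have weight_eq: "X_weight s b \<Gamma> n = (\<integral>\<^sup>+\<rho>. ennreal (w n \<rho>) \<partial>lborel)" for n
      by (simp add: X_weight_shift w_def)
    have pt: "2 powr (real k * (1 / 2 + \<epsilon>)) * sqrt (S \<rho>) \<le> (2 powr (- \<epsilon>)) ^ k * jbr \<rho> powr (- (2 * b)) + (\<Sum>n\<in>block k. w n \<rho>)" for \<rho>
    proof -
      define X where "X = 2 powr (- (real k * \<epsilon> / 2)) * jbr \<rho> powr (- b)"
      define Y where "Y = 2 powr (real k * s) * jbr \<rho> powr b * sqrt (S \<rho>)"
      have S0: "S \<rho> \<ge> 0" by (simp add: S_def sum_nonneg)
      have "2 powr (- (real k * \<epsilon> / 2)) * 2 powr (real k * s) = (2::real) powr (real k * (1 / 2 + \<epsilon>))"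
        unfolding powr_add[symmetric] by (simp add: \<epsilon>_def field_simps)
      moreover have "jbr \<rho> powr (- b) * jbr \<rho> powr b = 1"
        using jbr_pos[of \<rho>] by (simp add: powr_add[symmetric])
      moreover have "X * Y = (2 powr (- (real k * \<epsilon> / 2)) * 2 powr (real k * s)) * (jbr \<rho> powr (- b) * jbr \<rho> powr b) * sqrt (S \<rho>)"
        unfolding X_def Y_def by (simp only: mult_ac)
      ultimately have XY: "X * Y = 2 powr (real k * (1 / 2 + \<epsilon>)) * sqrt (S \<rho>)" by simp
      have X2: "X\<^sup>2 = (2 powr (- \<epsilon>)) ^ k * jbr \<rho> powr (- (2 * b))"
      proof -
        have "(2 powr (- (real k * \<epsilon> / 2)))\<^sup>2 = ((2::real) powr (- \<epsilon>)) ^ k"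
          by (simp add: power2_eq_square powr_add[symmetric] powr_realpow[symmetric] powr_powr mult.commute)
        moreover have "(jbr \<rho> powr (- b))\<^sup>2 = jbr \<rho> powr (- (2 * b))"
          by (simp add: power2_eq_square powr_add[symmetric])
        ultimately show ?thesis unfolding X_def by (simp add: power_mult_distrib)
      qed
      have "Y\<^sup>2 = (2 powr real k) powr (2 * s) * jbr \<rho> powr (2 * b) * S \<rho>"
      proof -
        have "(2 powr (real k * s))\<^sup>2 = (2 powr real k) powr (2 * s)" "(jbr \<rho> powr b)\<^sup>2 = jbr \<rho> powr (2 * b)"
          by (simp_all add: power2_eq_square powr_add[symmetric] powr_powr mult_ac)
        then show ?thesis unfolding Y_def power_mult_distrib using S0 by simp
      qed
      also have "\<dots> = (\<Sum>n\<in>block k. (2 powr real k) powr (2 * s) * jbr \<rho> powr (2 * b) * (cmod (shifted n \<rho>))\<^sup>2)"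
        by (simp add: S_def sum_distrib_left)
      also have "\<dots> \<le> (\<Sum>n\<in>block k. w n \<rho>)"
        unfolding w_def
      proof (intro sum_mono mult_right_mono)
        fix n assume "n \<in> block k"
        then have "2 powr real k \<le> jbr (fvec n)"
          using jbr_fvec_ge[of n "2 ^ k"] by (simp add: block_def powr_realpow)
        then show "(2 powr real k) powr (2 * s) \<le> jbr (fvec n) powr (2 * s)" using s by (intro powr_mono2) auto
      qed auto
      finally show ?thesis using mult_le_sum_squares[of X Y] unfolding XY X2 by linarith
    qed
    let ?r = "\<lambda>\<rho>. ennreal C * (ennreal ((2 powr (- \<epsilon>)) ^ k) * ennreal (jbr \<rho> powr (- (2 * b))) + (\<Sum>n\<in>block k. ennreal (w n \<rho>)))"
    have "(\<integral>\<^sup>+x. curve_max k x \<partial>torus) = (\<integral>\<^sup>+\<rho>. \<integral>\<^sup>+x. ennreal (ring_max k (\<lambda>n. shifted n \<rho>) x) \<partial>torus \<partial>lborel)"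
      unfolding curve_max_def by (rule Fubini'[symmetric]) measurable
    also have "\<dots> \<le> (\<integral>\<^sup>+\<rho>. ?r \<rho> \<partial>lborel)"
    proof (rule nn_integral_mono)
      fix \<rho>
      have "(\<integral>\<^sup>+x. ennreal (ring_max k (\<lambda>n. shifted n \<rho>) x) \<partial>torus) \<le>
        ennreal (C * 2 powr (real k * (1 / 2 + \<epsilon>)) * sqrt (S \<rho>))" unfolding S_def by (rule C(2))
      also have "\<dots> \<le> ennreal (C * ((2 powr (- \<epsilon>)) ^ k * jbr \<rho> powr (- (2 * b)) + (\<Sum>n\<in>block k. w n \<rho>)))"
        using C(1) pt[of \<rho>] by (intro ennreal_leI) (simp add: mult.assoc)
      also have "\<dots> = ?r \<rho>"
        using C(1) w0 by (simp add: ennreal_mult sum_nonneg)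
      finally show "(\<integral>\<^sup>+x. ennreal (ring_max k (\<lambda>n. shifted n \<rho>) x) \<partial>torus) \<le>
        ?r \<rho>" .
    qed
    also have "\<dots> = ennreal C * (ennreal ((2 powr (- \<epsilon>)) ^ k) * I + (\<Sum>n\<in>block k. X_weight s b \<Gamma> n))"
      unfolding I_def weight_eq by (simp add: nn_integral_cmult nn_integral_add nn_integral_sum)
    finally show ?thesis .
  qed
  have "(\<integral>\<^sup>+x. (\<Sum>k. curve_max k x) \<partial>torus) = (\<Sum>k. \<integral>\<^sup>+x. curve_max k x \<partial>torus)"
    by (rule nn_integral_suminf) measurable
  also have "\<dots> \<le> (\<Sum>k. ennreal C * (ennreal ((2 powr (- \<epsilon>)) ^ k) * I + (\<Sum>n\<in>block k. X_weight s b \<Gamma> n)))"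
    by (intro suminf_le bound) auto
  also have "\<dots> = ennreal C * ((\<Sum>k. ennreal ((2 powr (- \<epsilon>)) ^ k)) * I + (\<Sum>k. \<Sum>n\<in>block k. X_weight s b \<Gamma> n))"
    by (simp add: suminf_add[symmetric])
  also have "\<dots> < \<infinity>"
  proof -
    have "(\<Sum>k. ennreal ((2 powr (- \<epsilon>)) ^ k)) < \<infinity>"
    proof -
      have "summable (\<lambda>k. ((2::real) powr (- \<epsilon>)) ^ k)"
        using \<epsilon> by (intro summable_geometric) (simp add: powr_less_one)
      then show ?thesis by (simp add: suminf_ennreal2)
    qed
    moreover have "(\<Sum>k. \<Sum>n\<in>block k. X_weight s b \<Gamma> n) < \<infinity>"
      using sum_block_le fin unfolding X_energy_def by (rule le_less_trans)
    ultimately show ?thesis using I by (simp add: ennreal_mult_less_top)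
  qed
  finally show ?thesis .
qed

text \<open>A sum of majorants with finite integral is finite almost everywhere. Since the majorants
  do not see the time, one exceptional set of x serves all t.\<close>

lemma AE_uniform_limit_curve:
  "AE x in torus. uniform_limit UNIV (\<lambda>N t. \<Sum>n\<in>sq N. curve n t * char n x) (\<lambda>t. fsum (\<lambda>n. curve n t) x) sequentially"
proof -
  have "AE x in torus. (\<Sum>k. curve_max k x) \<noteq> \<infinity>"
    using nn_integral_curve_max by (intro nn_integral_noteq_infinite) auto
  then show ?thesis
  proof eventually_elim
    case (elim x)
    have fin: "curve_max k x < \<infinity>" for k
      using elim by (metis ennreal_suminf_lessD infinity_ennreal_def less_top)
    have sm: "summable (\<lambda>k. enn2real (curve_max k x))"
      using elim fin by (intro summable_suminf_not_top) (auto simp: less_top)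
    show ?case unfolding fsum_sq
    proof (rule uniform_limit_dyadic[OF sm])
      fix k N :: nat and t :: real assume "2 ^ k \<le> N" "N \<le> 2 ^ Suc k"
      from partial_sum_le_curve_max[OF this, of t x] fin[of k]
      show "cmod ((\<Sum>n\<in>sq N. curve n t * char n x) - (\<Sum>n\<in>sq (2 ^ k). curve n t * char n x)) \<le> enn2real (curve_max k x)"
        by (subst (asm) ennreal_enn2real[symmetric, of "curve_max k x"]) (auto simp: less_top)
    qed
  qed
qed

end

section \<open>Gaussian random waves\<close>

text \<open>Completing the square moves the mean to a / 2; the variance 1/2 of each component
  accounts for a^2 / 4.\<close>

lemma nn_integral_exp_normal:
  assumes "prob_space M" and X: "distributed M lborel X (normal_density 0 (1 / sqrt 2))"
  shows "(\<integral>\<^sup>+\<omega>. ennreal (exp (a * X \<omega>)) \<partial>M) = ennreal (exp (a\<^sup>2 / 4))"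
proof -
  have "(\<integral>\<^sup>+\<omega>. ennreal (exp (a * X \<omega>)) \<partial>M) =
      (\<integral>\<^sup>+x. ennreal (normal_density 0 (1 / sqrt 2) x) * ennreal (exp (a * x)) \<partial>lborel)"
    by (rule distributed_nn_integral[OF X, symmetric]) simp
  also have "\<dots> = (\<integral>\<^sup>+x. ennreal (exp (a\<^sup>2 / 4)) * ennreal (normal_density (a / 2) (1 / sqrt 2) x) \<partial>lborel)"
  proof (intro nn_integral_cong)
    fix x :: real
    have "normal_density 0 (1 / sqrt 2) x * exp (a * x) = exp (a\<^sup>2 / 4) * normal_density (a / 2) (1 / sqrt 2) x"
      by (simp add: normal_density_def exp_add[symmetric] power_divide) (simp add: power2_eq_square field_simps)
    then show "ennreal (normal_density 0 (1 / sqrt 2) x) * ennreal (exp (a * x)) =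
      ennreal (exp (a\<^sup>2 / 4)) * ennreal (normal_density (a / 2) (1 / sqrt 2) x)"
      by (simp add: ennreal_mult[symmetric])
  qed
  also have "\<dots> = ennreal (exp (a\<^sup>2 / 4))"
    by (simp add: nn_integral_cmult nn_integral_eq_integral)
  finally show ?thesis .
qed

lemma complex_std_gaussian_measurable:
  assumes "complex_std_gaussian M X"
  shows "X \<in> borel_measurable M"
proof -
  have [measurable]: "(\<lambda>\<omega>. Re (X \<omega>)) \<in> borel_measurable M" "(\<lambda>\<omega>. Im (X \<omega>)) \<in> borel_measurable M"
    using assms unfolding complex_std_gaussian_def distributed_def by auto
  have "X = (\<lambda>\<omega>. of_real (Re (X \<omega>)) + \<i> * of_real (Im (X \<omega>)))"
    by (simp add: complex_eq[symmetric] fun_eq_iff)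
  moreover have "(\<lambda>\<omega>. of_real (Re (X \<omega>)) + \<i> * of_real (Im (X \<omega>))) \<in> borel_measurable M" by measurable
  ultimately show ?thesis by simp
qed

text \<open>The real part of z X combines the independent components of X with coefficients Re z and
  -Im z, so the two moments multiply to a function of |z| alone.\<close>

lemma (in prob_space) nn_integral_exp_complex_gaussian:
  assumes X: "complex_std_gaussian M X"
  shows "(\<integral>\<^sup>+\<omega>. ennreal (exp (Re (z * X \<omega>))) \<partial>M) = ennreal (exp ((cmod z)\<^sup>2 / 4))"
proof -
  let ?Y = "case_bool (\<lambda>\<omega>. Re (X \<omega>)) (\<lambda>\<omega>. Im (X \<omega>))"
  let ?c = "case_bool (Re z) (- Im z)"
  define W where "W = (\<lambda>i \<omega>. ennreal (exp (?c i * ?Y i \<omega>)))"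
  have "indep_var borel (\<lambda>\<omega>. Re (X \<omega>)) borel (\<lambda>\<omega>. Im (X \<omega>))"
    using X by (simp add: complex_std_gaussian_def)
  then have ind: "indep_vars (case_bool borel borel) ?Y UNIV" unfolding indep_var_def .
  have "indep_vars (\<lambda>_. borel) W UNIV"
    unfolding W_def by (rule indep_vars_compose2[OF ind]) (auto split: bool.split)
  then have "(\<integral>\<^sup>+\<omega>. (\<Prod>i\<in>UNIV. W i \<omega>) \<partial>M) = (\<Prod>i\<in>UNIV. \<integral>\<^sup>+\<omega>. W i \<omega> \<partial>M)"
    by (intro indep_vars_nn_integral) auto
  moreover have "(\<Prod>i\<in>UNIV. W i \<omega>) = ennreal (exp (Re (z * X \<omega>)))" for \<omega>
    by (simp add: UNIV_bool W_def ennreal_mult[symmetric] exp_add[symmetric])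
  moreover have "(\<integral>\<^sup>+\<omega>. W i \<omega> \<partial>M) = ennreal (exp ((?c i)\<^sup>2 / 4))" for i
    unfolding W_def using X nn_integral_exp_normal[OF prob_space_axioms, of "\<lambda>\<omega>. Re (X \<omega>)" "Re z"]
      nn_integral_exp_normal[OF prob_space_axioms, of "\<lambda>\<omega>. Im (X \<omega>)" "- Im z"]
    by (cases i) (simp_all add: complex_std_gaussian_def)
  ultimately show ?thesis
    by (simp add: UNIV_bool ennreal_mult[symmetric] exp_add[symmetric] cmod_power2 add_divide_distrib[symmetric] add.commute)
qed

text \<open>By independence the moments multiply. Only the moduli of the coefficients survive, so
  for plane waves the result is the same at all (t, x).\<close>

lemma (in prob_space) nn_integral_exp_gaussian_sum:
  assumes ind: "indep_vars (\<lambda>_. borel) g UNIV" and g: "\<And>n. complex_std_gaussian M (g n)" and A: "finite A"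
  shows "(\<integral>\<^sup>+\<omega>. ennreal (exp (Re (\<Sum>n\<in>A. z n * g n \<omega>))) \<partial>M) = ennreal (exp ((\<Sum>n\<in>A. (cmod (z n))\<^sup>2) / 4))"
proof -
  define W where "W = (\<lambda>n \<omega>. ennreal (exp (Re (z n * g n \<omega>))))"
  have "indep_vars (\<lambda>_. borel) g A" using ind by (rule indep_vars_subset) simp
  then have "indep_vars (\<lambda>_. borel) W A"
    unfolding W_def by (rule indep_vars_compose2) measurable
  then have "(\<integral>\<^sup>+\<omega>. (\<Prod>n\<in>A. W n \<omega>) \<partial>M) = (\<Prod>n\<in>A. \<integral>\<^sup>+\<omega>. W n \<omega> \<partial>M)"
    using A by (intro indep_vars_nn_integral) auto
  moreover have "(\<Prod>n\<in>A. W n \<omega>) = ennreal (exp (Re (\<Sum>n\<in>A. z n * g n \<omega>)))" for \<omega>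
    using A by (simp add: W_def prod_ennreal exp_sum Re_sum)
  moreover have "(\<integral>\<^sup>+\<omega>. W n \<omega> \<partial>M) = ennreal (exp ((cmod (z n))\<^sup>2 / 4))" for n
    unfolding W_def by (rule nn_integral_exp_complex_gaussian[OF g])
  ultimately show ?thesis
    using A by (simp add: prod_ennreal exp_sum sum_divide_distrib)
qed

section \<open>Discretisation of time and space\<close>

lemma cmod_cis_diff_le: "cmod (cis u - cis v) \<le> \<bar>u - v\<bar>"
proof -
  have "cis u - cis v = cis v * (cis (u - v) - 1)" by (simp add: right_diff_distrib cis_mult)
  then have "cmod (cis u - cis v) = cmod (cis (u - v) - 1)" by (simp add: norm_mult)
  also have "\<dots> \<le> \<bar>u - v\<bar>" using iexp_approx1[of "u - v" 0] by (simp add: cis_conv_exp)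
  finally show ?thesis .
qed

lemma norm_wave [simp]: "cmod (wave t x n) = 1"
  by (simp add: wave_def norm_mult)

lemma wave_Pair: "wave t (x, y) n = cis (of_int (fst n) * x + of_int (snd n) * y - t * of_int (nsq n))"
  by (simp add: wave_def norm_fvec char_Pair cis_mult)

text \<open>The time derivative, of size |n|^2 \<le> 2 N^2, is the dominant one; the two space
  derivatives are at most N \<le> N^2.\<close>

lemma wave_lipschitz:
  assumes n: "n \<in> sq N" and N: "N \<ge> 1"
    and t: "\<bar>t - t'\<bar> \<le> h" and x: "\<bar>x - x'\<bar> \<le> h" and y: "\<bar>y - y'\<bar> \<le> h"
  shows "cmod (wave t (x, y) n - wave t' (x', y') n) \<le> 4 * (real N)\<^sup>2 * h"
proof -
  have h: "h \<ge> 0" using t by linarith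
  have 1: "\<bar>real_of_int (fst n)\<bar> \<le> real N" "\<bar>real_of_int (snd n)\<bar> \<le> real N"
    using n by (auto simp: sq_def abs_le_iff)
  have 2: "\<bar>real_of_int (nsq n)\<bar> \<le> 2 * (real N)\<^sup>2"
  proof -
    have "real_of_int (nsq n) \<le> real_of_int (2 * (int N)\<^sup>2)" using nsq_sq[OF n] by (simp only: of_int_le_iff)
    then show ?thesis using nsq_nonneg[of n] by simp
  qed
  have "real N * 1 \<le> real N * real N" using N by (intro mult_left_mono) auto
  then have 3: "real N \<le> (real N)\<^sup>2" by (simp add: power2_eq_square)
  have "cmod (wave t (x, y) n - wave t' (x', y') n) \<le>
    \<bar>of_int (fst n) * x + of_int (snd n) * y - t * of_int (nsq n) - (of_int (fst n) * x' + of_int (snd n) * y' - t' * of_int (nsq n))\<bar>"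
    unfolding wave_Pair by (rule cmod_cis_diff_le)
  also have "\<dots> = \<bar>of_int (fst n) * (x - x') + of_int (snd n) * (y - y') - (t - t') * of_int (nsq n)\<bar>"
    by (simp add: algebra_simps)
  also have "\<dots> \<le> \<bar>of_int (fst n) * (x - x')\<bar> + \<bar>of_int (snd n) * (y - y')\<bar> + \<bar>(t - t') * of_int (nsq n)\<bar>"
    by linarith
  also have "\<dots> \<le> real N * h + real N * h + h * (2 * (real N)\<^sup>2)"
    unfolding abs_mult using 1 2 t x y h by (intro add_mono mult_mono) auto
  also have "\<dots> \<le> (real N)\<^sup>2 * h + (real N)\<^sup>2 * h + h * (2 * (real N)\<^sup>2)"
    using 3 h by (intro add_mono mult_right_mono order_refl)
  also have "\<dots> = 4 * (real N)\<^sup>2 * h" by simp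
  finally show ?thesis .
qed

text \<open>The bound 7 is an integer above 2 \<pi>, so that [0, 7] contains a full period; the same
  grid is used for times in [0, 1].\<close>

lemma grid_point:
  fixes L :: nat
  assumes "L > 0" "0 \<le> t" "t \<le> 7"
  obtains i where "i \<le> 7 * L" "\<bar>t - real i / real L\<bar> \<le> 1 / real L"
proof
  define i where "i = nat \<lfloor>t * L\<rfloor>"
  have i: "real i \<le> t * L" "t * L < real i + 1"
    using assms by (auto simp: i_def)
  have "t * L \<le> 7 * L" using mult_right_mono[of t 7 "real L"] assms by simp
  with i have "real i \<le> real (7 * L)" by simp
  then show "i \<le> 7 * L" by (simp only: of_nat_le_iff)
  have "t - real i / real L = (t * L - real i) / L" using assms by (simp add: field_simps)
  moreover have "\<bar>t * L - real i\<bar> \<le> 1" using i by linarith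
  ultimately show "\<bar>t - real i / real L\<bar> \<le> 1 / real L" using assms by (simp add: divide_right_mono)
qed

lemma summable_linear_geometric:
  fixes q :: real
  assumes "0 \<le> q" "q < 1"
  shows "summable (\<lambda>k. real k * q ^ k)"
proof -
  have "summable (\<lambda>k. of_nat (Suc k) * q ^ k)"
    using geometric_deriv_sums[of q] assms by (auto simp: sums_iff)
  then show ?thesis
    by (rule summable_comparison_test'[of _ 0]) (use assms in \<open>auto simp: mult_right_mono\<close>)
qed

lemma card_sq_dyadic: "real (card (sq (2 ^ Suc k))) \<le> 25 * 4 ^ k"
proof -
  have "real (2 * 2 ^ Suc k + 1) \<le> 5 * 2 ^ k" using one_le_power[of "2::real" k] by simp
  then have "(real (2 * 2 ^ Suc k + 1))\<^sup>2 \<le> (5 * 2 ^ k)\<^sup>2" by (intro power_mono) auto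
  also have "\<dots> = 25 * (2 ^ k * 2 ^ k)" by (simp add: power2_eq_square)
  also have "\<dots> = 25 * 4 ^ k" by (simp add: power_mult_distrib[symmetric])
  finally show ?thesis unfolding card_sq by (simp only: of_nat_power)
qed

text \<open>The union bound over the grid, over the initial segments of the block and over the four directions
  \<open>\<theta>\<close> is taken in exponential moments: \<open>E Y\<^sub>k\<close> is summable, so \<open>Y\<^sub>k\<close> is almost surely summable.\<close>

lemma (in prob_space) random_wave_blocks:
  fixes \<alpha> :: real
  assumes ind: "indep_vars (\<lambda>_. borel) g UNIV" and g: "\<And>n. complex_std_gaussian M (g n)" and \<alpha>: "\<alpha> > 0"
  defines "c \<equiv> (\<lambda>\<omega> n. g n \<omega> / of_real (jbr (fvec n) powr (1 + \<alpha>)))"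
  shows "AE \<omega> in M. \<exists>b. summable b \<and> (\<forall>k m t x y. 2 ^ k \<le> m \<longrightarrow> m \<le> 2 ^ Suc k \<longrightarrow>
    t \<in> {0..1} \<longrightarrow> x \<in> {0..7} \<longrightarrow> y \<in> {0..7} \<longrightarrow>
    cmod (\<Sum>n\<in>sq m - sq (2 ^ k). c \<omega> n * wave t (x, y) n) \<le> b k)"
proof -
  \<comment> \<open>The mesh 32^(-k) beats the Lipschitz constant 16 * 4^k of a wave and the number,
    about 4^k, of frequencies in the block, with 2^(-k) to spare.\<close>
  define L where "L = (\<lambda>k. 32 ^ k :: nat)"
  define \<Theta> where "\<Theta> = {1, -1, \<i>, -\<i>}"
  define grid where "grid = (\<lambda>k. {..7 * L k} \<times> {..7 * L k} \<times> {..7 * L k})"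
  define wv where "wv = (\<lambda>k (i, j, l). wave (real i / real (L k)) (real j / real (L k), real l / real (L k)))"
  define ix where "ix = (\<lambda>k. {2 ^ k..2 ^ Suc k :: nat} \<times> grid k \<times> \<Theta>)"
  \<comment> \<open>This scale undoes the decay: for frequencies outside \<open>sq (2 ^ k)\<close>
    the normalised coefficients \<open>z\<close> are at most 2^(-k) in modulus, and at most 25 * 4^k
    of them keep the sum of squares below 25.\<close>
  define \<mu> where "\<mu> = (\<lambda>k. 2 powr (real k * \<alpha>))"
  define z where "z = (\<lambda>k p \<theta> n. \<theta> * of_real (\<mu> k) * wv k p n / of_real (jbr (fvec n) powr (1 + \<alpha>)))"
  let ?S = "\<lambda>k m p \<theta> \<omega>. \<Sum>n\<in>sq m - sq (2 ^ k). z k p \<theta> n * g n \<omega>"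
  \<comment> \<open>There are about 2^(16k) indices, namely 2^k cutoffs times 32^(3k) grid points
    times four directions. The damping exp (-17 k) \<le> 2^(-17k) outweighs them and leaves a mean
    of order 2^(-k).\<close>
  define Y where "Y = (\<lambda>k \<omega>. \<Sum>(m, p, \<theta>)\<in>ix k. exp (Re (?S k m p \<theta> \<omega>)) * exp (- 17 * real k))"
  \<comment> \<open>Measures the error of passing to the grid: each coefficient of the block is
    multiplied by the oscillation 8^(-k) of a wave over one mesh cell.\<close>
  define Z where "Z = (\<lambda>k \<omega>. (1 / 8) ^ k * (\<Sum>n\<in>sq (2 ^ Suc k). \<Sum>\<theta>\<in>\<Theta>. exp (Re (\<theta> * g n \<omega>))))"
  have [measurable]: "g n \<in> borel_measurable M" for n using complex_std_gaussian_measurable[OF g] .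
  have [measurable]: "Y k \<in> borel_measurable M" for k unfolding Y_def case_prod_unfold by measurable
  have [measurable]: "Z k \<in> borel_measurable M" for k unfolding Z_def by measurable
  have \<Theta>: "finite \<Theta>" "card \<Theta> \<le> 4" "\<And>\<theta>. \<theta> \<in> \<Theta> \<Longrightarrow> cmod \<theta> = 1"
    unfolding \<Theta>_def using card_length[of "[1, -1, \<i>, -\<i>]"] by auto
  have sq4: "((2::real) ^ k)\<^sup>2 = 4 ^ k" for k
    by (simp add: power2_eq_square power_mult_distrib[symmetric])
  have fin: "finite (ix k)" for k using \<Theta>(1) by (simp add: ix_def grid_def)
  have card_ix: "real (card (ix k)) \<le> 4096 * 2 ^ (16 * k)" for k
  proof -
    have "real (card (grid k)) \<le> (8 * 32 ^ k) ^ 3"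
    proof -
      have "real (7 * L k + 1) \<le> 8 * 32 ^ k" using one_le_power[of "32::real" k] by (simp add: L_def)
      then have "real (7 * L k + 1) ^ 3 \<le> (8 * 32 ^ k) ^ 3" by (intro power_mono) auto
      moreover have "card (grid k) = (7 * L k + 1) ^ 3"
        by (simp add: grid_def card_cartesian_product power3_eq_cube)
      ultimately show ?thesis by (simp only: of_nat_power)
    qed
    moreover have "real (card {(2::nat) ^ k..2 ^ Suc k}) \<le> 2 * 2 ^ k" using one_le_power[of "2::real" k] by simp
    moreover have "real (card \<Theta>) \<le> 4" using \<Theta>(2) by simp
    ultimately have "real (card {(2::nat) ^ k..2 ^ Suc k}) * (real (card (grid k)) * real (card \<Theta>)) \<le> (2 * 2 ^ k) * ((8 * 32 ^ k) ^ 3 * 4)"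
      by (intro mult_mono) auto
    also have "\<dots> = 4096 * 2 ^ (16 * k)"
    proof -
      have "16 * k = k + (5 * k) * 3" by simp
      then have "(2::real) ^ (16 * k) = 2 ^ k * ((2 ^ 5) ^ k) ^ 3" by (simp only: power_add power_mult)
      then show ?thesis by (simp add: power_mult_distrib)
    qed
    finally show ?thesis unfolding ix_def card_cartesian_product of_nat_mult .
  qed
  have EY: "(\<integral>\<^sup>+\<omega>. ennreal (Y k \<omega>) \<partial>M) \<le> ennreal (4096 * exp (25 / 4) * (1 / 2) ^ k)" for k
  proof -
    have moment: "(\<integral>\<^sup>+\<omega>. ennreal (exp (Re (?S k m p \<theta> \<omega>)) * exp (- 17 * real k)) \<partial>M)
        \<le> ennreal (exp (25 / 4) * (1 / 2) ^ (17 * k))" if i: "(m, p, \<theta>) \<in> ix k" for m p \<theta>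
    proof -
      have m: "m \<le> 2 ^ Suc k" and \<theta>: "cmod \<theta> = 1"
        using i \<Theta>(3)[of \<theta>] by (simp_all add: ix_def)
      have zle: "(cmod (z k p \<theta> n))\<^sup>2 \<le> 1 / 4 ^ k" if n: "n \<notin> sq (2 ^ k)" for n
      proof -
        have wv1: "cmod (wv k p n) = 1" by (cases p) (simp add: wv_def)
        have "2 powr real k \<le> jbr (fvec n)" using jbr_fvec_ge[OF n] by (simp add: powr_realpow)
        then have "(2 powr real k) powr (1 + \<alpha>) \<le> jbr (fvec n) powr (1 + \<alpha>)" using \<alpha> by (intro powr_mono2) auto
        then have "cmod (z k p \<theta> n) \<le> \<mu> k / (2 powr real k) powr (1 + \<alpha>)"
          unfolding z_def using \<theta> wv1 jbr_pos[of "fvec n"]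
          by (auto simp: norm_mult norm_divide \<mu>_def intro!: divide_left_mono)
        also have "\<dots> = 1 / 2 ^ k"
          unfolding \<mu>_def powr_powr by (simp add: powr_diff[symmetric] distrib_left powr_minus powr_realpow field_simps)
        finally have "(cmod (z k p \<theta> n))\<^sup>2 \<le> (1 / 2 ^ k)\<^sup>2" by (intro power_mono) auto
        then show ?thesis by (simp add: power_divide sq4)
      qed
      have "(\<Sum>n\<in>sq m - sq (2 ^ k). (cmod (z k p \<theta> n))\<^sup>2) \<le> (\<Sum>n\<in>sq m - sq (2 ^ k). 1 / 4 ^ k)"
        by (intro sum_mono zle) auto
      also have "\<dots> = real (card (sq m - sq (2 ^ k))) / 4 ^ k" by simp
      also have "\<dots> \<le> 25 * 4 ^ k / 4 ^ k"
      proof (rule divide_right_mono)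
        have "card (sq m - sq (2 ^ k)) \<le> card (sq (2 ^ Suc k))"
          using sq_mono[OF m] by (intro card_mono) auto
        then show "real (card (sq m - sq (2 ^ k))) \<le> 25 * 4 ^ k"
          using card_sq_dyadic[of k] by linarith
      qed simp
      finally have V: "(\<Sum>n\<in>sq m - sq (2 ^ k). (cmod (z k p \<theta> n))\<^sup>2) \<le> 25" by simp
      have e: "exp (- 17 * real k) \<le> (1 / 2) ^ (17 * k)"
      proof -
        have "exp (- 17 * real k) = (1 / exp 1) ^ (17 * k)"
          by (simp add: power_one_over[symmetric] exp_of_nat_mult[symmetric] exp_minus divide_inverse power_inverse)
        also have "\<dots> \<le> (1 / 2) ^ (17 * k)"
          using exp_ge_add_one_self[of 1] by (intro power_mono) (auto simp: field_simps)
        finally show ?thesis .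
      qed
      have "(\<integral>\<^sup>+\<omega>. ennreal (exp (Re (?S k m p \<theta> \<omega>)) * exp (- 17 * real k)) \<partial>M) =
          (\<integral>\<^sup>+\<omega>. ennreal (exp (Re (?S k m p \<theta> \<omega>))) * ennreal (exp (- 17 * real k)) \<partial>M)"
        by (intro nn_integral_cong) (simp add: ennreal_mult)
      also have "\<dots> = ennreal (exp ((\<Sum>n\<in>sq m - sq (2 ^ k). (cmod (z k p \<theta> n))\<^sup>2) / 4)) * ennreal (exp (- 17 * real k))"
        by (subst nn_integral_multc) (simp, subst nn_integral_exp_gaussian_sum[OF ind g], simp_all)
      also have "\<dots> \<le> ennreal (exp (25 / 4)) * ennreal ((1 / 2) ^ (17 * k))"
        using V e by (intro mult_mono ennreal_leI) auto
      also have "\<dots> = ennreal (exp (25 / 4) * (1 / 2) ^ (17 * k))" by (rule ennreal_mult[symmetric]) auto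
      finally show ?thesis .
    qed
    have "(\<integral>\<^sup>+\<omega>. ennreal (Y k \<omega>) \<partial>M) = (\<Sum>i\<in>ix k. \<integral>\<^sup>+\<omega>. ennreal (case i of (m, p, \<theta>) \<Rightarrow> exp (Re (?S k m p \<theta> \<omega>)) * exp (- 17 * real k)) \<partial>M)"
    proof -
      have "ennreal (Y k \<omega>) = (\<Sum>i\<in>ix k. ennreal (case i of (m, p, \<theta>) \<Rightarrow> exp (Re (?S k m p \<theta> \<omega>)) * exp (- 17 * real k)))" for \<omega>
        unfolding Y_def by (rule sum_ennreal[symmetric]) (simp add: case_prod_unfold)
      then show ?thesis by (simp only:) (rule nn_integral_sum, simp add: case_prod_unfold)
    qed
    also have "\<dots> \<le> (\<Sum>i\<in>ix k. ennreal (exp (25 / 4) * (1 / 2) ^ (17 * k)))"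
      using moment by (intro sum_mono) auto
    also have "\<dots> = ennreal (real (card (ix k)) * (exp (25 / 4) * (1 / 2) ^ (17 * k)))"
      by (simp add: ennreal_mult ennreal_of_nat_eq_real_of_nat)
    also have "\<dots> \<le> ennreal (4096 * 2 ^ (16 * k) * (exp (25 / 4) * (1 / 2) ^ (17 * k)))"
      by (intro ennreal_leI mult_right_mono card_ix) auto
    also have "4096 * 2 ^ (16 * k) * (exp (25 / 4) * (1 / 2) ^ (17 * k)) = 4096 * exp (25 / 4) * (1 / 2 :: real) ^ k"
    proof -
      have "17 * k = 16 * k + k" by simp
      then have "(1 / 2 :: real) ^ (17 * k) = (1 / 2) ^ (16 * k) * (1 / 2) ^ k" by (simp only: power_add)
      moreover have "(2::real) ^ (16 * k) * (1 / 2) ^ (16 * k) = 1" by (simp add: power_mult_distrib[symmetric])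
      ultimately show ?thesis by simp
    qed
    finally show ?thesis .
  qed
  have EZ: "(\<integral>\<^sup>+\<omega>. ennreal (Z k \<omega>) \<partial>M) \<le> ennreal (100 * exp (1 / 4) * (1 / 2) ^ k)" for k
  proof -
    have "(\<integral>\<^sup>+\<omega>. ennreal (Z k \<omega>) \<partial>M) = ennreal ((1 / 8) ^ k) * (\<Sum>n\<in>sq (2 ^ Suc k). \<Sum>\<theta>\<in>\<Theta>. \<integral>\<^sup>+\<omega>. ennreal (exp (Re (\<theta> * g n \<omega>))) \<partial>M)"
    proof -
      have "ennreal (Z k \<omega>) = ennreal ((1 / 8) ^ k) * (\<Sum>n\<in>sq (2 ^ Suc k). \<Sum>\<theta>\<in>\<Theta>. ennreal (exp (Re (\<theta> * g n \<omega>))))" for \<omega>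
        unfolding Z_def by (subst ennreal_mult) (simp_all add: sum_nonneg)
      then show ?thesis by (simp add: nn_integral_cmult nn_integral_sum del: sum_ennreal times_complex.sel)
    qed
    also have "\<dots> = ennreal ((1 / 8) ^ k) * (\<Sum>n\<in>sq (2 ^ Suc k). \<Sum>\<theta>\<in>\<Theta>. ennreal (exp (1 / 4)))"
      by (intro arg_cong2[where f = "(*)"] refl sum.cong)
        (simp only: nn_integral_exp_complex_gaussian[OF g] \<Theta>(3) one_power2)
    also have "\<dots> = ennreal ((1 / 8) ^ k * (real (card (sq (2 ^ Suc k))) * (real (card \<Theta>) * exp (1 / 4))))"
      by (simp add: ennreal_mult ennreal_of_nat_eq_real_of_nat)
    also have "\<dots> \<le> ennreal ((1 / 8) ^ k * ((25 * 4 ^ k) * (4 * exp (1 / 4))))"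
      using card_sq_dyadic[of k] \<Theta>(2) by (intro ennreal_leI mult_left_mono mult_mono) auto
    also have "(1 / 8) ^ k * ((25 * 4 ^ k) * (4 * exp (1 / 4))) = 100 * exp (1 / 4) * (1 / 2 :: real) ^ k"
    proof -
      have "(1 / 8 :: real) ^ k * 4 ^ k = (1 / 2) ^ k" by (simp add: power_mult_distrib[symmetric])
      then show ?thesis by simp
    qed
    finally show ?thesis .
  qed
  \<comment> \<open>In place of Borel-Cantelli: nonnegative variables with summable means have an
    integrable sum, which is therefore almost surely finite.\<close>
  have AE_summable: "AE \<omega> in M. summable (\<lambda>k. X k \<omega>)"
    if [measurable]: "\<And>k. X k \<in> borel_measurable M" and X0: "\<And>k \<omega>. X k \<omega> \<ge> 0"
      and C0: "C \<ge> 0" and E: "\<And>k. (\<integral>\<^sup>+\<omega>. ennreal (X k \<omega>) \<partial>M) \<le> ennreal (C * (1 / 2) ^ k)" for X C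
  proof -
    have "(\<integral>\<^sup>+\<omega>. (\<Sum>k. ennreal (X k \<omega>)) \<partial>M) = (\<Sum>k. \<integral>\<^sup>+\<omega>. ennreal (X k \<omega>) \<partial>M)"
      by (rule nn_integral_suminf) measurable
    also have "\<dots> \<le> (\<Sum>k. ennreal (C * (1 / 2) ^ k))" by (intro suminf_le E) auto
    also have "\<dots> < \<infinity>"
    proof -
      have "summable (\<lambda>k. C * (1 / 2 :: real) ^ k)" by (intro summable_mult summable_geometric) simp
      then show ?thesis using C0 by (simp add: suminf_ennreal2)
    qed
    finally have "AE \<omega> in M. (\<Sum>k. ennreal (X k \<omega>)) \<noteq> \<infinity>"
      by (intro nn_integral_noteq_infinite) auto
    then show ?thesis
      by eventually_elim (use X0 in \<open>auto intro: summable_suminf_not_top\<close>)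
  qed
  have "AE \<omega> in M. summable (\<lambda>k. Y k \<omega>)"
    by (rule AE_summable[OF _ _ _ EY]) (auto simp: Y_def intro!: sum_nonneg)
  moreover have "AE \<omega> in M. summable (\<lambda>k. Z k \<omega>)"
  proof (rule AE_summable[OF _ _ _ EZ])
    show "Z k \<omega> \<ge> 0" for k \<omega>
      unfolding Z_def by (intro mult_nonneg_nonneg sum_nonneg) auto
  qed auto
  ultimately show ?thesis
  proof eventually_elim
    case (elim \<omega>)
    \<comment> \<open>The factor 2 adds the real and imaginary parts of the sum at a grid point;
      division by \<open>\<mu> k\<close> removes the normalisation; 16 is the Lipschitz factor left
      out of \<open>Z\<close>.\<close>
    define b where "b = (\<lambda>k. 2 * (17 * real k + Y k \<omega>) / \<mu> k + 16 * Z k \<omega>)"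
    have Y0: "Y k \<omega> \<ge> 0" for k by (auto simp: Y_def intro!: sum_nonneg)
    have "summable b"
    proof -
      have inv: "1 / \<mu> k = (2 powr (- \<alpha>)) ^ k" for k
      proof -
        have "(2 powr (- \<alpha>)) ^ k = (2::real) powr (- \<alpha> * real k)" by (simp add: powr_realpow[symmetric] powr_powr)
        moreover have "1 / \<mu> k = 2 powr (- (real k * \<alpha>))" unfolding \<mu>_def by (rule powr_minus_divide[symmetric])
        ultimately show ?thesis by (simp add: mult.commute)
      qed
      have q: "(2::real) powr (- \<alpha>) < 1" using \<alpha> by (simp add: powr_less_one)
      have "summable (\<lambda>k. real k * (2 powr (- \<alpha>)) ^ k)" using q by (intro summable_linear_geometric) auto
      moreover have "summable (\<lambda>k. Y k \<omega> * (2 powr (- \<alpha>)) ^ k)"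
        using elim(1) by (rule summable_comparison_test'[of _ 0]) (use Y0 q in \<open>auto intro!: mult_left_le power_le_one\<close>)
      ultimately have "summable (\<lambda>k. 34 * (real k * (2 powr (- \<alpha>)) ^ k) + 2 * (Y k \<omega> * (2 powr (- \<alpha>)) ^ k) + 16 * Z k \<omega>)"
        using elim(2) by (intro summable_add summable_mult)
      moreover have "b k = 34 * (real k * (2 powr (- \<alpha>)) ^ k) + 2 * (Y k \<omega> * (2 powr (- \<alpha>)) ^ k) + 16 * Z k \<omega>" for k
        unfolding b_def inv[symmetric] by (simp add: add_divide_distrib algebra_simps)
      ultimately show ?thesis by presburger
    qed
    moreover have "cmod (\<Sum>n\<in>sq m - sq (2 ^ k). c \<omega> n * wave t (x, y) n) \<le> b k"
      if m: "2 ^ k \<le> m" "m \<le> 2 ^ Suc k" and t: "t \<in> {0..1}" and x: "x \<in> {0..7}" and y: "y \<in> {0..7}" for k m t x y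
    proof -
      have L0: "L k > 0" by (simp add: L_def)
      obtain i where i: "i \<le> 7 * L k" "\<bar>t - real i / real (L k)\<bar> \<le> 1 / real (L k)"
        using grid_point[OF L0, of t] t by auto
      obtain j where j: "j \<le> 7 * L k" "\<bar>x - real j / real (L k)\<bar> \<le> 1 / real (L k)"
        using grid_point[OF L0, of x] x by auto
      obtain l where l: "l \<le> 7 * L k" "\<bar>y - real l / real (L k)\<bar> \<le> 1 / real (L k)"
        using grid_point[OF L0, of y] y by auto
      define p where "p = (i, j, l)"
      define A where "A = sq m - sq (2 ^ k)"
      have finA: "finite A" and A: "A \<subseteq> sq (2 ^ Suc k)" using sq_mono[OF m(2)] by (auto simp: A_def)
      define S where "S = (\<Sum>n\<in>A. c \<omega> n * wv k p n)"
      \<comment> \<open>The summand of \<open>Y k\<close> for this index is exp v with v =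
        \<open>\<mu> k * Re (\<theta> * S) - 17 * real k\<close>, and v \<le> exp v makes the bound
        linear.\<close>
      have dir: "\<mu> k * Re (\<theta> * S) \<le> 17 * real k + Y k \<omega>" if \<theta>: "\<theta> \<in> \<Theta>" for \<theta>
      proof -
        have S: "(\<Sum>n\<in>A. z k p \<theta> n * g n \<omega>) = of_real (\<mu> k) * (\<theta> * S)"
          unfolding S_def sum_distrib_left by (intro sum.cong) (auto simp: z_def c_def)
        have mem: "(m, p, \<theta>) \<in> ix k" using m i j l \<theta> by (auto simp: ix_def grid_def p_def)
        let ?f = "\<lambda>(m, p, \<theta>). exp (Re (?S k m p \<theta> \<omega>)) * exp (- 17 * real k)"
        have "?f (m, p, \<theta>) \<le> Y k \<omega>"
          unfolding Y_def by (rule member_le_sum[OF mem]) (auto simp: fin)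
        then have "exp (\<mu> k * Re (\<theta> * S) - 17 * real k) \<le> Y k \<omega>"
          unfolding A_def[symmetric] prod.case S by (simp add: exp_diff exp_minus divide_inverse)
        moreover have "\<mu> k * Re (\<theta> * S) - 17 * real k \<le> exp (\<mu> k * Re (\<theta> * S) - 17 * real k)"
          using exp_ge_add_one_self[of "\<mu> k * Re (\<theta> * S) - 17 * real k"] by linarith
        ultimately show ?thesis by linarith
      qed
      have \<mu>0: "\<mu> k > 0" by (simp add: \<mu>_def)
      have "\<mu> k * Re S \<le> 17 * real k + Y k \<omega>" "- (\<mu> k * Re S) \<le> 17 * real k + Y k \<omega>"
        "\<mu> k * Im S \<le> 17 * real k + Y k \<omega>" "- (\<mu> k * Im S) \<le> 17 * real k + Y k \<omega>"
        using dir[of 1] dir[of "-1"] dir[of "-\<i>"] dir[of "\<i>"] by (auto simp: \<Theta>_def)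
      then have "\<mu> k * \<bar>Re S\<bar> + \<mu> k * \<bar>Im S\<bar> \<le> 2 * (17 * real k + Y k \<omega>)"
        using \<mu>0 by (auto simp: abs_if)
      moreover have "\<mu> k * cmod S \<le> \<mu> k * \<bar>Re S\<bar> + \<mu> k * \<bar>Im S\<bar>"
        unfolding distrib_left[symmetric] using \<mu>0 cmod_le by (intro mult_left_mono) auto
      ultimately have S: "cmod S \<le> 2 * (17 * real k + Y k \<omega>) / \<mu> k"
        using \<mu>0 by (simp add: pos_le_divide_eq mult.commute)
      \<comment> \<open>Single coefficients are also dominated by exponentials in the four
        directions, so the grid error is governed by the same kind of moments.\<close>
      have gle: "cmod (c \<omega> n) \<le> (\<Sum>\<theta>\<in>\<Theta>. exp (Re (\<theta> * g n \<omega>)))" for n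
      proof -
        have "1 \<le> jbr (fvec n) powr (1 + \<alpha>)" using jbr_ge_1 \<alpha> by (intro ge_one_powr_ge_zero) auto
        then have "cmod (c \<omega> n) \<le> cmod (g n \<omega>)"
          unfolding c_def using mult_left_mono[of 1 "jbr (fvec n) powr (1 + \<alpha>)" "cmod (g n \<omega>)"]
          by (simp add: norm_divide divide_le_eq)
        also have "\<dots> \<le> \<bar>Re (g n \<omega>)\<bar> + \<bar>Im (g n \<omega>)\<bar>" by (rule cmod_le)
        also have "\<dots> \<le> exp (Re (g n \<omega>)) + exp (- Re (g n \<omega>)) + exp (Im (g n \<omega>)) + exp (- Im (g n \<omega>))"
        proof -
          have "\<bar>u\<bar> \<le> exp u + exp (- u)" for u :: real
            using exp_ge_add_one_self[of u] exp_ge_add_one_self[of "-u"] exp_gt_zero[of u] exp_gt_zero[of "-u"] by linarith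
          from this[of "Re (g n \<omega>)"] this[of "Im (g n \<omega>)"] show ?thesis by linarith
        qed
        also have "\<dots> = (\<Sum>\<theta>\<in>\<Theta>. exp (Re (\<theta> * g n \<omega>)))"
        proof -
          have "(1::complex) \<noteq> -1" "(1::complex) \<noteq> \<i>" "(1::complex) \<noteq> -\<i>" "(-1::complex) \<noteq> \<i>" "(-1::complex) \<noteq> -\<i>" "\<i> \<noteq> -\<i>"
            by (auto simp: complex_eq_iff)
          then show ?thesis unfolding \<Theta>_def by simp
        qed
        finally show ?thesis .
      qed
      have "cmod ((\<Sum>n\<in>A. c \<omega> n * wave t (x, y) n) - S) \<le> (\<Sum>n\<in>A. cmod (c \<omega> n * (wave t (x, y) n - wv k p n)))"
        unfolding S_def sum_subtractf[symmetric] right_diff_distrib[symmetric] by (rule norm_sum)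
      also have "\<dots> \<le> (\<Sum>n\<in>A. (\<Sum>\<theta>\<in>\<Theta>. exp (Re (\<theta> * g n \<omega>))) * (16 * (1 / 8) ^ k))"
        unfolding norm_mult
      proof (intro sum_mono mult_mono gle)
        fix n assume "n \<in> A"
        then have "cmod (wave t (x, y) n - wv k p n) \<le> 4 * (real (2 ^ Suc k))\<^sup>2 * (1 / real (L k))"
          unfolding wv_def p_def prod.case using A i j l by (intro wave_lipschitz) auto
        also have "\<dots> = 16 * (4 ^ k / 32 ^ k)"
          by (simp add: L_def power_mult_distrib sq4)
        also have "(4::real) ^ k / 32 ^ k = (1 / 8) ^ k" by (simp add: power_divide[symmetric])
        finally show "cmod (wave t (x, y) n - wv k p n) \<le> 16 * (1 / 8) ^ k" .
      qed (auto intro!: sum_nonneg)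
      also have "\<dots> \<le> (\<Sum>n\<in>sq (2 ^ Suc k). (\<Sum>\<theta>\<in>\<Theta>. exp (Re (\<theta> * g n \<omega>))) * (16 * (1 / 8) ^ k))"
        using A by (intro sum_mono2) (auto intro!: mult_nonneg_nonneg sum_nonneg)
      also have "\<dots> = 16 * Z k \<omega>" by (simp add: Z_def sum_distrib_right[symmetric])
      finally have "cmod ((\<Sum>n\<in>A. c \<omega> n * wave t (x, y) n) - S) \<le> 16 * Z k \<omega>" .
      then show ?thesis
        using S norm_triangle_ineq[of "(\<Sum>n\<in>A. c \<omega> n * wave t (x, y) n) - S" S] unfolding b_def A_def by simp
    qed
    ultimately show ?case by blast
  qed
qed

section \<open>Convergence of the solution\<close>

lemma AE_torus_cell: "AE x in torus. x \<in> cell"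
  unfolding torus_def by (rule AE_uniform_measureI) auto

section \<open>The free evolution of the random datum\<close>

context
  fixes c :: "freq \<Rightarrow> complex" and b :: "nat \<Rightarrow> real"
  assumes b: "summable b"
    and blocks: "\<And>k m t x y. 2 ^ k \<le> m \<Longrightarrow> m \<le> 2 ^ Suc k \<Longrightarrow> t \<in> {0..1} \<Longrightarrow> x \<in> {0..7} \<Longrightarrow> y \<in> {0..7} \<Longrightarrow>
      cmod (\<Sum>n\<in>sq m - sq (2 ^ k). c n * wave t (x, y) n) \<le> b k"
begin

lemma uniform_limit_wave:
  "uniform_limit ({0..1} \<times> cell) (\<lambda>N (t, x). \<Sum>n\<in>sq N. c n * wave t x n)
    (\<lambda>(t, x). lim (\<lambda>N. \<Sum>n\<in>sq N. c n * wave t x n)) sequentially"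
proof -
  have pi7: "2 * pi \<le> 7" using pi_approx(2) by simp
  have "uniform_limit ({0..1} \<times> cell) (\<lambda>N p. \<Sum>n\<in>sq N. c n * wave (fst p) (snd p) n)
    (\<lambda>p. lim (\<lambda>N. \<Sum>n\<in>sq N. c n * wave (fst p) (snd p) n)) sequentially"
  proof (rule uniform_limit_dyadic[OF b])
    fix k N :: nat and p :: "real \<times> point"
    assume p: "p \<in> {0..1} \<times> cell" and N: "2 ^ k \<le> N" "N \<le> 2 ^ Suc k"
    obtain t x y where txy: "p = (t, x, y)" by (cases p) auto
    show "cmod ((\<Sum>n\<in>sq N. c n * wave (fst p) (snd p) n) - (\<Sum>n\<in>sq (2 ^ k). c n * wave (fst p) (snd p) n)) \<le> b k"
      unfolding sum_sq_diff[OF N(1)] txy fst_conv snd_conv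
      using p pi7 by (intro blocks[OF N]) (auto simp: txy)
  qed
  then show ?thesis by (simp add: case_prod_unfold)
qed

lemma wave_0: "wave 0 x n = char n x"
  by (simp add: wave_def)

text \<open>The flow is defined through the Fourier coefficients of the function, so these must be
  recognised as \<open>c\<close>. Uniform convergence on the cell, which has full measure, allows
  the limit under the integral.\<close>

lemma fcoeff_fsum: "fcoeff (fsum c) m = c m"
proof -
  define P where "P = (\<lambda>N x. \<Sum>n\<in>sq N. c n * char n x)"
  have fs: "fsum c x = lim (\<lambda>N. P N x)" for x by (simp add: fsum_sq P_def)
  have [measurable]: "P N \<in> borel_measurable borel" for N unfolding P_def by measurable
  have [measurable]: "fsum c \<in> borel_measurable borel" unfolding fs by measurable
  have ul: "\<forall>\<^sub>F N in sequentially. \<forall>x\<in>cell. cmod (P N x - fsum c x) < e" if "e > 0" for e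
  proof -
    have "\<forall>\<^sub>F N in sequentially. \<forall>p\<in>{0..1} \<times> cell. dist (case p of (t, x) \<Rightarrow> \<Sum>n\<in>sq N. c n * wave t x n)
        (case p of (t, x) \<Rightarrow> lim (\<lambda>N. \<Sum>n\<in>sq N. c n * wave t x n)) < e"
      using uniform_limitD[OF uniform_limit_wave that] .
    then show ?thesis
    proof eventually_elim
      case (elim N)
      show ?case
      proof
        fix x assume "x \<in> cell"
        then have "(0::real, x) \<in> {0..1} \<times> cell" by simp
        from bspec[OF elim this] show "cmod (P N x - fsum c x) < e"
          by (simp add: dist_norm P_def fs wave_0)
      qed
    qed
  qed
  have Pbd: "cmod (P N x) \<le> (\<Sum>n\<in>sq N. cmod (c n))" for N x
    unfolding P_def by (rule order_trans[OF norm_sum]) (simp add: norm_mult)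
  have intP: "integrable torus (\<lambda>x. P N x * cnj (char m x))" for N
    by (rule torus.integrable_const_bound[of _ "\<Sum>n\<in>sq N. cmod (c n)"]) (auto simp: norm_mult Pbd)
  obtain N1 where N1: "\<And>x. x \<in> cell \<Longrightarrow> cmod (P N1 x - fsum c x) < 1"
    using ul[of 1] by (auto simp: eventually_sequentially)
  have intf: "integrable torus (\<lambda>x. fsum c x * cnj (char m x))"
  proof (rule torus.integrable_const_bound[of _ "(\<Sum>n\<in>sq N1. cmod (c n)) + 1"])
    show "AE x in torus. cmod (fsum c x * cnj (char m x)) \<le> (\<Sum>n\<in>sq N1. cmod (c n)) + 1"
      using AE_torus_cell
    proof eventually_elim
      case (elim x)
      have "cmod (fsum c x) \<le> cmod (P N1 x) + cmod (P N1 x - fsum c x)"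
        using norm_triangle_ineq4[of "P N1 x" "P N1 x - fsum c x"] by simp
      then show ?case using N1[OF elim] Pbd[of N1 x] by (simp add: norm_mult)
    qed
  qed simp
  have "(\<lambda>N. fcoeff (P N) m) \<longlonglongrightarrow> fcoeff (fsum c) m"
  proof (rule LIMSEQ_I)
    fix e :: real assume e: "e > 0"
    then obtain N0 where N0: "\<And>N x. N \<ge> N0 \<Longrightarrow> x \<in> cell \<Longrightarrow> cmod (P N x - fsum c x) < e / 2"
      using ul[of "e / 2"] by (auto simp: eventually_sequentially)
    have "cmod (fcoeff (P N) m - fcoeff (fsum c) m) < e" if N: "N \<ge> N0" for N
    proof -
      have "fcoeff (P N) m - fcoeff (fsum c) m = (LINT x|torus. P N x * cnj (char m x) - fsum c x * cnj (char m x))"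
        unfolding fcoeff_def by (rule Bochner_Integration.integral_diff[symmetric, OF intP intf])
      also have "cmod \<dots> \<le> (LINT x|torus. cmod (P N x * cnj (char m x) - fsum c x * cnj (char m x)))"
        by (rule integral_norm_bound)
      also have "\<dots> \<le> (LINT x|torus. e / 2)"
      proof (rule integral_mono_AE)
        show "AE x in torus. cmod (P N x * cnj (char m x) - fsum c x * cnj (char m x)) \<le> e / 2"
          using AE_torus_cell
        proof eventually_elim
          case (elim x)
          then show ?case using N0[OF N elim] by (simp add: left_diff_distrib[symmetric] norm_mult)
        qed
      qed (use intP intf in auto)
      also have "\<dots> < e" using e by (simp add: torus.prob_space[simplified])
      finally show ?thesis .
    qed
    then show "\<exists>N0. \<forall>N\<ge>N0. cmod (fcoeff (P N) m - fcoeff (fsum c) m) < e" by blast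
  qed
  moreover have "(\<lambda>N. fcoeff (P N) m) \<longlonglongrightarrow> c m"
  proof (rule tendsto_eventually)
    define k where "k = nat (max \<bar>fst m\<bar> \<bar>snd m\<bar>)"
    have "m \<in> sq N" if "N \<ge> k" for N
    proof -
      have "m \<in> sq k" by (cases m) (auto simp: sq_def k_def)
      then show ?thesis using sq_mono[OF that] by blast
    qed
    then show "\<forall>\<^sub>F N in sequentially. fcoeff (P N) m = c m"
      unfolding eventually_sequentially P_def by (intro exI[of _ k]) (simp add: fcoeff_sum)
  qed
  ultimately show ?thesis by (rule LIMSEQ_unique)
qed

lemma schroedinger_fsum: "schroedinger t (fsum c) x = lim (\<lambda>N. \<Sum>n\<in>sq N. c n * wave t x n)"
  unfolding schroedinger_def fcoeff_fsum fsum_sq by (simp add: wave_def mult_ac)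

text \<open>A uniform limit in \<open>t\<close> of continuous functions is continuous. The bounds
  hold at every point of the cell, so no exceptional set of x arises here.\<close>

lemma schroedinger_tendsto:
  assumes x: "x \<in> cell"
  shows "((\<lambda>t. schroedinger t (fsum c) x) \<longlongrightarrow> fsum c x) (at_right 0)"
proof -
  have "uniform_limit {0..1} (\<lambda>N t. \<Sum>n\<in>sq N. c n * wave t x n) (\<lambda>t. schroedinger t (fsum c) x) sequentially"
  proof (rule uniform_limitI)
    fix e :: real assume "e > 0"
    from uniform_limitD[OF uniform_limit_wave this]
    show "\<forall>\<^sub>F N in sequentially. \<forall>t\<in>{0..1}. dist (\<Sum>n\<in>sq N. c n * wave t x n) (schroedinger t (fsum c) x) < e"
    proof eventually_elim
      case (elim N)
      show ?case
      proof
        fix t :: real assume "t \<in> {0..1}"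
        then have "(t, x) \<in> {0..1} \<times> cell" using x by simp
        from bspec[OF elim this] show "dist (\<Sum>n\<in>sq N. c n * wave t x n) (schroedinger t (fsum c) x) < e"
          by (simp add: schroedinger_fsum)
      qed
    qed
  qed
  then have "continuous_on {0..1} (\<lambda>t. schroedinger t (fsum c) x)"
    by (rule uniform_limit_theorem[rotated]) (auto simp: wave_def intro!: always_eventually continuous_intros)
  then have "((\<lambda>t. schroedinger t (fsum c) x) \<longlongrightarrow> schroedinger 0 (fsum c) x) (at 0 within {0..1})"
    by (simp add: continuous_on_def)
  then have "((\<lambda>t. schroedinger t (fsum c) x) \<longlongrightarrow> schroedinger 0 (fsum c) x) (at_right 0)"
    by (simp add: at_within_Icc_at_right)
  moreover have "schroedinger 0 (fsum c) x = fsum c x"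
    by (simp add: schroedinger_fsum wave_0 fsum_sq)
  ultimately show ?thesis by simp
qed

end

section \<open>Integrals in time and bounds for the nonlinearity\<close>

lemma continuous_on_LINT_Icc:
  fixes k :: "real \<Rightarrow> 'a :: euclidean_space"
  assumes "set_integrable lborel {0..\<delta>} k"
  shows "continuous_on {0..\<delta>} (\<lambda>t. LINT r:{0..t}|lborel. k r)"
proof -
  have "continuous_on {0..\<delta>} (\<lambda>t. integral {0..t} k)"
    using set_borel_integral_eq_integral(1)[OF assms] by (rule indefinite_integral_continuous_1)
  then show ?thesis
  proof (rule continuous_on_cong[THEN iffD1, rotated -1])
    fix t assume "t \<in> {0..\<delta>}"
    then have "set_integrable lborel {0..t} k" by (intro set_integrable_subset[OF assms]) auto
    then show "integral {0..t} k = (LINT r:{0..t}|lborel. k r)"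
      by (simp add: set_borel_integral_eq_integral(2))
  qed simp
qed

text \<open>A function that is not integrable has Bochner integral 0 by convention, which satisfies
  the bound trivially; later estimates thus need no prior check of integrability.\<close>

lemma norm_LINT_le_nn_integral:
  fixes F :: "'a \<Rightarrow> complex"
  shows "ennreal (cmod (LINT x|M. F x)) \<le> (\<integral>\<^sup>+x. ennreal (cmod (F x)) \<partial>M)"
proof (cases "integrable M F")
  case True
  then show ?thesis by (rule integral_norm_bound_ennreal)
qed (simp add: not_integrable_integral_eq)

lemma norm_fcoeff_le: "ennreal (cmod (fcoeff F n)) \<le> (\<integral>\<^sup>+x. ennreal (cmod (F x)) \<partial>torus)"
  unfolding fcoeff_def using norm_LINT_le_nn_integral[of torus "\<lambda>x. F x * cnj (char n x)"] by (simp add: norm_mult)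

text \<open>Both terms of the nonlinearity are reduced to the fifth power. For the mean-value term,
  u v^4 \<le> u^5 + v^5 with u at x and v at y gives twice the integral after integration in both
  points, whence 7 = 1 + 3 * 2.\<close>

lemma norm_fcoeff_quintic_le:
  assumes [measurable]: "w \<in> borel_measurable borel"
  shows "ennreal (cmod (fcoeff (quintic w) n)) \<le> 7 * (\<integral>\<^sup>+x. ennreal (cmod (w x) ^ 5) \<partial>torus)"
proof -
  define B where "B = (LINT y|torus. cmod (w y) ^ 4)"
  have B0: "B \<ge> 0" by (simp add: B_def)
  have B: "ennreal B \<le> (\<integral>\<^sup>+y. ennreal (cmod (w y) ^ 4) \<partial>torus)"
  proof (cases "integrable torus (\<lambda>y. cmod (w y) ^ 4)")
    case True
    then show ?thesis by (simp add: B_def nn_integral_eq_integral)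
  qed (simp add: B_def not_integrable_integral_eq)
  let ?I = "\<integral>\<^sup>+x. ennreal (cmod (w x) ^ 5) \<partial>torus"
  have young: "u * v ^ 4 \<le> u ^ 5 + v ^ 5" if "u \<ge> 0" "v \<ge> 0" for u v :: real
  proof (cases "u \<le> v")
    case True
    then have "u * v ^ 4 \<le> v * v ^ 4" using that by (intro mult_right_mono) auto
    then show ?thesis using that by (simp add: eval_nat_numeral add_increasing)
  next
    case False
    then have "u * v ^ 4 \<le> u * u ^ 4" using that by (intro mult_left_mono power_mono) auto
    then show ?thesis using that by (simp add: eval_nat_numeral add_increasing2)
  qed
  have wB: "(\<integral>\<^sup>+x. ennreal (cmod (w x)) * ennreal B \<partial>torus) \<le> 2 * ?I"
  proof -
    have "(\<integral>\<^sup>+x. ennreal (cmod (w x)) * ennreal B \<partial>torus) \<le>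
        (\<integral>\<^sup>+x. ennreal (cmod (w x)) * (\<integral>\<^sup>+y. ennreal (cmod (w y) ^ 4) \<partial>torus) \<partial>torus)"
      by (intro nn_integral_mono mult_left_mono B) auto
    also have "\<dots> = (\<integral>\<^sup>+x. \<integral>\<^sup>+y. ennreal (cmod (w x)) * ennreal (cmod (w y) ^ 4) \<partial>torus \<partial>torus)"
      by (simp add: nn_integral_cmult)
    also have "\<dots> \<le> (\<integral>\<^sup>+x. \<integral>\<^sup>+y. ennreal (cmod (w x) ^ 5) + ennreal (cmod (w y) ^ 5) \<partial>torus \<partial>torus)"
      by (intro nn_integral_mono) (simp add: ennreal_mult[symmetric] ennreal_plus[symmetric] young del: ennreal_plus)
    also have "\<dots> = 2 * ?I"
      by (simp add: nn_integral_add torus.emeasure_space_1[simplified] mult_2)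
    finally show ?thesis .
  qed
  have "ennreal (cmod (fcoeff (quintic w) n)) \<le> (\<integral>\<^sup>+x. ennreal (cmod (quintic w x)) \<partial>torus)"
    by (rule norm_fcoeff_le)
  also have "\<dots> \<le> (\<integral>\<^sup>+x. ennreal (cmod (w x) ^ 5) + 3 * (ennreal (cmod (w x)) * ennreal B) \<partial>torus)"
  proof (rule nn_integral_mono)
    fix x
    have "cmod (quintic w x) \<le> cmod (of_real (cmod (w x) ^ 4) * w x) + cmod (3 * w x * of_real B)"
      unfolding quintic_def B_def by (rule norm_triangle_ineq4)
    also have "\<dots> = cmod (w x) ^ 5 + 3 * (cmod (w x) * B)"
      using B0 by (simp add: norm_mult norm_power eval_nat_numeral)
    finally have "ennreal (cmod (quintic w x)) \<le> ennreal (cmod (w x) ^ 5 + 3 * (cmod (w x) * B))"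
      by (rule ennreal_leI)
    also have "\<dots> = ennreal (cmod (w x) ^ 5) + 3 * (ennreal (cmod (w x)) * ennreal B)"
      using B0 by (simp add: ennreal_mult)
    finally show "ennreal (cmod (quintic w x)) \<le> ennreal (cmod (w x) ^ 5) + 3 * (ennreal (cmod (w x)) * ennreal B)" .
  qed
  also have "\<dots> = ?I + 3 * (\<integral>\<^sup>+x. ennreal (cmod (w x)) * ennreal B \<partial>torus)"
    by (subst nn_integral_add) (auto simp: nn_integral_cmult)
  also have "\<dots> \<le> ?I + 3 * (2 * ?I)"
    by (intro add_left_mono mult_left_mono wB) auto
  also have "\<dots> = 7 * ?I"
    by (simp add: distrib_right[of 1 6 ?I, simplified, symmetric] mult.assoc[symmetric])
  finally show ?thesis .
qed

lemma schroedinger_measurable [measurable]: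
  "(\<lambda>(t, x). schroedinger t f x) \<in> borel_measurable (borel \<Otimes>\<^sub>M borel)"
proof -
  have "(\<lambda>p. lim (\<lambda>N. \<Sum>n\<in>sq N. cis (- (fst p * (norm (fvec n))\<^sup>2)) * fcoeff f n * char n (snd p)))
      \<in> borel_measurable (borel \<Otimes>\<^sub>M borel)"
    by measurable
  then show ?thesis by (simp add: schroedinger_def fsum_sq case_prod_unfold)
qed

text \<open>On a probability space a coefficient is at most the L^2 norm in x, so square
  integrability in (t, x) passes to the coefficients as functions of t.\<close>

lemma fourier_coefficients_of_spacetime:
  assumes F: "spacetime_fourier G \<Gamma>"
  shows "(\<lambda>t. fcoeff (G t) n) \<in> borel_measurable lborel" (is ?meas)
    and "integrable lborel (\<lambda>t. (cmod (fcoeff (G t) n))\<^sup>2)" (is ?int)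
proof -
  have [measurable]: "(\<lambda>(t, x). G t x) \<in> borel_measurable (lborel \<Otimes>\<^sub>M torus)"
    and G2: "integrable (lborel \<Otimes>\<^sub>M torus) (\<lambda>(t, x). (cmod (G t x))\<^sup>2)"
    using F by (auto simp: spacetime_fourier_def)
  have [measurable]: "G t \<in> borel_measurable torus" for t
    using measurable_compose[OF measurable_Pair1' \<open>(\<lambda>(t, x). G t x) \<in> _\<close>, of t] by simp
  show meas [measurable]: ?meas unfolding fcoeff_def by measurable
  have "(\<integral>\<^sup>+t. ennreal ((cmod (fcoeff (G t) n))\<^sup>2) \<partial>lborel) \<le> (\<integral>\<^sup>+t. \<integral>\<^sup>+x. ennreal ((cmod (G t x))\<^sup>2) \<partial>torus \<partial>lborel)"
  proof (rule nn_integral_mono)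
    fix t
    have "(ennreal (cmod (fcoeff (G t) n)))\<^sup>2 \<le> (\<integral>\<^sup>+x. ennreal (cmod (G t x)) * 1 \<partial>torus)\<^sup>2"
      using norm_fcoeff_le[of "G t" n] by (intro power_mono) auto
    also have "\<dots> \<le> (\<integral>\<^sup>+x. (ennreal (cmod (G t x)))\<^sup>2 \<partial>torus) * (\<integral>\<^sup>+x. 1\<^sup>2 \<partial>torus)"
      by (rule Cauchy_Schwarz_nn_integral) auto
    also have "\<dots> = (\<integral>\<^sup>+x. ennreal ((cmod (G t x))\<^sup>2) \<partial>torus)"
      by (simp add: ennreal_power torus.emeasure_space_1[simplified])
    finally show "ennreal ((cmod (fcoeff (G t) n))\<^sup>2) \<le> (\<integral>\<^sup>+x. ennreal ((cmod (G t x))\<^sup>2) \<partial>torus)"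
      by (simp add: ennreal_power)
  qed
  also have "\<dots> = (\<integral>\<^sup>+p. ennreal (case p of (t, x) \<Rightarrow> (cmod (G t x))\<^sup>2) \<partial>(lborel \<Otimes>\<^sub>M torus))"
    by (subst torus.nn_integral_fst[symmetric]) (auto simp: case_prod_unfold)
  also have "\<dots> < \<infinity>"
    using G2 unfolding integrable_iff_bounded by (simp add: case_prod_unfold)
  finally show ?int by (simp add: integrable_iff_bounded)
qed

section \<open>The remainder \<open>D\<close> and the gauge phase\<close>

context
  fixes \<delta> s b :: real and f :: "point \<Rightarrow> complex" and D :: "real \<Rightarrow> point \<Rightarrow> complex" and w :: "real \<Rightarrow> point \<Rightarrow> complex"
  assumes \<delta>: "\<delta> > 0" and sol: "gauged_solution \<delta> s b f D"
    and w: "\<And>t x. w t x = schroedinger t f x + D t x"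
begin

abbreviation time :: "real measure" where "time \<equiv> restrict_space lborel {0..\<delta>}"

lemma w_eq: "w = (\<lambda>t x. schroedinger t f x + D t x)"
  by (intro ext w)

lemma w_sol:
  "(\<lambda>(t, x). D t x) \<in> borel_measurable (slab \<delta>)"
  "\<And>t x. t \<in> {0..\<delta>} \<Longrightarrow> D t x = fsum (fcoeff (D t)) x"
  "X_norm_on \<delta> s b D \<le> 1"
  "integrable (slab \<delta>) (\<lambda>(t, x). (cmod (w t x)) ^ 5)"
  "\<And>t n. t \<in> {0..\<delta>} \<Longrightarrow> \<i> * fcoeff (D t) n =
          (LINT r:{0..t}|lborel. of_real ((norm (fvec n))\<^sup>2) * fcoeff (D r) n + fcoeff (quintic (w r)) n)"
  using sol unfolding gauged_solution_def Let_def w_eq[symmetric] w[symmetric] by blast+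

lemma finite_measure_time: "finite_measure time"
  using \<delta> by (intro finite_measureI) (simp add: space_restrict_space emeasure_restrict_space)

lemma pair_time: "pair_sigma_finite time torus"
proof -
  interpret finite_measure time by (rule finite_measure_time)
  show ?thesis ..
qed

lemma D_measurable [measurable]: "(\<lambda>(t, x). D t x) \<in> borel_measurable (time \<Otimes>\<^sub>M torus)"
  using w_sol(1) by (simp add: slab_def)

lemma D_section: "t \<in> {0..\<delta>} \<Longrightarrow> D t \<in> borel_measurable torus"
  using measurable_compose[OF measurable_Pair1' D_measurable, of t] by (simp add: space_restrict_space)

lemma time_measurable [measurable]: "(\<lambda>t. t) \<in> borel_measurable time"
  by (rule measurable_restrict_space1) simp

lemma w_measurable [measurable]: "(\<lambda>(t, x). w t x) \<in> borel_measurable (time \<Otimes>\<^sub>M torus)"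
proof -
  have "(\<lambda>p. (fst p, snd p)) \<in> (time \<Otimes>\<^sub>M torus) \<rightarrow>\<^sub>M (borel \<Otimes>\<^sub>M borel)"
    by (intro measurable_Pair measurable_compose[OF measurable_fst time_measurable]
      measurable_compose[OF measurable_snd measurable_ident_sets]) simp
  from measurable_compose[OF this schroedinger_measurable[of f]]
  have "(\<lambda>p. schroedinger (fst p) f (snd p)) \<in> borel_measurable (time \<Otimes>\<^sub>M torus)" by simp
  then have "(\<lambda>p. schroedinger (fst p) f (snd p) + D (fst p) (snd p)) \<in> borel_measurable (time \<Otimes>\<^sub>M torus)"
    using D_measurable unfolding case_prod_unfold by (rule borel_measurable_add)
  then show ?thesis by (simp add: w case_prod_unfold)
qed

lemma w_section: "t \<in> {0..\<delta>} \<Longrightarrow> w t \<in> borel_measurable borel"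
  using measurable_compose[OF measurable_Pair1' w_measurable, of t]
  by (simp add: space_restrict_space measurable_cong_sets[OF sets_torus refl])

lemma w5_finite: "(\<integral>\<^sup>+t. \<integral>\<^sup>+x. ennreal (cmod (w t x) ^ 5) \<partial>torus \<partial>time) < \<infinity>"
proof -
  have "(\<integral>\<^sup>+t. \<integral>\<^sup>+x. ennreal (cmod (w t x) ^ 5) \<partial>torus \<partial>time) =
    (\<integral>\<^sup>+p. ennreal (cmod (w (fst p) (snd p)) ^ 5) \<partial>(time \<Otimes>\<^sub>M torus))"
    by (subst torus.nn_integral_fst[symmetric]) (use w_measurable in \<open>auto simp: case_prod_unfold\<close>)
  then show ?thesis
    using w_sol(4) unfolding integrable_iff_bounded slab_def by (simp add: case_prod_unfold)
qed

text \<open>The slab has finite measure and v^4 \<le> 1 + v^5, so the fifth-power condition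
  suffices.\<close>

lemma phase_integrable: "set_integrable lborel {0..\<delta>} (\<lambda>r. LINT y|torus. cmod (w r y) ^ 4)"
proof -
  interpret T: finite_measure time by (rule finite_measure_time)
  interpret P: pair_sigma_finite time torus by (rule pair_time)
  interpret TT: finite_measure "time \<Otimes>\<^sub>M torus"
    by (rule finite_measure_pair_measure[OF torus.finite_measure_axioms T.finite_measure_axioms])
  have "integrable (time \<Otimes>\<^sub>M torus) (\<lambda>p. cmod (w (fst p) (snd p)) ^ 4)"
  proof (rule Bochner_Integration.integrable_bound)
    show "integrable (time \<Otimes>\<^sub>M torus) (\<lambda>p. 1 + cmod (w (fst p) (snd p)) ^ 5)"
      using w_sol(4) by (intro Bochner_Integration.integrable_add) (auto simp: slab_def case_prod_unfold)
    show "AE p in time \<Otimes>\<^sub>M torus. norm (cmod (w (fst p) (snd p)) ^ 4) \<le> norm (1 + cmod (w (fst p) (snd p)) ^ 5)"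
    proof (rule AE_I2)
      fix p
      have "v ^ 4 \<le> 1 + v ^ 5" if "v \<ge> 0" for v :: real
      proof (cases "v \<le> 1")
        case True
        then show ?thesis using that power_le_one[of v 4] by (simp add: add_increasing2)
      next
        case False
        then have "v ^ 4 \<le> v ^ 5" by (intro power_increasing) auto
        then show ?thesis by simp
      qed
      then show "norm (cmod (w (fst p) (snd p)) ^ 4) \<le> norm (1 + cmod (w (fst p) (snd p)) ^ 5)" by simp
    qed
  qed (use w_measurable in \<open>simp add: case_prod_unfold\<close>)
  from P.integrable_fst'[OF this]
  have "integrable time (\<lambda>r. LINT y|torus. cmod (w r y) ^ 4)" by simp
  then show ?thesis by (simp add: integrable_restrict_space set_integrable_def)
qed

lemma quintic_integrable: "integrable time (\<lambda>r. fcoeff (quintic (w r)) n)"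
  unfolding integrable_iff_bounded
proof
  have "(\<lambda>p. of_real (cmod (w (fst p) (snd p)) ^ 4) * w (fst p) (snd p) -
      3 * w (fst p) (snd p) * of_real (LINT y|torus. cmod (w (fst p) y) ^ 4)) \<in> borel_measurable (time \<Otimes>\<^sub>M torus)"
    using w_measurable by measurable
  then have [measurable]: "(\<lambda>(r, x). quintic (w r) x) \<in> borel_measurable (time \<Otimes>\<^sub>M torus)"
    by (simp add: quintic_def case_prod_unfold)
  show "(\<lambda>r. fcoeff (quintic (w r)) n) \<in> borel_measurable time"
    unfolding fcoeff_def by measurable
  have "(\<integral>\<^sup>+r. ennreal (cmod (fcoeff (quintic (w r)) n)) \<partial>time) \<le> (\<integral>\<^sup>+r. 7 * (\<integral>\<^sup>+x. ennreal (cmod (w r x) ^ 5) \<partial>torus) \<partial>time)"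
    by (intro nn_integral_mono norm_fcoeff_quintic_le w_section) (simp add: space_restrict_space)
  also have "\<dots> = 7 * (\<integral>\<^sup>+r. (\<integral>\<^sup>+x. ennreal (cmod (w r x) ^ 5) \<partial>torus) \<partial>time)"
    by (rule nn_integral_cmult) measurable
  also have "\<dots> < \<infinity>" using w5_finite by (simp add: ennreal_mult_less_top)
  finally show "(\<integral>\<^sup>+r. ennreal (cmod (fcoeff (quintic (w r)) n)) \<partial>time) < \<infinity>" .
qed

text \<open>Fubini turns equality almost everywhere on the slab into equality of functions of x for
  almost every time. Nothing is learnt at a given time, which is why continuity is brought in
  afterwards.\<close>

lemma AE_fcoeff_eq:
  assumes G: "AE (t, x) in slab \<delta>. G t x = D t x" and F: "spacetime_fourier G \<Gamma>"
  shows "AE t in lborel. t \<in> {0..\<delta>} \<longrightarrow> fcoeff (G t) n = fcoeff (D t) n"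
proof -
  interpret P: pair_sigma_finite time torus by (rule pair_time)
  have Gm: "(\<lambda>(t, x). G t x) \<in> borel_measurable (lborel \<Otimes>\<^sub>M torus)"
    using F by (auto simp: spacetime_fourier_def)
  have [measurable]: "G t \<in> borel_measurable torus" for t
    using measurable_compose[OF measurable_Pair1' Gm, of t] by simp
  have "AE t in time. AE x in torus. G t x = D t x"
    using P.AE_pair[OF G[unfolded slab_def]] by simp
  then have "AE t in lborel. t \<in> {0..\<delta>} \<longrightarrow> (AE x in torus. G t x = D t x)"
    by (simp add: AE_restrict_space_iff)
  then show ?thesis
  proof eventually_elim
    case (elim t)
    show ?case
    proof
      assume t: "t \<in> {0..\<delta>}"
      note [measurable] = D_section[OF t]
      have "AE x in torus. G t x = D t x" using elim t by blast
      then show "fcoeff (G t) n = fcoeff (D t) n"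
        unfolding fcoeff_def by (intro integral_cong_AE) (auto simp: measurable_cong_sets[OF sets_torus refl, symmetric])
    qed
  qed
qed

text \<open>The integrated equation makes each coefficient an indefinite integral, continuous once
  its integrand is integrable. For the nonlinear part this is the fifth-power bound; for the linear
  part it is borrowed from the extension, whose coefficients are square integrable on a bounded
  interval and agree with those of \<open>D\<close> almost everywhere.\<close>

lemma continuous_on_fcoeff:
  assumes G: "AE (t, x) in slab \<delta>. G t x = D t x" and F: "spacetime_fourier G \<Gamma>"
  shows "continuous_on {0..\<delta>} (\<lambda>t. fcoeff (D t) n)"
proof -
  interpret T: finite_measure time by (rule finite_measure_time)
  have [measurable]: "(\<lambda>t. fcoeff (D t) n) \<in> borel_measurable time"
    unfolding fcoeff_def by measurable
  note Gn = fourier_coefficients_of_spacetime[OF F, of n]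
  have "integrable time (\<lambda>t. (cmod (fcoeff (G t) n))\<^sup>2)"
    using integrable_mult_indicator[OF _ Gn(2), of "{0..\<delta>}"] by (simp add: integrable_restrict_space)
  then have "integrable time (\<lambda>t. 1 + (cmod (fcoeff (G t) n))\<^sup>2)" by simp
  then have "integrable time (\<lambda>t. fcoeff (D t) n)"
  proof (rule Bochner_Integration.integrable_bound)
    have "AE t in time. fcoeff (G t) n = fcoeff (D t) n"
      using AE_fcoeff_eq[OF G F] by (simp add: AE_restrict_space_iff)
    then show "AE t in time. norm (fcoeff (D t) n) \<le> norm (1 + (cmod (fcoeff (G t) n))\<^sup>2)"
    proof eventually_elim
      case (elim t)
      have "1 * cmod (fcoeff (D t) n) \<le> 1\<^sup>2 + (cmod (fcoeff (D t) n))\<^sup>2" by (rule mult_le_sum_squares)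
      then show ?case by (simp add: elim)
    qed
  qed simp
  then have "integrable time (\<lambda>r. of_real ((norm (fvec n))\<^sup>2) * fcoeff (D r) n + fcoeff (quintic (w r)) n)"
    by (intro Bochner_Integration.integrable_add integrable_mult_right quintic_integrable)
  then have "set_integrable lborel {0..\<delta>} (\<lambda>r. of_real ((norm (fvec n))\<^sup>2) * fcoeff (D r) n + fcoeff (quintic (w r)) n)"
    by (simp only: integrable_restrict_space set_integrable_def) (simp add: integrable_restrict_space)
  then have "continuous_on {0..\<delta>} (\<lambda>t. LINT r:{0..t}|lborel.
      of_real ((norm (fvec n))\<^sup>2) * fcoeff (D r) n + fcoeff (quintic (w r)) n)"
    by (rule continuous_on_LINT_Icc)
  then have "continuous_on {0..\<delta>} (\<lambda>t. \<i> * fcoeff (D t) n)"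
    by (rule continuous_on_cong[THEN iffD1, rotated -1]) (auto simp: w_sol(5))
  then have "continuous_on {0..\<delta>} (\<lambda>t. - \<i> * (\<i> * fcoeff (D t) n))" by (rule continuous_on_mult_left)
  moreover have "- \<i> * (\<i> * z) = z" for z :: complex by (simp add: mult.assoc[symmetric])
  ultimately show ?thesis by (simp only:)
qed

lemma fcoeff_D_0: "fcoeff (D 0) n = 0"
proof -
  have "AE r in lborel. indicator {0..0::real} r *\<^sub>R
      (of_real ((norm (fvec n))\<^sup>2) * fcoeff (D r) n + fcoeff (quintic (w r)) n) = 0"
    using AE_lborel_singleton[of "0::real"] by eventually_elim (auto simp: indicator_def)
  then have "(LINT r:{0..0}|lborel. of_real ((norm (fvec n))\<^sup>2) * fcoeff (D r) n + fcoeff (quintic (w r)) n) = 0"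
    unfolding set_lebesgue_integral_def by (rule integral_eq_zero_AE)
  then show ?thesis using w_sol(5)[of 0 n] \<delta> by simp
qed

text \<open>The coefficients of \<open>D\<close> at interior times are those of the continuous curve
  attached to \<Gamma>. As \<open>D\<close> is by definition the sum of its Fourier series at every
  point, the uniform convergence of the curve's series gives a limit as t tends to 0, and that limit
  has vanishing coefficients.\<close>

lemma D_tendsto_0:
  assumes s: "s > 1 / 2" and b: "b > 1 / 2"
  shows "AE x in torus. ((\<lambda>t. D t x) \<longlongrightarrow> 0) (at_right 0)"
proof -
  have "X_norm_on \<delta> s b D < \<top>" using w_sol(3) by (rule le_less_trans) simp
  then obtain G where G: "AE (t, x) in slab \<delta>. G t x = D t x" "X_norm s b G < \<top>"
    unfolding X_norm_on_def INF_less_iff by auto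
  then obtain \<Gamma> where \<Gamma>: "spacetime_fourier G \<Gamma>" and "ennreal_sqrt (X_energy s b \<Gamma>) < \<top>"
    unfolding X_norm_def X_weight_def[symmetric] X_energy_def[symmetric] INF_less_iff by auto
  then have fin: "X_energy s b \<Gamma> < \<infinity>"
    by (auto simp: ennreal_sqrt_def less_top split: if_splits)
  have \<Gamma>m: "\<And>n. \<Gamma> n \<in> borel_measurable lborel" using \<Gamma> unfolding spacetime_fourier_def by blast
  note prem = \<Gamma>m s b fin
  have cont_curve: "continuous_on UNIV (curve \<Gamma> n)" for n by (rule continuous_on_curve[OF prem])
  have cont_D: "continuous_on {0..\<delta>} (\<lambda>t. fcoeff (D t) n)" for n by (rule continuous_on_fcoeff[OF G(1) \<Gamma>])
  \<comment> \<open>Inversion needs a two-sided neighbourhood of the time, so the endpoint 0 is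
    excluded here and reached by a limit later.\<close>
  have eq: "curve \<Gamma> n t = fcoeff (D t) n" if t: "0 < t" "t < \<delta>" for n t
  proof (rule curve_eqI[OF prem], rule fourier_inversion)
    show "(\<lambda>t. fcoeff (G t) n) \<in> borel_measurable lborel" "integrable lborel (\<lambda>t. (cmod (fcoeff (G t) n))\<^sup>2)"
      by (rule fourier_coefficients_of_spacetime[OF \<Gamma>])+
    show "integrable lborel (\<Gamma> n)" by (rule integrable_\<Gamma>[OF prem])
    show "((\<lambda>T. \<integral>\<^sup>+\<tau>. ennreal ((cmod (\<Gamma> n \<tau> - (LINT t:{-T..T}|lborel. fcoeff (G t) n * cis (- (\<tau> * t)))))\<^sup>2) \<partial>lborel)
      \<longlongrightarrow> 0) at_top"
      using \<Gamma> unfolding spacetime_fourier_def by blast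
    fix e :: real assume e: "e > 0"
    have "isCont (\<lambda>t. fcoeff (D t) n) t"
      using continuous_on_interior[OF cont_D, of t] t by simp
    then obtain \<eta>0 where \<eta>0: "\<eta>0 > 0" "\<And>r. \<bar>r - t\<bar> < \<eta>0 \<Longrightarrow> cmod (fcoeff (D r) n - fcoeff (D t) n) < e"
      unfolding continuous_at_eps_delta dist_norm using e by (auto simp: real_norm_def)
    \<comment> \<open>The minimum keeps the neighbourhood inside [0, \<delta>], where the extension
      and \<open>D\<close> share their coefficients almost everywhere.\<close>
    define \<eta> where "\<eta> = min \<eta>0 (min t (\<delta> - t))"
    have "AE r in lborel. \<bar>t - r\<bar> < \<eta> \<longrightarrow> cmod (fcoeff (G r) n - fcoeff (D t) n) \<le> e"
      using AE_fcoeff_eq[OF G(1) \<Gamma>, of n]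
    proof eventually_elim
      case (elim r)
      show ?case
      proof
        assume "\<bar>t - r\<bar> < \<eta>"
        then have "\<bar>r - t\<bar> < \<eta>0" "r \<in> {0..\<delta>}" unfolding \<eta>_def by (auto simp: abs_if split: if_splits)
        then show "cmod (fcoeff (G r) n - fcoeff (D t) n) \<le> e" using elim \<eta>0(2)[of r] by simp
      qed
    qed
    moreover have "\<eta> > 0" using \<eta>0 t by (simp add: \<eta>_def)
    ultimately show "\<exists>\<eta>>0. AE r in lborel. \<bar>t - r\<bar> < \<eta> \<longrightarrow> cmod (fcoeff (G r) n - fcoeff (D t) n) \<le> e" by blast
  qed (rule \<Gamma>m)
  have near: "\<forall>\<^sub>F t in at_right 0. t \<in> {0<..<\<delta>}"
    using \<delta> by (rule eventually_at_right_real)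
  \<comment> \<open>The curve is continuous at 0 and coincides to the right of 0 with coefficients
    of \<open>D\<close>, which tend to their initial value 0.\<close>
  have curve_0: "curve \<Gamma> n 0 = 0" for n
  proof -
    have "(curve \<Gamma> n \<longlongrightarrow> curve \<Gamma> n 0) (at_right 0)"
      using cont_curve[of n] by (auto simp: continuous_on_def intro: tendsto_within_subset)
    moreover have "((\<lambda>t. fcoeff (D t) n) \<longlongrightarrow> 0) (at_right 0)"
      using cont_D[of n] \<delta> unfolding continuous_on_def
      by (metis at_within_Icc_at_right atLeastAtMost_iff fcoeff_D_0 less_imp_le order_refl)
    then have "(curve \<Gamma> n \<longlongrightarrow> 0) (at_right 0)"
      by (rule Lim_transform_eventually) (use near in \<open>eventually_elim, simp add: eq\<close>)
    ultimately show ?thesis by (rule tendsto_unique[rotated]) simp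
  qed
  show ?thesis using AE_uniform_limit_curve[OF prem]
  proof eventually_elim
    case (elim x)
    have "continuous_on UNIV (\<lambda>t. fsum (\<lambda>n. curve \<Gamma> n t) x)"
      by (rule uniform_limit_theorem[OF _ elim])
        (auto intro!: always_eventually continuous_intros continuous_on_subset[OF cont_curve])
    then have "((\<lambda>t. fsum (\<lambda>n. curve \<Gamma> n t) x) \<longlongrightarrow> fsum (\<lambda>n. curve \<Gamma> n 0) x) (at_right 0)"
      by (auto simp: continuous_on_def intro: tendsto_within_subset)
    moreover have "fsum (\<lambda>n. curve \<Gamma> n 0) x = 0" by (simp add: curve_0 fsum_def)
    ultimately have "((\<lambda>t. fsum (\<lambda>n. curve \<Gamma> n t) x) \<longlongrightarrow> 0) (at_right 0)" by simp
    then show ?case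
    proof (rule Lim_transform_eventually)
      show "\<forall>\<^sub>F t in at_right 0. fsum (\<lambda>n. curve \<Gamma> n t) x = D t x"
        using near
      proof eventually_elim
        case (elim t)
        then have "D t x = fsum (fcoeff (D t)) x" by (intro w_sol(2)) auto
        moreover have "fcoeff (D t) = (\<lambda>n. curve \<Gamma> n t)" using elim by (auto simp: eq)
        ultimately show ?case by simp
      qed
    qed
  qed
qed

lemma phase_tendsto:
  "((\<lambda>t. cis (- 3 * (LINT r:{0..t}|lborel. (LINT y|torus. cmod (w r y) ^ 4)))) \<longlongrightarrow> 1) (at_right 0)"
proof -
  let ?I = "\<lambda>t. LINT r:{0..t}|lborel. (LINT y|torus. cmod (w r y) ^ 4)"
  have "(?I \<longlongrightarrow> ?I 0) (at_right 0)"
    using continuous_on_LINT_Icc[OF phase_integrable] \<delta> unfolding continuous_on_def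
    by (metis at_within_Icc_at_right atLeastAtMost_iff less_imp_le order_refl)
  moreover have "?I 0 = 0"
  proof -
    have "AE r in lborel. indicator {0..0::real} r *\<^sub>R (LINT y|torus. cmod (w r y) ^ 4) = 0"
      using AE_lborel_singleton[of "0::real"] by eventually_elim (auto simp: indicator_def)
    then show ?thesis unfolding set_lebesgue_integral_def by (rule integral_eq_zero_AE)
  qed
  ultimately have "(?I \<longlongrightarrow> 0) (at_right 0)" by simp
  then have "((\<lambda>t. cis (- 3 * ?I t)) \<longlongrightarrow> cis (- 3 * 0)) (at_right 0)"
    by (intro tendsto_intros)
  then show ?thesis by simp
qed

end

text \<open>Deterministic once the block bounds hold. The formula for \<open>u\<close> is valid at
  every x and every t in [0, \<delta>], so the exceptional set of x is that of \<open>D\<close>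
  together with the complement of the cell and does not depend on t.\<close>

lemma nls_solution_tendsto:
  fixes c :: "freq \<Rightarrow> complex"
  assumes "summable B"
    and "\<And>k m t x y. 2 ^ k \<le> m \<Longrightarrow> m \<le> 2 ^ Suc k \<Longrightarrow> t \<in> {0..1} \<Longrightarrow> x \<in> {0..7} \<Longrightarrow> y \<in> {0..7} \<Longrightarrow>
      cmod (\<Sum>n\<in>sq m - sq (2 ^ k). c n * wave t (x, y) n) \<le> B k"
    and \<delta>: "\<delta> > 0" and s: "s > 1 / 2" and b: "b > 1 / 2" and u: "nls_solution \<delta> s b (fsum c) u"
  shows "AE x in torus. ((\<lambda>t. u t x) \<longlongrightarrow> fsum c x) (at_right 0)"
proof -
  obtain D where D: "gauged_solution \<delta> s b (fsum c) D"
    and u: "\<And>t x. t \<in> {0..\<delta>} \<Longrightarrow> u t x = cis (- 3 * (LINT r:{0..t}|lborel.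
      (LINT y|torus. (cmod (schroedinger r (fsum c) y + D r y)) ^ 4))) * (schroedinger t (fsum c) x + D t x)"
    using u unfolding nls_solution_def Let_def by blast
  let ?u = "\<lambda>t x. cis (- 3 * (LINT r:{0..t}|lborel.
      (LINT y|torus. (cmod (schroedinger r (fsum c) y + D r y)) ^ 4))) * (schroedinger t (fsum c) x + D t x)"
  note ph = phase_tendsto[OF \<delta> D refl]
  show ?thesis
    using D_tendsto_0[OF \<delta> D refl s b] AE_torus_cell
  proof eventually_elim
    case (elim x)
    have "((\<lambda>t. ?u t x) \<longlongrightarrow> 1 * (fsum c x + 0)) (at_right 0)"
      by (intro tendsto_mult tendsto_add ph elim(1) schroedinger_tendsto[OF assms(1,2) elim(2)])
    then have "((\<lambda>t. ?u t x) \<longlongrightarrow> fsum c x) (at_right 0)" by simp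
    moreover have "\<forall>\<^sub>F t in at_right 0. t \<in> {0<..<\<delta>}"
      using \<delta> by (rule eventually_at_right_real)
    ultimately show ?case
      by (elim Lim_transform_eventually) (auto simp: u elim!: eventually_mono)
  qed
qed

text \<open>The exceptional set of \<omega> is that of the block bounds for the free evolution; it
  is therefore common to all lifespans and all solutions.\<close>

theorem theorem1p1:
  fixes M :: "'w measure" and g :: "freq \<Rightarrow> 'w \<Rightarrow> complex" and \<alpha> \<sigma> :: real
  assumes "prob_space M"
    and "prob_space.indep_vars M (\<lambda>_. borel) g UNIV"
    and "\<And>n. complex_std_gaussian M (g n)"
    and "\<alpha> > 0"
    and "0 \<le> \<sigma>" "\<sigma> < 1 / 2" "\<alpha> + \<sigma> > 1 / 2"
  shows "\<exists>\<beta>\<^sub>0>0. \<forall>\<beta>. 0 < \<beta> \<and> \<beta> < \<beta>\<^sub>0 \<longrightarrow>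
    (AE \<omega> in M. \<forall>\<delta>>0. \<forall>u. nls_solution \<delta> (\<alpha> + \<sigma>) (1 / 2 + \<beta>) (datum \<alpha> g \<omega>) u \<longrightarrow>
      (AE x in torus. ((\<lambda>t. u t x) \<longlongrightarrow> datum \<alpha> g \<omega> x) (at_right 0)))"
\<comment> \<open>The witness for \<open>\<beta>\<^sub>0\<close> is 1: each \<beta> > 0 gives b >
  1/2, as the estimate of \<open>D\<close> requires.\<close>
proof (intro exI[of _ 1] conjI allI impI)
  fix \<beta> :: real assume \<beta>: "0 < \<beta> \<and> \<beta> < 1"
  show "AE \<omega> in M. \<forall>\<delta>>0. \<forall>u. nls_solution \<delta> (\<alpha> + \<sigma>) (1 / 2 + \<beta>) (datum \<alpha> g \<omega>) u \<longrightarrow>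
      (AE x in torus. ((\<lambda>t. u t x) \<longlongrightarrow> datum \<alpha> g \<omega> x) (at_right 0))"
    using prob_space.random_wave_blocks[OF assms(1-4)]
  proof eventually_elim
    case (elim \<omega>)
    then obtain B where B: "summable B"
      "\<And>k m t x y. 2 ^ k \<le> m \<Longrightarrow> m \<le> 2 ^ Suc k \<Longrightarrow> t \<in> {0..1} \<Longrightarrow> x \<in> {0..7} \<Longrightarrow> y \<in> {0..7} \<Longrightarrow>
        cmod (\<Sum>n\<in>sq m - sq (2 ^ k). g n \<omega> / of_real (jbr (fvec n) powr (1 + \<alpha>)) * wave t (x, y) n) \<le> B k"
      by blast
    show ?case
      unfolding datum_def using \<beta> assms(7) by (intro allI impI nls_solution_tendsto[OF B]) auto
  qed
qed simp

end
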